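(* For each $\alpha>0$ there exists a constant $C_\alpha>0$ such that for all $n\ge2$, $$\frac{1}{C_\alpha}f_\alpha(n)\le R_\alpha(\widehat\sigma_2)\le C_\alpha f_\alpha(n)\qquad\text{and}\qquad \frac{1}{C_\alpha}g_\alpha(n)\le R_\alpha(\widehat\sigma_J)\le C_\alpha g_\alpha(n),$$ where $$f_\alpha(n)=\begin{cases} n^{2-\alpha},&\alpha\in(0,2),\\ \log n,&\alpha=2,\\ 1,&\alpha>2,\end{cases}\qquad\qquad g_\alpha(n)=\begin{cases} n^{2-\alpha},&\alpha\in(0,2),\\ (\log n)^2,&\alpha=2,\\ \log n,&\alpha>2.\end{cases}$$ Here $\widehat\sigma_2$ and $\widehat\sigma_J$ are the Jordan-2 ordering and the Jordan ordering of the uniform random recursive tree $T_n$.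
   Context: The uniform random recursive tree $T_n$ on vertex set $[n]=\{1,\dots,n\}$ is sampled recursively: $T_1$ is the single vertex $1$ (the root); given $T_n$, choose $u\in\{1,\dots,n\}$ uniformly at random, independently of $T_1,\dots,T_n$, and add a new vertex $n+1$ together with the edge $\{u,n+1\}$. For a finite tree $t$ and vertices $u,v$, let $(t,u)_{v\downarrow}$ be the subtree of $v$ in the tree $t$ rooted at $u$ (the vertices $w$ such that $v$ lies on the path from $u$ to $w$), and $|\cdot|$ its number of vertices. The Jordan centrality is $\phi_t(v)=\min_{u\sim v}|(t,u)_{v\downarrow}|$, the minimum being over neighbors $u$ of $v$ in $t$. Let $v^{(1)}=\arg\min_{u\sim v}|(t,u)_{v\downarrow}|$. The Jordan-2 centrality is $$\phi_t^{(2)}(v)=\phi_t(v)\cdot\max\big(\phi_t(v^{(1)}),\phi_t(v)\big);$$ if $v^{(1)}$ is not uniquely defined, it is chosen among the minimizers so that the resulting value of $\phi^{(2)}_t(v)$ is smallest. The Jordan ordering $\widehat\sigma_J$ (resp. Jordan-2 ordering $\widehat\sigma_2$) ranks the vertices of $T_n$ decreasingly by $\phi_{T_n}$ (resp. $\phi^{(2)}_{T_n}$), the largest value getting rank $1$, with ties broken uniformly at random; $\widehat\sigma(v)$ denotes the rank of $v$. The risk of such an ordering $\widehat\sigma$ is $$R_\alpha(\widehat\sigma)=\mathbb{E}\Big[\sum_{v\in[n]}\frac{|\widehat\sigma(v)-v|}{v^\alpha}\Big].$$ *)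

theory Defs
  imports
    "HOL-Probability.Probability"
    "HOL-Combinatorics.Permutations"
    "Graph_Theory.Pair_Digraph"
    "Graph_Theory.Vertex_Walk"
begin

text \<open>An undirected graph is represented by its symmetric digraph, so an edge
  \<open>{u, w}\<close> contributes the two arcs \<open>(u, w)\<close> and \<open>(w, u)\<close>.\<close>

definition add_leaf :: "'a pair_pre_digraph \<Rightarrow> 'a \<Rightarrow> 'a \<Rightarrow> 'a pair_pre_digraph" where
  "add_leaf t u w =
     \<lparr> pverts = insert w (pverts t), parcs = parcs t \<union> {(u, w), (w, u)} \<rparr>"

text \<open>Law of the uniform random recursive tree \<open>T\<^sub>n\<close> on \<open>{1..n}\<close>; the value at
  \<open>n = 0\<close> (empty graph) is a dummy.\<close>

fun recursive_tree_pmf :: "nat \<Rightarrow> nat pair_pre_digraph pmf" where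
  "recursive_tree_pmf 0 = return_pmf \<lparr> pverts = {}, parcs = {} \<rparr>"
| "recursive_tree_pmf (Suc 0) = return_pmf \<lparr> pverts = {1}, parcs = {} \<rparr>"
| "recursive_tree_pmf (Suc (Suc n)) =
     bind_pmf (recursive_tree_pmf (Suc n)) (\<lambda>t.
     bind_pmf (pmf_of_set {1..Suc n}) (\<lambda>u.
       return_pmf (add_leaf t u (Suc (Suc n)))))"

definition neighbors :: "'a pair_pre_digraph \<Rightarrow> 'a \<Rightarrow> 'a set" where
  "neighbors t v = {u. (u, v) \<in> parcs t}"

text \<open>\<open>(t, u)\<^sub>v\<^sub>\<down>\<close>: a \<open>vpath\<close> is a walk without repeated vertices, so in a tree it
  is the unique path between its endpoints.\<close>

definition subtree_of :: "'a pair_pre_digraph \<Rightarrow> 'a \<Rightarrow> 'a \<Rightarrow> 'a set" where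
  "subtree_of t u v =
     {w \<in> pverts t. \<exists>p. vpath p (with_proj t) \<and> hd p = u \<and> last p = w \<and> v \<in> set p}"

definition jordan :: "'a pair_pre_digraph \<Rightarrow> 'a \<Rightarrow> nat" where
  "jordan t v = Min ((\<lambda>u. card (subtree_of t u v)) ` neighbors t v)"

definition jordan_minimizers :: "'a pair_pre_digraph \<Rightarrow> 'a \<Rightarrow> 'a set" where
  "jordan_minimizers t v =
     {u. is_arg_min (\<lambda>u. card (subtree_of t u v)) (\<lambda>u. u \<in> neighbors t v) u}"

text \<open>The outer \<open>Min\<close> resolves ties in the choice of \<open>v\<^sup>(\<^sup>1\<^sup>)\<close>: the minimizer giving
  the smallest value is taken.\<close>

definition jordan2 :: "'a pair_pre_digraph \<Rightarrow> 'a \<Rightarrow> nat" where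
  "jordan2 t v =
     Min ((\<lambda>v1. jordan t v * max (jordan t v1) (jordan t v)) ` jordan_minimizers t v)"

text \<open>The bijections \<open>\<sigma>\<close> of \<open>{1..n}\<close> (vertex to rank) that order the vertices decreasingly
  by score. Each of them amounts to one choice of an order within every group of tied vertices,
  so breaking ties uniformly at random means drawing uniformly from this set.\<close>

definition decreasing_rankings :: "nat \<Rightarrow> (nat \<Rightarrow> nat) \<Rightarrow> (nat \<Rightarrow> nat) set" where
  "decreasing_rankings n s =
     {\<sigma>. \<sigma> permutes {1..n} \<and> (\<forall>u\<in>{1..n}. \<forall>v\<in>{1..n}. s u > s v \<longrightarrow> \<sigma> u < \<sigma> v)}"

lemma finite_decreasing_rankings: "finite (decreasing_rankings n s)"
  by (rule finite_subset[OF _ finite_permutations[of "{1..n}"]])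
     (auto simp: decreasing_rankings_def)

lemma decreasing_rankings_nonempty: "decreasing_rankings n s \<noteq> {}"
proof -
  define xs where "xs = rev (sort_key s [1..<Suc n])"
  define g where "g i = (if i \<in> {1..n} then xs ! (i - 1) else i)" for i
  have len: "length xs = n" and set: "set xs = {1..n}" and dist: "distinct xs"
    by (auto simp: xs_def)
  have sorted: "s (xs ! j) \<le> s (xs ! i)" if "i \<le> j" "j < n" for i j
  proof -
    have "sorted (rev (map s xs))"
      by (simp add: xs_def rev_map)
    then show ?thesis
      using sorted_rev_nth_mono[of "map s xs" i j] that len by simp
  qed
  have g: "g permutes {1..n}"
  proof (rule bij_imp_permutes)
    have "bij_betw (\<lambda>i. i - 1) {1..n} {..<n}"
      by (rule bij_betwI[where g = Suc]) auto
    moreover have "bij_betw (\<lambda>i. xs ! i) {..<n} {1..n}"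
      by (rule bij_betw_nth) (use len set dist in auto)
    ultimately have "bij_betw (\<lambda>i. xs ! (i - 1)) {1..n} {1..n}"
      using bij_betw_trans by (fastforce simp: o_def)
    then show "bij_betw g {1..n} {1..n}"
      by (subst bij_betw_cong[where g = "\<lambda>i. xs ! (i - 1)"]) (auto simp: g_def)
  qed (auto simp: g_def)
  have "inv g u < inv g v" if "u \<in> {1..n}" "v \<in> {1..n}" "s u > s v" for u v
  proof (rule ccontr)
    assume "\<not> inv g u < inv g v"
    then have le: "inv g v - 1 \<le> inv g u - 1" by simp
    have mem: "inv g u \<in> {1..n}" "inv g v \<in> {1..n}"
      using permutes_in_image[OF permutes_inv[OF g]] that by auto
    then have "s (g (inv g u)) \<le> s (g (inv g v))"
      using sorted[OF le] by (auto simp: g_def)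
    then show False
      using that(3) by (simp add: permutes_inverses[OF g])
  qed
  then have "inv g \<in> decreasing_rankings n s"
    using permutes_inv[OF g] by (auto simp: decreasing_rankings_def)
  then show ?thesis by blast
qed

definition ranking_pmf ::
  "(nat pair_pre_digraph \<Rightarrow> nat \<Rightarrow> nat) \<Rightarrow> nat \<Rightarrow> (nat \<Rightarrow> nat) pmf" where
  "ranking_pmf c n =
     bind_pmf (recursive_tree_pmf n) (\<lambda>t. pmf_of_set (decreasing_rankings n (c t)))"

definition risk :: "real \<Rightarrow> nat \<Rightarrow> (nat \<Rightarrow> nat) pmf \<Rightarrow> real" where
  "risk \<alpha> n P =
     measure_pmf.expectation P (\<lambda>\<sigma>. \<Sum>v\<in>{1..n}. \<bar>real (\<sigma> v) - real v\<bar> / real v powr \<alpha>)"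

definition f_rate :: "real \<Rightarrow> nat \<Rightarrow> real" where
  "f_rate \<alpha> n =
     (if \<alpha> < 2 then real n powr (2 - \<alpha>) else if \<alpha> = 2 then ln (real n) else 1)"

definition g_rate :: "real \<Rightarrow> nat \<Rightarrow> real" where
  "g_rate \<alpha> n =
     (if \<alpha> < 2 then real n powr (2 - \<alpha>) else if \<alpha> = 2 then (ln (real n))\<^sup>2 else ln (real n))"

end

theory Submission
  imports Defs
begin

text \<open>Write \<open>D(w)\<close> for the number of descendants of \<open>w\<close>, itself included, in the tree rooted at \<open>1\<close>. The score
\<open>\<phi>(v)\<close> is \<open>n\<close> minus the size of the largest component left when \<open>v\<close> is removed, so
\<open>\<phi>(v) \<le> D(v)\<close>, with equality unless \<open>v\<close> lies near the centroid. Since vertex \<open>v\<close> arrives as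
one of \<open>v\<close>, its share \<open>D(v) / n\<close> has mean \<open>1 / v\<close> and a bounded density after rescaling by \<open>v\<close>.

The risk is the sum of the expected displacements of the vertices \<open>v\<close>, weighted by \<open>v\<close> to the
power \<open>-\<alpha>\<close>, so everything reduces to bounding one displacement. The rank of \<open>v\<close> is at most \<open>v\<close> plus
the number of later vertices \<open>u\<close> whose score is at least that of \<open>v\<close>, and the question is how likely
such an inversion is. For the Jordan score it requires the share of \<open>v\<close>, of typical size \<open>1 / v\<close>, to
be as small as \<open>1 / u\<close>, which has probability of order \<open>v / u\<close>
(\<open>prob_jordan_le\<close>); summing over \<open>u\<close> gives an expected rank of order \<open>v (1 + log (n / v))\<close>. For the
Jordan-2 score the product of two shares, roughly those of \<open>v\<close> and of its parent, has to be small at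
once. Two shares have a bounded joint density, so this has probability of order \<open>(v / u)\<^sup>2\<close> up to
logarithms; the bound with exponent \<open>6/5\<close> proved in \<open>prob_jordan2_le\<close> is already summable, and the expected
rank is of order \<open>v\<close>.

Both analyses must survive the case that \<open>v\<close> lies near the centroid. The device is to freeze the
tree at a time \<open>m\<close> of order \<open>v\<close>. Each of the \<open>m\<close> vertices present then grows a clan of its own,
and the sizes of these clans form a Polya urn. The Jordan score of \<open>v\<close> is bounded below by its
own clan or by the union of all others (\<open>jordan_ge_clan\<close>), its Jordan-2 score by a product of two out
of three clan sizes (\<open>jordan2_ge_late\<close>, \<open>jordan2_ge_early\<close>), and for
urns the required anticoncentration is a short induction: the supremum of the point probabilities
shrinks at each step (\<open>prob_N_eq\<close>, \<open>prob_N_eq_pair\<close>).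

The lower bounds come from symmetries. If \<open>v < w\<close> and the labels \<open>v\<close> and \<open>w\<close> can be
exchanged without destroying the increasing order along branches, then no ranking that depends on the
unlabelled tree only can tell them apart, and together they are misplaced by at least \<open>w - v\<close> on average. For
\<open>w = 2 v\<close> the exchange is possible with probability bounded below, which yields displacements of order
\<open>v\<close> for every score that ignores labels (\<open>avg_displacement_pair_ge\<close>). The additional logarithm for the Jordan
score comes from a vertex \<open>v\<close> that is still a leaf when \<open>u\<close> arrives, an event of probability
\<open>(v - 1) / (u - 1)\<close>: from then on \<open>u\<close> and \<open>v\<close> grow alike, so \<open>u\<close> overtakes
\<open>v\<close> with conditional probability one half (\<open>avg_overtake_ge\<close>).\<close>

section \<open>Recursive trees as attachment histories\<close>

text \<open>The parents chosen by the vertices \<open>2, \<dots>, n\<close> are independent and uniform, so a recursive tree is a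
uniform element of a finite product. Expectations then are finite averages, and measure preserving
transformations are bijections of this set.\<close>

definition histories :: "nat \<Rightarrow> (nat \<Rightarrow> nat) set" where
  "histories n = PiE {2..n} (\<lambda>k. {1..<k})"

definition history_tree :: "nat \<Rightarrow> (nat \<Rightarrow> nat) \<Rightarrow> nat pair_pre_digraph" where
  "history_tree n p =
     \<lparr> pverts = {1..n}, parcs = (\<Union>k\<in>{2..n}. {(p k, k), (k, p k)}) \<rparr>"

lemma history_parent:
  assumes "p \<in> histories n" "2 \<le> k" "k \<le> n"
  shows "1 \<le> p k" "p k < k"
  using assms by (auto simp: histories_def PiE_def Pi_def)

lemma finite_histories [simp]: "finite (histories n)"
  unfolding histories_def by (rule finite_PiE) auto

lemma card_histories: "card (histories n) = fact (n - 1)"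
proof -
  have "card (histories n) = (\<Prod>k\<in>{2..n}. k - 1)"
    unfolding histories_def by (simp add: card_PiE)
  also have "\<dots> = (\<Prod>k\<in>{1..n - 1}. k)"
    by (rule prod.reindex_bij_witness[of _ Suc "\<lambda>k. k - 1"]) auto
  finally show ?thesis
    by (simp add: fact_prod)
qed

lemma histories_nonempty [simp]: "histories n \<noteq> {}"
  using card_histories[of n] by (metis card.empty fact_nonzero)

lemma histories_update:
  assumes "p \<in> histories n" "2 \<le> k" "k \<le> n" "x \<in> {1..<k}"
  shows "p(k := x) \<in> histories n"
  using assms by (auto simp: histories_def PiE_def Pi_def extensional_def)

text \<open>The first vertex of \<open>R\<close> on the way from \<open>y\<close> to the root. The test \<open>p y < y\<close> only serves termination: in a
history it fails at \<open>y = 1\<close> alone, and \<open>1\<close> belongs to every set \<open>R\<close> used below.\<close>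

function anc :: "nat set \<Rightarrow> (nat \<Rightarrow> nat) \<Rightarrow> nat \<Rightarrow> nat" where
  "anc R p y = (if y \<in> R \<or> \<not> p y < y then y else anc R p (p y))"
  by auto
termination by (relation "Wellfounded.measure (\<lambda>(R, p, y). y)") auto

declare anc.simps [simp del]

lemma anc_root [simp]: "y \<in> R \<Longrightarrow> anc R p y = y"
  by (simp add: anc.simps)

lemma anc_le: "anc R p y \<le> y"
proof (induction y rule: less_induct)
  case (less y)
  show ?case
    using less[of "p y"] by (subst anc.simps) auto
qed

lemma anc_parent:
  assumes "p \<in> histories n" "y \<in> {1..n}" "1 \<in> R" "y \<notin> R"
  shows "anc R p y = anc R p (p y)"
proof -
  have "y \<noteq> 1"
    using assms by metis
  then show ?thesis
    using history_parent(2)[of p n y] assms by (subst anc.simps) auto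
qed

lemma anc_in:
  assumes "p \<in> histories n" "y \<in> {1..n}" "1 \<in> R"
  shows "anc R p y \<in> R"
  using assms(2)
proof (induction y rule: less_induct)
  case (less y)
  show ?case
  proof (cases "y \<in> R")
    case False
    then have "2 \<le> y"
      using less.prems assms(3) by (cases "y = 1") auto
    then show ?thesis
      using less anc_parent[OF assms(1) less.prems assms(3) False]
        history_parent[OF assms(1), of y] by simp
  qed simp
qed

lemma anc_anc:
  assumes "R \<subseteq> R'"
  shows "anc R p (anc R' p y) = anc R p y"
proof (induction y rule: less_induct)
  case (less y)
  show ?case
  proof (cases "y \<in> R' \<or> \<not> p y < y")
    case False
    then have "anc R' p y = anc R' p (p y)" "anc R p y = anc R p (p y)"
      using assms by (subst anc.simps; auto)+
    then show ?thesis
      using less[of "p y"] False by simp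
  qed (subst anc.simps, simp)
qed

lemma anc_update:
  assumes "k \<in> R \<or> y < k"
  shows "anc R (p(k := x)) y = anc R p y"
  using assms
proof (induction y rule: less_induct)
  case (less y)
  show ?case
  proof (cases "y \<in> R")
    case False
    then have "y \<noteq> k"
      using less.prems by auto
    then show ?thesis
      using False less.IH[of "p y"] less.prems
        anc.simps[of R "p(k := x)" y] anc.simps[of R p y]
      by (metis fun_upd_other less_trans)
  qed simp
qed

text \<open>Every vertex belongs to the clan of its nearest ancestor in \<open>R\<close>. With \<open>R = {1, w}\<close> the clan of \<open>w\<close> is
its whole offspring; with \<open>R = {1..m}\<close> the clans are what has grown on the vertices of the tree at
time \<open>m\<close>; adding a later vertex \<open>u\<close> to \<open>R\<close> removes the offspring of \<open>u\<close> from all other clans, which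
makes their sizes independent of the parent of \<open>u\<close>.\<close>

definition clan :: "nat set \<Rightarrow> (nat \<Rightarrow> nat) \<Rightarrow> nat \<Rightarrow> nat \<Rightarrow> nat set" where
  "clan R p n i = {y \<in> {1..n}. anc R p y = i}"

abbreviation clan_size :: "nat set \<Rightarrow> (nat \<Rightarrow> nat) \<Rightarrow> nat \<Rightarrow> nat \<Rightarrow> nat" where
  "clan_size R p n i \<equiv> card (clan R p n i)"

abbreviation descendants :: "(nat \<Rightarrow> nat) \<Rightarrow> nat \<Rightarrow> nat \<Rightarrow> nat set" where
  "descendants p n w \<equiv> clan {1, w} p n w"

lemma finite_clan [simp]: "finite (clan R p n i)"
  by (simp add: clan_def)

lemma clan_subset: "clan R p n i \<subseteq> {1..n}"
  by (auto simp: clan_def)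

lemma clan_disjoint: "i \<noteq> j \<Longrightarrow> clan R p n i \<inter> clan R p n j = {}"
  by (auto simp: clan_def)

lemma root_in_clan: "i \<in> R \<Longrightarrow> 1 \<le> i \<Longrightarrow> i \<le> n \<Longrightarrow> i \<in> clan R p n i"
  by (auto simp: clan_def)

lemma clan_size_pos: "i \<in> R \<Longrightarrow> 1 \<le> i \<Longrightarrow> i \<le> n \<Longrightarrow> 1 \<le> clan_size R p n i"
  using root_in_clan[of i R n p] by (metis One_nat_def Suc_leI card_gt_0_iff empty_iff finite_clan)

lemma clan_update: "k \<in> R \<Longrightarrow> clan R (p(k := x)) n i = clan R p n i"
  by (simp add: clan_def anc_update)

lemma clan_antimono:
  assumes "R \<subseteq> R'" "i \<in> R"
  shows "clan R' p n i \<subseteq> clan R p n i"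
proof
  fix y assume "y \<in> clan R' p n i"
  then show "y \<in> clan R p n i"
    using assms(2) anc_anc[OF assms(1), of p y] by (auto simp: clan_def)
qed

lemma anc_pos:
  assumes "p \<in> histories n" "y \<in> {1..n}" "1 \<in> R"
  shows "1 \<le> anc R p y"
  using assms(2)
proof (induction y rule: less_induct)
  case (less y)
  show ?case
  proof (cases "y \<in> R")
    case False
    then have "2 \<le> y"
      using less.prems assms(3) by (cases "y = 1") auto
    then show ?thesis
      using less anc_parent[OF assms(1) less.prems assms(3) False]
        history_parent[OF assms(1), of y] by simp
  qed (use less.prems in auto)
qed

text \<open>The ancestral lines of a clan pass through its founder \<open>i\<close>, and they cannot meet \<open>w\<close> before, because \<open>w\<close> belongs
to \<open>R\<close> itself. So the part of the line above \<open>i\<close> decides.\<close>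

lemma clan_within_descendants_iff:
  assumes "p \<in> histories n" "y \<in> clan R p n i" "1 \<in> R" "w \<in> R"
  shows "y \<in> descendants p n w \<longleftrightarrow> i \<in> descendants p n w"
proof -
  have "anc {1, w} p y = anc {1, w} p i"
    using assms anc_anc[of "{1, w}" R p y] by (simp add: clan_def)
  moreover have "i \<le> y" "1 \<le> i"
    using assms anc_le[of R p y] anc_pos[of p n y R] by (auto simp: clan_def)
  ultimately show ?thesis
    using assms(2) by (auto simp: clan_def)
qed

section \<open>Subtrees hanging off an edge\<close>

lemma vwalk_stays:
  assumes "vwalk q (with_proj t)" "hd q \<in> S" "a \<notin> set q"
    and "\<And>x y. (x, y) \<in> parcs t \<Longrightarrow> x \<in> S \<Longrightarrow> y \<notin> S \<Longrightarrow> y = a"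
  shows "last q \<in> S"
  using assms(1-3)
proof (induction rule: vwalk_induct)
  case (Cons u v es)
  then have "v \<in> S"
    using assms(4)[of u v] by auto
  then show ?case
    using Cons by auto
qed auto

lemma vwalk_crosses:
  assumes "vwalk q (with_proj t)" "hd q \<notin> S" "last q \<in> S"
    and "\<And>x y. (x, y) \<in> parcs t \<Longrightarrow> x \<notin> S \<Longrightarrow> y \<in> S \<Longrightarrow> y = b"
  shows "b \<in> set q"
  using assms(1-3)
proof (induction rule: vwalk_induct)
  case (Cons u v es)
  show ?case
  proof (cases "v \<in> S")
    case True
    then show ?thesis
      using assms(4)[of u v] Cons by auto
  next
    case False
    then show ?thesis
      using Cons by auto
  qed
qed auto

text \<open>The only arcs between \<open>S\<close> and its complement are the two orientations of \<open>{a, b}\<close>. A path from \<open>a\<close>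
has to use \<open>(a, b)\<close> to reach \<open>S\<close>, and once it has done so it cannot leave \<open>S\<close>, because that would visit
\<open>a\<close> a second time.\<close>

lemma subtree_of_bridge:
  assumes reach: "\<And>y. y \<in> pverts t \<Longrightarrow> \<exists>q. vwalk q (with_proj t) \<and> hd q = a \<and> last q = y"
    and ab: "a \<notin> S" "b \<in> S"
    and enter: "\<And>x y. (x, y) \<in> parcs t \<Longrightarrow> x \<notin> S \<Longrightarrow> y \<in> S \<Longrightarrow> y = b"
    and leave: "\<And>x y. (x, y) \<in> parcs t \<Longrightarrow> x \<in> S \<Longrightarrow> y \<notin> S \<Longrightarrow> y = a"
  shows "subtree_of t a b = pverts t \<inter> S"
proof (intro equalityI subsetI)
  fix y assume "y \<in> subtree_of t a b"
  then obtain q where q: "y \<in> pverts t" "vpath q (with_proj t)" "hd q = a" "last q = y" "b \<in> set q"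
    by (auto simp: subtree_of_def)
  obtain q1 q2 where q12: "q = q1 @ b # q2"
    using split_list[OF q(5)] by blast
  have "q1 \<noteq> []"
    using q(3) q12 ab by (cases q1) auto
  then have "a \<notin> set (b # q2)"
    using q(2,3) q12 by (cases q1) (auto simp: vpath_def)
  moreover have "vwalk (b # q2) (with_proj t)"
    using q(2) vwalkI_append_r[of "b # q2" q1] unfolding q12 by (auto simp: vpath_def)
  ultimately have "last (b # q2) \<in> S"
    using vwalk_stays[of "b # q2" t S a] ab(2) leave by auto
  then show "y \<in> pverts t \<inter> S"
    using q q12 by auto
next
  fix y assume y: "y \<in> pverts t \<inter> S"
  then obtain q where q: "vwalk q (with_proj t)" "hd q = a" "last q = y"
    using reach by blast
  then obtain q' where q': "vpath q' (with_proj t)" "hd q' = a" "last q' = y"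
    using vwalk_imp_ex_vpath[OF q] by metis
  then have "b \<in> set q'"
    using vwalk_crosses[of q' t S b] ab(1) y enter by (auto simp: vpath_def)
  then show "y \<in> subtree_of t a b"
    using q' y by (auto simp: subtree_of_def)
qed

lemma history_tree_simps [simp]:
  "pverts (history_tree n p) = {1..n}"
  "(x, y) \<in> parcs (history_tree n p) \<longleftrightarrow>
     (y \<in> {2..n} \<and> x = p y) \<or> (x \<in> {2..n} \<and> y = p x)"
proof -
  show "(x, y) \<in> parcs (history_tree n p) \<longleftrightarrow>
     (y \<in> {2..n} \<and> x = p y) \<or> (x \<in> {2..n} \<and> y = p x)"
    unfolding history_tree_def by (simp del: atLeastAtMost_iff) blast
qed (simp add: history_tree_def)

lemma history_tree_walk_from_root:
  assumes p: "p \<in> histories n" and y: "y \<in> {1..n}"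
  shows "\<exists>q. vwalk q (with_proj (history_tree n p)) \<and> hd q = y \<and> last q = 1"
  using y
proof (induction y rule: less_induct)
  case (less y)
  show ?case
  proof (cases "y = 1")
    case True
    then show ?thesis
      using less.prems by (intro exI[of _ "[1]"]) auto
  next
    case False
    then obtain q where q: "vwalk q (with_proj (history_tree n p))" "hd q = p y" "last q = 1"
      using less.IH[of "p y"] less.prems history_parent[OF p, of y] by force
    then have "vwalk (y # q) (with_proj (history_tree n p))"
      using less.prems False by (intro vwalk_consI) auto
    then show ?thesis
      using q by (intro exI[of _ "y # q"]) (auto simp: vwalk_def)
  qed
qed

lemma history_tree_connected:
  assumes p: "p \<in> histories n" and "x \<in> {1..n}" "y \<in> {1..n}"
  shows "\<exists>q. vwalk q (with_proj (history_tree n p)) \<and> hd q = x \<and> last q = y"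
proof -
  let ?G = "with_proj (history_tree n p)"
  obtain q r where q: "vwalk q ?G" "hd q = x" "last q = 1" and r: "vwalk r ?G" "hd r = y" "last r = 1"
    using history_tree_walk_from_root[OF p] assms by meson
  have "symmetric ?G"
    by (auto simp: symmetric_def sym_def)
  then have r': "vwalk (rev r) ?G" "hd (rev r) = 1" "last (rev r) = y"
    using r(2,3) vwalk_rev_ex[OF _ r(1)] by (auto simp: hd_rev last_rev)
  show ?thesis
    using concat_vpath_is_vpath[OF q r'] unfolding vpath_def by blast
qed

lemma descendants_step:
  assumes p: "p \<in> histories n" and k: "k \<in> {2..n}" and w: "w \<in> {2..n}"
  shows "k \<noteq> w \<Longrightarrow> k \<in> descendants p n w \<longleftrightarrow> p k \<in> descendants p n w"
    and "w \<in> descendants p n w" "p w \<notin> descendants p n w"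
proof -
  show "k \<noteq> w \<Longrightarrow> k \<in> descendants p n w \<longleftrightarrow> p k \<in> descendants p n w"
    using anc_parent[OF p, of k "{1, w}"] k history_parent[OF p, of k] by (auto simp: clan_def)
  show "w \<in> descendants p n w"
    using w by (auto simp: clan_def)
  show "p w \<notin> descendants p n w"
    using anc_le[of "{1, w}" p "p w"] history_parent[OF p, of w] w by (auto simp: clan_def)
qed

abbreviation side :: "nat \<Rightarrow> (nat \<Rightarrow> nat) \<Rightarrow> nat \<Rightarrow> nat \<Rightarrow> nat set" where
  "side n p \<equiv> subtree_of (history_tree n p)"

lemma subtree_of_parent:
  assumes p: "p \<in> histories n" and w: "w \<in> {2..n}"
  shows "side n p (p w) w = descendants p n w"
proof -
  have "side n p (p w) w
      = pverts (history_tree n p) \<inter> descendants p n w"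
  proof (rule subtree_of_bridge)
    show "\<exists>q. vwalk q (with_proj (history_tree n p)) \<and> hd q = p w \<and> last q = y"
      if "y \<in> pverts (history_tree n p)" for y
      using history_tree_connected[OF p, of "p w" y] that history_parent[OF p, of w] w by auto
  qed (use descendants_step[OF p _ w] w in \<open>auto simp del: atLeastAtMost_iff\<close>)
  then show ?thesis
    using clan_subset[of "{1, w}" p n w] by (auto simp: Int_absorb1)
qed

lemma subtree_of_child:
  assumes p: "p \<in> histories n" and w: "w \<in> {2..n}"
  shows "side n p w (p w) = {1..n} - descendants p n w"
proof -
  have "side n p w (p w)
      = pverts (history_tree n p) \<inter> (- descendants p n w)"
  proof (rule subtree_of_bridge)
    show "\<exists>q. vwalk q (with_proj (history_tree n p)) \<and> hd q = w \<and> last q = y"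
      if "y \<in> pverts (history_tree n p)" for y
      using history_tree_connected[OF p, of w y] that w by auto
  qed (use descendants_step[OF p _ w] w in \<open>auto simp del: atLeastAtMost_iff\<close>)
  then show ?thesis
    by auto
qed

section \<open>Bounds for the two centralities\<close>

abbreviation adj :: "nat \<Rightarrow> (nat \<Rightarrow> nat) \<Rightarrow> nat \<Rightarrow> nat set" where
  "adj n p \<equiv> neighbors (history_tree n p)"

lemma neighbors_history_tree:
  "u \<in> adj n p v \<longleftrightarrow>
     (v \<in> {2..n} \<and> u = p v) \<or> (u \<in> {2..n} \<and> v = p u)"
  by (simp add: neighbors_def)

lemma neighbors_finite_nonempty:
  assumes p: "p \<in> histories n" and v: "v \<in> {1..n}" and n: "2 \<le> n"
  shows "finite (adj n p v)" "adj n p v \<noteq> {}"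
    "adj n p v \<subseteq> {1..n}"
proof -
  show sub: "adj n p v \<subseteq> {1..n}"
  proof
    fix u assume "u \<in> adj n p v"
    then show "u \<in> {1..n}"
      using history_parent[OF p, of v] by (auto simp: neighbors_history_tree simp del: One_nat_def)
  qed
  show "finite (adj n p v)"
    by (rule finite_subset[OF sub]) simp
  show "adj n p v \<noteq> {}"
  proof (cases "v = 1")
    case True
    then have "p 2 = v"
      using history_parent[OF p, of 2] n by simp
    then have "2 \<in> adj n p v"
      using n by (simp add: neighbors_history_tree)
    then show ?thesis by blast
  next
    case False
    then have "p v \<in> adj n p v"
      using v by (simp add: neighbors_history_tree)
    then show ?thesis by blast
  qed
qed

lemma jordan_le_side:
  assumes "p \<in> histories n" "v \<in> {1..n}" "2 \<le> n" "u \<in> adj n p v"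
  shows "jordan (history_tree n p) v \<le> card (side n p u v)"
  unfolding jordan_def using neighbors_finite_nonempty[OF assms(1-3)] assms(4) by (intro Min_le) auto

lemma jordan_geI:
  assumes "p \<in> histories n" "v \<in> {1..n}" "2 \<le> n"
    and "\<And>u. u \<in> adj n p v \<Longrightarrow> b \<le> card (side n p u v)"
  shows "b \<le> jordan (history_tree n p) v"
  unfolding jordan_def using neighbors_finite_nonempty[OF assms(1-3)] assms(4)
  by (subst Min_ge_iff) auto

lemma jordan_minimizers_finite_nonempty:
  assumes "p \<in> histories n" "v \<in> {1..n}" "2 \<le> n"
  shows "finite (jordan_minimizers (history_tree n p) v)" "jordan_minimizers (history_tree n p) v \<noteq> {}"
proof -
  note N = neighbors_finite_nonempty[OF assms]
  show "finite (jordan_minimizers (history_tree n p) v)"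
    by (rule finite_subset[OF _ N(1)]) (auto simp: jordan_minimizers_def is_arg_min_def)
  show "jordan_minimizers (history_tree n p) v \<noteq> {}"
    using ex_is_arg_min_if_finite[OF N(1,2), of "\<lambda>u. card (side n p u v)"]
    by (auto simp: jordan_minimizers_def)
qed

lemma jordan_minimizerD:
  assumes "p \<in> histories n" "v \<in> {1..n}" "2 \<le> n" "u \<in> jordan_minimizers (history_tree n p) v"
  shows "u \<in> adj n p v"
    "jordan (history_tree n p) v = card (side n p u v)"
proof -
  show u: "u \<in> adj n p v"
    using assms(4) by (simp add: jordan_minimizers_def is_arg_min_def)
  show "jordan (history_tree n p) v = card (side n p u v)"
    using jordan_le_side[OF assms(1-3) u] assms(4)
    by (intro antisym jordan_geI[OF assms(1-3)])
      (auto simp: jordan_minimizers_def is_arg_min_linorder)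
qed

text \<open>Labels decrease towards the root of the tree, so a line that meets the largest root \<open>w\<close> has met no
other root before.\<close>

lemma clan_last_root:
  assumes p: "p \<in> histories n" and R: "R \<subseteq> {1..w}" "1 \<in> R" "w \<in> R"
  shows "clan R p n w = descendants p n w"
proof
  show "clan R p n w \<subseteq> descendants p n w"
    using R by (intro clan_antimono) auto
  show "descendants p n w \<subseteq> clan R p n w"
  proof
    fix y assume y: "y \<in> descendants p n w"
    let ?i = "anc R p y"
    have "?i \<in> R"
      using anc_in[OF p, of y R] y R by (auto simp: clan_def)
    moreover have "anc {1, w} p ?i = w"
      using y R anc_anc[of "{1, w}" R p y] by (simp add: clan_def)
    then have "w \<le> ?i"
      using anc_le[of "{1, w}" p ?i] by simp
    ultimately have "?i = w"
      using R by auto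
    then show "y \<in> clan R p n w"
      using y by (simp add: clan_def)
  qed
qed

lemma side_cases:
  assumes p: "p \<in> histories n" and u: "u \<in> adj n p v"
  obtains (parent) "v \<in> {2..n}" "u = p v" "side n p u v = descendants p n v"
  | (child) "u \<in> {2..n}" "v = p u" "side n p u v = {1..n} - descendants p n u"
  using u subtree_of_parent[OF p] subtree_of_child[OF p] unfolding neighbors_history_tree by blast

lemma clan_subset_side:
  assumes p: "p \<in> histories n" and R: "1 \<in> R" "v \<in> R" "u \<in> R"
    and u: "u \<in> adj n p v"
    and i: "i \<in> side n p u v"
  shows "clan R p n i \<subseteq> side n p u v"
proof
  fix y assume y: "y \<in> clan R p n i"
  from p u show "y \<in> side n p u v"
  proof (cases rule: side_cases)
    case parent
    then show ?thesis
      using clan_within_descendants_iff[OF p y R(1,2)] i by simp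
  next
    case child
    then show ?thesis
      using clan_within_descendants_iff[OF p y R(1,3)] i y clan_subset[of R p n i] by auto
  qed
qed

text \<open>A neighbour attached after time \<open>m\<close> belongs, with everything on its side, to the clan of \<open>v\<close>.\<close>

lemma late_neighbor_side:
  assumes p: "p \<in> histories n" and v: "1 \<le> v" "v \<le> m"
    and u: "u \<in> adj n p v" "m < u"
  shows "{1..n} - clan {1..m} p n v \<subseteq> side n p u v"
  using p u(1)
proof (cases rule: side_cases)
  case parent
  then show ?thesis
    using u(2) v history_parent[OF p, of v] by auto
next
  case child
  have "descendants p n u \<subseteq> clan {1..m} p n v"
  proof
    fix y assume y: "y \<in> descendants p n u"
    have "clan (insert u {1..m}) p n u = descendants p n u"
      using u v by (intro clan_last_root[OF p]) auto
    then have "anc (insert u {1..m}) p y = u"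
      using y by (auto simp: clan_def)
    then have "anc {1..m} p y = anc {1..m} p u"
      using anc_anc[OF subset_insertI[of "{1..m}" u], of p y] by simp
    also have "\<dots> = v"
      using anc_parent[OF p, of u "{1..m}"] child u v by auto
    finally show "y \<in> clan {1..m} p n v"
      using y by (simp add: clan_def)
  qed
  then show ?thesis
    using child by auto
qed

lemma self_in_side:
  assumes p: "p \<in> histories n" and u: "u \<in> adj n p v"
  shows "v \<in> side n p u v"
  using p u
proof (cases rule: side_cases)
  case parent
  then show ?thesis
    using descendants_step(2)[OF p, of v v] by auto
next
  case child
  then show ?thesis
    using descendants_step(3)[OF p, of u u] history_parent[OF p, of u] by auto
qed

lemma other_neighbor_in_side:
  assumes p: "p \<in> histories n"
    and u: "u \<in> adj n p v"
    and w: "w \<in> adj n p v" "w \<noteq> u"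
  shows "w \<in> side n p u v"
  using p u
proof (cases rule: side_cases)
  case parent
  then have "w \<in> {2..n}" "p w = v"
    using w by (auto simp: neighbors_history_tree)
  moreover have "w \<noteq> v"
    using history_parent[OF p, of w] calculation by auto
  ultimately show ?thesis
    using descendants_step(1)[OF p, of w v] descendants_step(2)[OF p, of v v] parent by auto
next
  case child
  from p w(1) show ?thesis
  proof (cases rule: side_cases)
    case parent
    have "w \<notin> descendants p n u"
      using anc_le[of "{1, u}" p w] parent child history_parent[OF p, of v] history_parent[OF p, of u]
      by (auto simp: clan_def)
    then show ?thesis
      using child parent history_parent[OF p, of v] by auto
  next
    case child': child
    then have "w \<notin> descendants p n u"
      using descendants_step(1)[OF p, of w u] descendants_step(3)[OF p, of u u] child w(2) by auto
    then show ?thesis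
      using child child' by auto
  qed
qed

lemma finite_side:
  "finite (side n p u v)"
  by (rule finite_subset[of _ "{1..n}"]) (auto simp: subtree_of_def)

lemma card_compl_clan: "card ({1..n} - clan R p n i) = n - clan_size R p n i"
  by (subst card_Diff_subset) (auto simp: clan_def)

lemma two_clans_le:
  assumes "a \<noteq> b" "a \<noteq> v" "b \<noteq> v"
  shows "clan_size R p n a + clan_size R p n b \<le> n - clan_size R p n v"
proof -
  have "clan_size R p n a + clan_size R p n b = card (clan R p n a \<union> clan R p n b)"
    using clan_disjoint[OF assms(1)] by (subst card_Un_disjoint) auto
  also have "\<dots> \<le> card ({1..n} - clan R p n v)"
    using assms by (intro card_mono) (auto simp: clan_def)
  finally show ?thesis
    unfolding card_compl_clan .
qed

text \<open>A neighbour \<open>u\<close> present at time \<open>m\<close> leaves the whole clan of \<open>v\<close> on the side of \<open>v\<close>; a later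
neighbour is in the clan of \<open>v\<close> and leaves all other clans there.\<close>

lemma jordan_ge_clan:
  assumes p: "p \<in> histories n" and n: "2 \<le> n" and v: "1 \<le> v" "v \<le> m" "m \<le> n"
  shows "min (clan_size {1..m} p n v) (n - clan_size {1..m} p n v) \<le> jordan (history_tree n p) v"
proof (rule jordan_geI[OF p _ n])
  fix u assume u: "u \<in> adj n p v"
  have u1: "1 \<le> u"
    using neighbors_finite_nonempty(3)[OF p _ n, of v] u v by auto
  show "min (clan_size {1..m} p n v) (n - clan_size {1..m} p n v)
      \<le> card (side n p u v)"
  proof (cases "u \<le> m")
    case True
    then have "clan_size {1..m} p n v \<le> card (side n p u v)"
      using v u1 by (intro card_mono finite_side clan_subset_side[OF p _ _ _ u] self_in_side[OF p u]) auto
    then show ?thesis by simp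
  next
    case False
    then have "card ({1..n} - clan {1..m} p n v) \<le> card (side n p u v)"
      using v by (intro card_mono finite_side late_neighbor_side[OF p _ _ u]) auto
    then show ?thesis
      unfolding card_compl_clan by simp
  qed
qed (use v in auto)

lemma jordan_le_descendants:
  assumes p: "p \<in> histories n" and n: "2 \<le> n" and v: "v \<in> {1..n}"
  shows "jordan (history_tree n p) v \<le> card (descendants p n v)"
proof (cases "v = 1")
  case True
  obtain u where u: "u \<in> adj n p v"
    using neighbors_finite_nonempty(2)[OF p v n] by blast
  have "side n p u v \<subseteq> {1..n}"
    by (auto simp: subtree_of_def)
  also have "{1..n} = descendants p n v"
  proof -
    have "anc {1, 1} p y = 1" if "y \<in> {1..n}" for y
      using anc_in[OF p that, of "{1}"] by simp
    then show ?thesis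
      unfolding True clan_def by blast
  qed
  finally show ?thesis
    using jordan_le_side[OF p v n u] card_mono[OF finite_clan, of "side n p u v"]
    by (meson order.trans)
next
  case False
  then have "p v \<in> adj n p v"
    using v by (auto simp: neighbors_history_tree)
  then show ?thesis
    using jordan_le_side[OF p v n, of "p v"] subtree_of_parent[OF p, of v] False v by simp
qed

lemma descendants_subset_parent:
  assumes p: "p \<in> histories n" and w: "w \<in> {2..n}"
  shows "descendants p n w \<subseteq> descendants p n (p w)"
proof
  fix y assume y: "y \<in> descendants p n w"
  let ?R = "{1, p w, w}"
  have pw: "1 \<le> p w" "p w < w"
    using history_parent[OF p, of w] w by auto
  then have "y \<in> clan ?R p n w"
    using y by (subst clan_last_root[OF p]) auto
  moreover have "w \<in> descendants p n (p w)"
    using anc_parent[OF p, of w "{1, p w}"] w pw by (auto simp: clan_def)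
  ultimately show "y \<in> descendants p n (p w)"
    using clan_within_descendants_iff[OF p, of y ?R w "p w"] by auto
qed

text \<open>If the minimizing neighbour is the parent, its score is at most its offspring; if it is a child,
its offspring is contained in that of \<open>u\<close> and hence in that of the parent.\<close>

lemma jordan2_le:
  assumes p: "p \<in> histories n" and u: "u \<in> {2..n}"
  shows "jordan2 (history_tree n p) u \<le> card (descendants p n u) * card (descendants p n (p u))"
proof -
  let ?t = "history_tree n p"
  have n: "2 \<le> n" and u1: "u \<in> {1..n}" and pu: "p u \<in> {1..n}"
    using u history_parent[OF p, of u] by auto
  obtain w where w: "w \<in> jordan_minimizers ?t u"
    using jordan_minimizers_finite_nonempty(2)[OF p u1 n] by blast
  note D = jordan_le_descendants[OF p n]
  have sub: "card (descendants p n x) \<le> card (descendants p n (p x))" if "x \<in> {2..n}" for x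
    using descendants_subset_parent[OF p that] by (intro card_mono) auto
  have "jordan ?t w \<le> card (descendants p n (p u))"
    using jordan_minimizerD(1)[OF p u1 n w] D[of w] D[OF pu] sub[of u] sub[of w] u
    by (auto simp: neighbors_history_tree)
  then have "max (jordan ?t w) (jordan ?t u) \<le> card (descendants p n (p u))"
    using D[OF u1] sub[OF u] by simp
  then have "jordan ?t u * max (jordan ?t w) (jordan ?t u)
      \<le> card (descendants p n u) * card (descendants p n (p u))"
    using D[OF u1] by (intro mult_mono) auto
  moreover have "jordan2 ?t u \<le> jordan ?t u * max (jordan ?t w) (jordan ?t u)"
    unfolding jordan2_def using jordan_minimizers_finite_nonempty[OF p u1 n] w by (intro Min_le) auto
  ultimately show ?thesis by linarith
qed

text \<open>The second part is disjoint from the offspring of \<open>u\<close>. Its size does not depend on the parent chosen by \<open>u\<close>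
once \<open>p u\<close> is read as a fixed label, which allows conditioning on that choice.\<close>

lemma descendants_parent_subset:
  assumes p: "p \<in> histories n" and u: "u \<in> {2..n}"
  shows "descendants p n (p u) \<subseteq> descendants p n u \<union> clan {1, p u, u} p n (p u)"
proof
  fix y assume y: "y \<in> descendants p n (p u)"
  let ?R = "{1, p u, u}"
  have pu: "1 \<le> p u" "p u < u"
    using history_parent[OF p, of u] u by auto
  have "anc ?R p y \<in> ?R"
    using anc_in[OF p, of y ?R] y by (auto simp: clan_def)
  moreover have "anc {1, p u} p (anc ?R p y) = p u"
    using y anc_anc[of "{1, p u}" ?R p y] by (simp add: clan_def)
  ultimately consider "anc ?R p y = p u" | "anc ?R p y = u"
    by fastforce
  then show "y \<in> descendants p n u \<union> clan ?R p n (p u)"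
  proof cases
    case 2
    then have "y \<in> clan ?R p n u"
      using y by (simp add: clan_def)
    also have "clan ?R p n u = descendants p n u"
      using pu by (intro clan_last_root[OF p]) auto
    finally show ?thesis by blast
  qed (use y in \<open>simp add: clan_def\<close>)
qed

lemma jordan2_attained:
  assumes "p \<in> histories n" "v \<in> {1..n}" "2 \<le> n"
  obtains w where "w \<in> adj n p v"
    "jordan (history_tree n p) v = card (side n p w v)"
    "jordan2 (history_tree n p) v
       = jordan (history_tree n p) v * max (jordan (history_tree n p) w) (jordan (history_tree n p) v)"
proof -
  let ?t = "history_tree n p"
  have "jordan2 ?t v \<in> (\<lambda>w. jordan ?t v * max (jordan ?t w) (jordan ?t v)) ` jordan_minimizers ?t v"
    unfolding jordan2_def using jordan_minimizers_finite_nonempty[OF assms] by (intro Min_in) auto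
  then obtain w where "w \<in> jordan_minimizers ?t v"
    "jordan2 ?t v = jordan ?t v * max (jordan ?t w) (jordan ?t v)"
    by blast
  then show ?thesis
    using that jordan_minimizerD[OF assms] by blast
qed

lemma jordan2_ge_square:
  assumes "p \<in> histories n" "v \<in> {1..n}" "2 \<le> n"
    and "a + b \<le> jordan (history_tree n p) v"
  shows "a * b \<le> jordan2 (history_tree n p) v"
proof -
  obtain w where w: "jordan2 (history_tree n p) v
      = jordan (history_tree n p) v * max (jordan (history_tree n p) w) (jordan (history_tree n p) v)"
    using jordan2_attained[OF assms(1-3)] by blast
  show ?thesis
    unfolding w using assms(4) by (intro mult_mono) auto
qed

text \<open>Let \<open>v\<close> be a leaf of the tree at time \<open>m\<close>, attached to \<open>q\<close>. If the minimizing neighbour arrived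
later, all other clans lie on the side of \<open>v\<close>. If it is \<open>q\<close>, then the side of \<open>v\<close> contains the clan
of \<open>v\<close>, and the score of \<open>q\<close> is at least its own clan or the sum of all others, in particular at least the
smaller of the clans of \<open>q\<close> and \<open>j\<close>.\<close>

lemma jordan2_ge_leaf:
  assumes p: "p \<in> histories n" and m: "m \<le> n" "2 \<le> n"
    and v: "v \<in> {1..m}" and q: "q \<in> {1..m}" "q \<noteq> v"
    and only: "\<And>u. u \<in> adj n p v \<Longrightarrow> u \<le> m \<Longrightarrow> u = q"
    and j: "j \<in> {1..m}" "j \<noteq> v" "j \<noteq> q"
  defines "K \<equiv> clan_size {1..m} p n"
  shows "K v * K q \<le> jordan2 (history_tree n p) v \<or> K v * K j \<le> jordan2 (history_tree n p) v
    \<or> K q * K j \<le> jordan2 (history_tree n p) v"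
proof -
  let ?t = "history_tree n p"
  have v1: "v \<in> {1..n}" using v m by auto
  obtain w where w: "w \<in> neighbors ?t v" "jordan ?t v = card (subtree_of ?t w v)"
    "jordan2 ?t v = jordan ?t v * max (jordan ?t w) (jordan ?t v)"
    using jordan2_attained[OF p v1 m(2)] .
  show ?thesis
  proof (cases "w \<le> m")
    case True
    then have "w = q" using only w by blast
    have "min (K q) (n - K q) \<le> jordan ?t q"
      unfolding K_def using q m by (intro jordan_ge_clan[OF p]) auto
    moreover have "K v + K j \<le> n - K q"
      unfolding K_def using q j by (intro two_clans_le) auto
    ultimately have "min (K q) (K j) \<le> jordan ?t q" by linarith
    moreover have "K v \<le> jordan ?t v"
      unfolding w K_def using v q w(1) \<open>w = q\<close>
      by (intro card_mono finite_side clan_subset_side[OF p] self_in_side[OF p]) auto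
    ultimately have "K v * min (K q) (K j) \<le> jordan2 ?t v"
      unfolding w(3) \<open>w = q\<close> by (intro mult_mono) auto
    then show ?thesis
      by (cases "K q \<le> K j") (auto simp: min_def)
  next
    case False
    then have "card ({1..n} - clan {1..m} p n v) \<le> jordan ?t v"
      unfolding w(2) using v w(1) by (intro card_mono finite_side late_neighbor_side[OF p]) auto
    then have "n - K v \<le> jordan ?t v"
      unfolding card_compl_clan K_def .
    moreover have "K q + K j \<le> n - K v"
      unfolding K_def using q j by (intro two_clans_le) auto
    ultimately show ?thesis
      using jordan2_ge_square[OF p v1 m(2), of "K q" "K j"] by linarith
  qed
qed

text \<open>In the tree on three vertices the middle vertex needs a separate argument: whichever component is
removed, two of the three clans remain on the side of \<open>v\<close>.\<close>

lemma jordan2_ge_middle: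
  assumes p: "p \<in> histories n" and n: "3 \<le> n"
    and v: "v \<in> {1..3}" and a: "a \<in> {1..3}" and b: "b \<in> {1..3}"
    and ne: "a \<noteq> v" "b \<noteq> v" "a \<noteq> b"
    and nb: "a \<in> adj n p v" "b \<in> adj n p v"
  defines "K \<equiv> clan_size {1..3} p n"
  shows "K v * K a \<le> jordan2 (history_tree n p) v \<or> K v * K b \<le> jordan2 (history_tree n p) v
    \<or> K a * K b \<le> jordan2 (history_tree n p) v"
proof -
  let ?t = "history_tree n p"
  have v1: "v \<in> {1..n}" and n2: "2 \<le> n" using v n by auto
  obtain w where w: "w \<in> neighbors ?t v" "jordan ?t v = card (subtree_of ?t w v)"
    "jordan2 ?t v = jordan ?t v * max (jordan ?t w) (jordan ?t v)"
    using jordan2_attained[OF p v1 n2] .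
  have two: "K v + K c \<le> jordan ?t v"
    if c: "c \<in> {1..3}" "c \<noteq> v" "c \<in> neighbors ?t v" "c \<noteq> w" "w \<in> {1..3}" for c
  proof -
    have "clan {1..3} p n v \<union> clan {1..3} p n c \<subseteq> subtree_of ?t w v"
      using v w c n by (intro Un_least clan_subset_side[OF p] self_in_side[OF p]
          other_neighbor_in_side[OF p]) auto
    then have "card (clan {1..3} p n v \<union> clan {1..3} p n c) \<le> jordan ?t v"
      unfolding w(2) by (intro card_mono finite_side)
    then show ?thesis
      using clan_disjoint[of v c "{1..3}" p n] c unfolding K_def
      by (subst (asm) card_Un_disjoint) auto
  qed
  have w1: "1 \<le> w"
    using neighbors_finite_nonempty(3)[OF p v1 n2] w(1) by auto
  have "w = a \<or> w = b \<or> w = v \<or> 3 < w"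
    using v a b ne w1 unfolding atLeastAtMost_iff by presburger
  then consider "w = a" | "w = b" | "w = v" | "3 < w"
    by blast
  then show ?thesis
  proof cases
    case 1
    then show ?thesis
      using jordan2_ge_square[OF p v1 n2 two[of b]] a b ne nb by auto
  next
    case 2
    then show ?thesis
      using jordan2_ge_square[OF p v1 n2 two[of a]] a b ne nb by auto
  next
    case 3
    then show ?thesis
      using w(1) history_parent[OF p, of v] by (auto simp: neighbors_history_tree)
  next
    case 4
    then have "card ({1..n} - clan {1..3} p n v) \<le> jordan ?t v"
      unfolding w(2) using v w(1) by (intro card_mono finite_side late_neighbor_side[OF p]) auto
    then have "n - K v \<le> jordan ?t v"
      unfolding card_compl_clan K_def .
    moreover have "K a + K b \<le> n - K v"
      unfolding K_def using ne by (intro two_clans_le) auto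
    ultimately show ?thesis
      using jordan2_ge_square[OF p v1 n2, of "K a" "K b"] by linarith
  qed
qed

text \<open>A vertex is a leaf at the time of its arrival.\<close>

lemma jordan2_ge_late:
  assumes p: "p \<in> histories n" and v: "3 \<le> v" "v \<le> n"
  defines "K \<equiv> clan_size {1..v} p n" and "q \<equiv> p v" and "j \<equiv> if p v = 1 then 2 else 1"
  shows "K v * K q \<le> jordan2 (history_tree n p) v \<or> K v * K j \<le> jordan2 (history_tree n p) v
    \<or> K q * K j \<le> jordan2 (history_tree n p) v"
  unfolding K_def
proof (rule jordan2_ge_leaf[OF p])
  fix u assume "u \<in> adj n p v" "u \<le> v"
  then show "u = q"
    using history_parent[OF p, of u] by (auto simp: neighbors_history_tree q_def)
qed (use v history_parent[OF p, of v] in \<open>auto simp: q_def j_def\<close>)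

text \<open>The first two vertices are treated at time \<open>3\<close>, when the tree is a path with three vertices; each of
them is either an end or the middle of it.\<close>

lemma jordan2_ge_early:
  assumes p: "p \<in> histories n" and v: "v \<in> {1, 2}" and n: "3 \<le> n"
  defines "K \<equiv> clan_size {1..3} p n"
  shows "K 1 * K 2 \<le> jordan2 (history_tree n p) v \<or> K 1 * K 3 \<le> jordan2 (history_tree n p) v
    \<or> K 2 * K 3 \<le> jordan2 (history_tree n p) v"
proof -
  have p2: "p 2 = 1"
    using history_parent[OF p, of 2] n by auto
  have nbr: "u \<in> {1, 2, 3}" if "u \<in> adj n p v" "u \<le> 3" for u
    using that neighbors_finite_nonempty(3)[OF p, of v] v n by (force simp: numeral_3_eq_3 le_Suc_eq)
  have nself: "v \<notin> adj n p v"
    using history_parent[OF p, of v] by (auto simp: neighbors_history_tree)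
  consider "p 3 = 1" "v = 1" | "p 3 = 1" "v = 2" | "p 3 = 2" "v = 1" | "p 3 = 2" "v = 2"
    using history_parent[OF p, of 3] n v by (auto simp: numeral_3_eq_3 numeral_2_eq_2 less_Suc_eq)
  then show ?thesis
  proof cases
    case 1
    then show ?thesis
      using jordan2_ge_middle[OF p n, of 1 2 3] p2 n by (auto simp: neighbors_history_tree K_def)
  next
    case 2
    have "K 2 * K 1 \<le> jordan2 (history_tree n p) v \<or> K 2 * K 3 \<le> jordan2 (history_tree n p) v
      \<or> K 1 * K 3 \<le> jordan2 (history_tree n p) v"
      unfolding K_def 2(2)
    proof (rule jordan2_ge_leaf[OF p n])
      fix u assume "u \<in> adj n p 2" "u \<le> 3"
      then show "u = 1"
        using nbr[of u] nself 2 p2 by (auto simp: neighbors_history_tree)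
    qed (use n in auto)
    then show ?thesis
      by (auto simp: mult.commute)
  next
    case 3
    have "K 1 * K 2 \<le> jordan2 (history_tree n p) v \<or> K 1 * K 3 \<le> jordan2 (history_tree n p) v
      \<or> K 2 * K 3 \<le> jordan2 (history_tree n p) v"
      unfolding K_def 3(2)
    proof (rule jordan2_ge_leaf[OF p n])
      fix u assume "u \<in> adj n p 1" "u \<le> 3"
      then show "u = 2"
        using nbr[of u] nself 3 p2 by (auto simp: neighbors_history_tree)
    qed (use n in auto)
    then show ?thesis .
  next
    case 4
    then show ?thesis
      using jordan2_ge_middle[OF p n, of 2 1 3] p2 n
      by (auto simp: neighbors_history_tree K_def mult.commute)
  qed
qed

section \<open>Averages over histories\<close>

definition avg :: "nat \<Rightarrow> ((nat \<Rightarrow> nat) \<Rightarrow> real) \<Rightarrow> real" where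
  "avg n F = (\<Sum>p\<in>histories n. F p) / fact (n - 1)"

abbreviation prob_hist :: "nat \<Rightarrow> ((nat \<Rightarrow> nat) \<Rightarrow> bool) \<Rightarrow> real" where
  "prob_hist n Q \<equiv> avg n (\<lambda>p. of_bool (Q p))"

lemma avg_cong: "(\<And>p. p \<in> histories n \<Longrightarrow> F p = G p) \<Longrightarrow> avg n F = avg n G"
  by (simp add: avg_def)

lemma avg_mono: "(\<And>p. p \<in> histories n \<Longrightarrow> F p \<le> G p) \<Longrightarrow> avg n F \<le> avg n G"
  by (simp add: avg_def divide_right_mono sum_mono)

lemma avg_add: "avg n (\<lambda>p. F p + G p) = avg n F + avg n G"
  by (simp add: avg_def sum.distrib add_divide_distrib)

lemma avg_cmult: "avg n (\<lambda>p. c * F p) = c * avg n F"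
  by (simp add: avg_def sum_distrib_left[symmetric])

lemma avg_const [simp]: "avg n (\<lambda>p. c) = c"
  by (simp add: avg_def card_histories)

lemma avg_sum: "avg n (\<lambda>p. \<Sum>i\<in>A. F i p) = (\<Sum>i\<in>A. avg n (F i))"
  unfolding avg_def by (subst sum.swap) (simp add: sum_divide_distrib)

lemma avg_nonneg: "(\<And>p. p \<in> histories n \<Longrightarrow> 0 \<le> F p) \<Longrightarrow> 0 \<le> avg n F"
  using avg_mono[of n "\<lambda>_. 0" F] by simp

lemma prob_hist_mono:
  "(\<And>p. p \<in> histories n \<Longrightarrow> Q p \<Longrightarrow> Q' p) \<Longrightarrow> prob_hist n Q \<le> prob_hist n Q'"
  by (rule avg_mono) auto

lemma prob_hist_le_1: "prob_hist n Q \<le> 1"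
  using avg_mono[of n "\<lambda>p. of_bool (Q p)" "\<lambda>_. 1"] by simp

lemma prob_hist_nonneg: "0 \<le> prob_hist n Q"
  by (rule avg_nonneg) auto

lemma prob_hist_disj_le: "prob_hist n (\<lambda>p. Q p \<or> Q' p) \<le> prob_hist n Q + prob_hist n Q'"
  unfolding avg_add[symmetric] by (rule avg_mono) auto

lemma prob_hist_Bex_le:
  assumes "finite A"
  shows "prob_hist n (\<lambda>p. \<exists>a\<in>A. Q a p) \<le> (\<Sum>a\<in>A. prob_hist n (Q a))"
  unfolding avg_sum[symmetric]
proof (rule avg_mono)
  fix p
  show "of_bool (\<exists>a\<in>A. Q a p) \<le> (\<Sum>a\<in>A. of_bool (Q a p) :: real)"
  proof (cases "\<exists>a\<in>A. Q a p")
    case True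
    then obtain a where a: "a \<in> A" "Q a p" by blast
    then have "of_bool (Q a p) \<le> (\<Sum>a\<in>A. of_bool (Q a p) :: real)"
      using assms by (intro member_le_sum) auto
    then show ?thesis using True a by simp
  qed (simp add: sum_nonneg)
qed

lemma prob_hist_zero: "(\<And>p. p \<in> histories n \<Longrightarrow> \<not> Q p) \<Longrightarrow> prob_hist n Q = 0"
  using avg_cong[of n "\<lambda>p. of_bool (Q p)" "\<lambda>_. 0"] by simp

lemma markov:
  assumes "0 < a" "\<And>p. p \<in> histories n \<Longrightarrow> 0 \<le> F p" "\<And>p. p \<in> histories n \<Longrightarrow> Q p \<Longrightarrow> a \<le> F p"
  shows "prob_hist n Q \<le> avg n F / a"
proof -
  have "a * prob_hist n Q \<le> avg n F"
    unfolding avg_cmult[symmetric] using assms by (intro avg_mono) auto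
  then show ?thesis
    using assms(1) by (simp add: pos_le_divide_eq mult.commute)
qed

lemma histories_Suc:
  assumes "1 \<le> n"
  shows "histories (Suc n) = (\<lambda>(x, p). p(Suc n := x)) ` ({1..n} \<times> histories n)"
    and "inj_on (\<lambda>(x, p). p(Suc n := x)) ({1..n} \<times> histories n)"
proof -
  have ins: "{2..Suc n} = insert (Suc n) {2..n}" and n: "{1..<Suc n} = {1..n}"
    using assms by auto
  show "histories (Suc n) = (\<lambda>(x, p). p(Suc n := x)) ` ({1..n} \<times> histories n)"
    unfolding histories_def ins PiE_insert_eq n ..
  have "inj_on (\<lambda>(x, p). p(Suc n := x)) ({1..<Suc n} \<times> histories n)"
    unfolding histories_def by (rule inj_combinator) auto
  then show "inj_on (\<lambda>(x, p). p(Suc n := x)) ({1..n} \<times> histories n)"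
    unfolding n .
qed

lemma avg_Suc:
  assumes n: "1 \<le> n"
  shows "avg (Suc n) F = avg n (\<lambda>p. (\<Sum>x\<in>{1..n}. F (p(Suc n := x))) / n)"
proof -
  have "(\<Sum>p\<in>histories (Suc n). F p) = (\<Sum>(x, p)\<in>{1..n} \<times> histories n. F (p(Suc n := x)))"
    unfolding histories_Suc(1)[OF n]
    by (subst sum.reindex[OF histories_Suc(2)[OF n]]) (simp add: case_prod_unfold)
  also have "\<dots> = (\<Sum>p\<in>histories n. \<Sum>x\<in>{1..n}. F (p(Suc n := x)))"
    unfolding sum.cartesian_product[symmetric] by (rule sum.swap)
  finally have "(\<Sum>p\<in>histories (Suc n). F p) = (\<Sum>p\<in>histories n. \<Sum>x\<in>{1..n}. F (p(Suc n := x)))" .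
  moreover have "fact n = real n * fact (n - 1)"
    using n by (simp add: fact_reduce)
  ultimately show ?thesis
    by (simp add: avg_def sum_divide_distrib[symmetric])
qed

text \<open>If \<open>F x\<close> ignores the parent of \<open>u\<close>, then averaging over that parent first gives the formula. Formally, the
exchange of \<open>p u\<close> with an additional independent value is an involution of the extended set
of histories.\<close>

lemma avg_parent:
  assumes u: "u \<in> {2..n}"
    and indep: "\<And>x y p. p \<in> histories n \<Longrightarrow> y \<in> {1..<u} \<Longrightarrow> F x (p(u := y)) = F x p"
  shows "avg n (\<lambda>p. F (p u) p) = (\<Sum>x\<in>{1..<u}. avg n (F x)) / (real u - 1)"
proof -
  let ?S = "histories n \<times> {1..<u}"
  have "(\<Sum>x\<in>{1..<u}. \<Sum>p\<in>histories n. F x p) = (\<Sum>p\<in>histories n. \<Sum>x\<in>{1..<u}. F x p)"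
    by (rule sum.swap)
  also have "\<dots> = (\<Sum>(p, x)\<in>?S. F x p)"
    by (simp add: sum.cartesian_product)
  also have "\<dots> = (\<Sum>(p, x)\<in>?S. F (p u) p)"
    using u history_parent[of _ n u] indep
    by (intro sum.reindex_bij_witness[of _ "\<lambda>(p, x). (p(u := x), p u)" "\<lambda>(p, x). (p(u := x), p u)"])
      (auto intro!: histories_update simp del: One_nat_def)
  also have "\<dots> = (\<Sum>p\<in>histories n. \<Sum>x\<in>{1..<u}. F (p u) p)"
    by (rule sum.cartesian_product[symmetric])
  also have "\<dots> = (real u - 1) * (\<Sum>p\<in>histories n. F (p u) p)"
    using u by (simp add: sum_distrib_left of_nat_diff)
  finally show ?thesis
    using u by (simp add: avg_def sum_divide_distrib[symmetric])
qed

lemma avg_prod: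
  "avg n (\<lambda>p. \<Prod>k\<in>{2..n}. f k (p k)) = (\<Prod>k\<in>{2..n}. (\<Sum>x\<in>{1..<k}. f k x) / (real k - 1))"
proof -
  have "(\<Sum>p\<in>histories n. \<Prod>k\<in>{2..n}. f k (p k)) = (\<Prod>k\<in>{2..n}. \<Sum>x\<in>{1..<k}. f k x)"
    unfolding histories_def by (rule prod_sum_PiE[symmetric]) auto
  moreover have "fact (n - 1) = (\<Prod>k\<in>{2..n}. real k - 1)"
  proof -
    have "(fact (n - 1) :: real) = (\<Prod>k\<in>{1..n - 1}. real k)"
      by (simp add: fact_prod)
    also have "\<dots> = (\<Prod>k\<in>{2..n}. real k - 1)"
      by (rule prod.reindex_bij_witness[of _ "\<lambda>k. k - 1" Suc]) auto
    finally show ?thesis .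
  qed
  ultimately show ?thesis
    by (simp add: avg_def prod_dividef)
qed

lemma prob_parents:
  assumes K: "K \<subseteq> {2..n}"
  shows "prob_hist n (\<lambda>p. \<forall>k\<in>K. Q k (p k)) = (\<Prod>k\<in>K. card {x \<in> {1..<k}. Q k x} / (real k - 1))"
proof -
  let ?f = "\<lambda>k x. if k \<in> K then of_bool (Q k x) else 1 :: real"
  have fin: "finite K"
    using K finite_subset by blast
  have "prob_hist n (\<lambda>p. \<forall>k\<in>K. Q k (p k)) = avg n (\<lambda>p. \<Prod>k\<in>{2..n}. ?f k (p k))"
  proof (rule avg_cong)
    fix p
    have "(\<Prod>k\<in>{2..n}. ?f k (p k)) = (\<Prod>k\<in>K. ?f k (p k))"
      using K by (intro prod.mono_neutral_right) auto
    also have "\<dots> = of_bool (\<forall>k\<in>K. Q k (p k))"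
      using fin by (cases "\<forall>k\<in>K. Q k (p k)") auto
    finally show "of_bool (\<forall>k\<in>K. Q k (p k)) = (\<Prod>k\<in>{2..n}. ?f k (p k))" ..
  qed
  also have "\<dots> = (\<Prod>k\<in>{2..n}. (\<Sum>x\<in>{1..<k}. ?f k x) / (real k - 1))"
    by (rule avg_prod)
  also have "\<dots> = (\<Prod>k\<in>K. (\<Sum>x\<in>{1..<k}. ?f k x) / (real k - 1))"
    using K by (intro prod.mono_neutral_right) auto
  also have "\<dots> = (\<Prod>k\<in>K. card {x \<in> {1..<k}. Q k x} / (real k - 1))"
    by (intro prod.cong) (auto simp: of_bool_def sum.If_cases Int_def)
  finally show ?thesis .
qed

section \<open>Growth of clans\<close>

lemma clan_Suc:
  assumes p: "p \<in> histories n" and n: "1 \<le> n" and x: "x \<in> {1..n}" and R: "1 \<in> R" "Suc n \<notin> R"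
  shows "clan R (p(Suc n := x)) (Suc n) i
    = (if anc R p x = i then insert (Suc n) (clan R p n i) else clan R p n i)"
proof -
  let ?q = "p(Suc n := x)"
  have q: "?q \<in> histories (Suc n)"
    unfolding histories_Suc(1)[OF n] using p x by force
  have "anc R ?q (Suc n) = anc R ?q (?q (Suc n))"
    using R by (intro anc_parent[OF q]) auto
  then have new: "anc R ?q (Suc n) = anc R p x"
    using x by (simp add: anc_update)
  have old: "anc R ?q y = anc R p y" if "y \<in> {1..n}" for y
    using that by (intro anc_update) auto
  have "{1..Suc n} = insert (Suc n) {1..n}" by auto
  then have "clan R ?q (Suc n) i = {y \<in> insert (Suc n) {1..n}. anc R ?q y = i}"
    by (simp add: clan_def)
  also have "\<dots> = (if anc R p x = i then {Suc n} else {}) \<union> {y \<in> {1..n}. anc R ?q y = i}"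
    using new by auto
  also have "{y \<in> {1..n}. anc R ?q y = i} = clan R p n i"
    unfolding clan_def using old by (intro Collect_cong) metis
  also have "(if anc R p x = i then {Suc n} else {}) \<union> clan R p n i
    = (if anc R p x = i then insert (Suc n) (clan R p n i) else clan R p n i)"
    by simp
  finally show ?thesis .
qed

lemma clan_size_Suc:
  assumes "p \<in> histories n" "1 \<le> n" "x \<in> {1..n}" "1 \<in> R" "Suc n \<notin> R"
  shows "clan_size R (p(Suc n := x)) (Suc n) i
    = clan_size R p n i + of_bool (x \<in> clan R p n i)"
proof -
  have "Suc n \<notin> clan R p n i"
    by (simp add: clan_def)
  moreover have "x \<in> clan R p n i \<longleftrightarrow> anc R p x = i"
    using assms by (simp add: clan_def)
  ultimately show ?thesis
    unfolding clan_Suc[OF assms] by simp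
qed

lemma clan_size_Suc_root:
  assumes p: "p \<in> histories n" and n: "1 \<le> n" and x: "x \<in> {1..n}" and R: "Suc n \<in> R"
  shows "clan_size R (p(Suc n := x)) (Suc n) i
    = (if i = Suc n then 1 else clan_size R p n i)"
proof -
  let ?q = "p(Suc n := x)"
  have old: "anc R ?q y = anc R p y" if "y \<in> {1..n}" for y
    using that by (intro anc_update) auto
  have ne: "anc R p y \<noteq> Suc n" if "y \<in> {1..n}" for y
    using anc_le[of R p y] that by auto
  have "{1..Suc n} = insert (Suc n) {1..n}" by auto
  then have "clan R ?q (Suc n) i = {y \<in> insert (Suc n) {1..n}. anc R ?q y = i}"
    by (simp add: clan_def)
  also have "\<dots> = (if i = Suc n then {Suc n} else {}) \<union> {y \<in> {1..n}. anc R ?q y = i}"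
    using R by auto
  also have "{y \<in> {1..n}. anc R ?q y = i} = clan R p n i"
    unfolding clan_def using old by (intro Collect_cong) metis
  finally have clan: "clan R ?q (Suc n) i = (if i = Suc n then {Suc n} else {}) \<union> clan R p n i" .
  have "clan R p n i = {}" if "i = Suc n"
    using ne that unfolding clan_def by blast
  then show ?thesis
    unfolding clan by (cases "i = Suc n") simp_all
qed

text \<open>Two clans form a Polya urn diluted by the vertices of the other clans: the new vertex joins a clan
with probability proportional to its size.\<close>

lemma avg_clan_sizes_Suc:
  fixes f :: "nat \<Rightarrow> nat \<Rightarrow> real"
  assumes n: "1 \<le> n" and R: "1 \<in> R" "Suc n \<notin> R" and ij: "i \<noteq> j"
  shows "avg (Suc n) (\<lambda>p. f (clan_size R p (Suc n) i) (clan_size R p (Suc n) j))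
    = avg n (\<lambda>p. (1 - (real (clan_size R p n i) + real (clan_size R p n j)) / n)
          * f (clan_size R p n i) (clan_size R p n j)
        + clan_size R p n i / n * f (Suc (clan_size R p n i)) (clan_size R p n j)
        + clan_size R p n j / n * f (clan_size R p n i) (Suc (clan_size R p n j)))"
  unfolding avg_Suc[OF n]
proof (rule avg_cong)
  fix p assume p: "p \<in> histories n"
  let ?I = "clan R p n i" and ?J = "clan R p n j"
  let ?g = "\<lambda>x. f (clan_size R (p(Suc n := x)) (Suc n) i) (clan_size R (p(Suc n := x)) (Suc n) j)"
  let ?a = "f (card ?I) (card ?J)" and ?b = "f (Suc (card ?I)) (card ?J)"
    and ?c = "f (card ?I) (Suc (card ?J))"
  have disj: "?I \<inter> ?J = {}"
    using ij by (rule clan_disjoint)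
  have sub: "?I \<union> ?J \<subseteq> {1..n}"
    by (auto simp: clan_def)
  have "?g x = ?a + of_bool (x \<in> ?I) * (?b - ?a) + of_bool (x \<in> ?J) * (?c - ?a)"
    if "x \<in> {1..n}" for x
    unfolding clan_size_Suc[OF p n that R] using disj by auto
  then have "(\<Sum>x\<in>{1..n}. ?g x)
      = (\<Sum>x\<in>{1..n}. ?a + of_bool (x \<in> ?I) * (?b - ?a) + of_bool (x \<in> ?J) * (?c - ?a))"
    by (intro sum.cong) auto
  also have "\<dots> = n * ?a + card ({1..n} \<inter> ?I) * (?b - ?a) + card ({1..n} \<inter> ?J) * (?c - ?a)"
    by (simp add: sum.distrib sum_distrib_right[symmetric] of_bool_def sum.If_cases)
  also have "{1..n} \<inter> ?I = ?I"
    using sub by blast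
  also have "{1..n} \<inter> ?J = ?J"
    using sub by blast
  finally have "(\<Sum>x\<in>{1..n}. ?g x) / n
      = (n * ?a + card ?I * (?b - ?a) + card ?J * (?c - ?a)) / n"
    by (rule arg_cong)
  also have "\<dots> = (1 - (real (card ?I) + real (card ?J)) / n) * ?a + card ?I / n * ?b + card ?J / n * ?c"
    using n by (simp add: field_simps)
  finally show "(\<Sum>x\<in>{1..n}. ?g x) / n
    = (1 - (real (card ?I) + real (card ?J)) / n) * ?a + card ?I / n * ?b + card ?J / n * ?c" .
qed

text \<open>A new vertex that is itself a root founds its own clan and leaves the others as they are.\<close>

lemma avg_clan_sizes_Suc_root:
  assumes n: "1 \<le> n" and R: "Suc n \<in> R" and ij: "i \<noteq> Suc n" "j \<noteq> Suc n"
  shows "avg (Suc n) (\<lambda>p. f (clan_size R p (Suc n) i) (clan_size R p (Suc n) j))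
    = avg n (\<lambda>p. f (clan_size R p n i) (clan_size R p n j))"
  unfolding avg_Suc[OF n]
proof (rule avg_cong)
  fix p assume p: "p \<in> histories n"
  have "(\<Sum>x\<in>{1..n}. f (clan_size R (p(Suc n := x)) (Suc n) i) (clan_size R (p(Suc n := x)) (Suc n) j))
      = (\<Sum>x\<in>{1..n}. f (clan_size R p n i) (clan_size R p n j))"
    using clan_size_Suc_root[OF p n _ R] ij by (intro sum.cong) simp_all
  then show "(\<Sum>x\<in>{1..n}. f (clan_size R (p(Suc n := x)) (Suc n) i)
      (clan_size R (p(Suc n := x)) (Suc n) j)) / n = f (clan_size R p n i) (clan_size R p n j)"
    using n by simp
qed

lemma prob_clan_sizes_Suc:
  assumes n: "1 \<le> n" and R: "1 \<in> R" "Suc n \<notin> R" and ij: "i \<noteq> j"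
  defines "N \<equiv> clan_size R"
  shows "prob_hist (Suc n) (\<lambda>p. N p (Suc n) i = k \<and> N p (Suc n) j = l)
    = (1 - (real k + real l) / n) * prob_hist n (\<lambda>p. N p n i = k \<and> N p n j = l)
      + (real k - 1) / n * prob_hist n (\<lambda>p. Suc (N p n i) = k \<and> N p n j = l)
      + (real l - 1) / n * prob_hist n (\<lambda>p. N p n i = k \<and> Suc (N p n j) = l)"
  unfolding N_def avg_clan_sizes_Suc[OF n R ij, of "\<lambda>a b. of_bool (a = k \<and> b = l)"]
    avg_add[symmetric] avg_cmult[symmetric]
  by (rule avg_cong) auto

lemma prob_clan_size_Suc:
  assumes n: "1 \<le> n" and R: "1 \<in> R" "Suc n \<notin> R"
  defines "N \<equiv> clan_size R"
  shows "prob_hist (Suc n) (\<lambda>p. N p (Suc n) i = k)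
    = (1 - real k / n) * prob_hist n (\<lambda>p. N p n i = k)
      + (real k - 1) / n * prob_hist n (\<lambda>p. Suc (N p n i) = k)"
proof -
  let ?j = "Suc i"
  have "prob_hist (Suc n) (\<lambda>p. N p (Suc n) i = k)
    = avg n (\<lambda>p. (1 - (real (N p n i) + real (N p n ?j)) / n) * of_bool (N p n i = k)
       + N p n i / n * of_bool (Suc (N p n i) = k) + N p n ?j / n * of_bool (N p n i = k))"
    using avg_clan_sizes_Suc[OF n R, of i ?j "\<lambda>a b. of_bool (a = k)"] by (simp add: N_def)
  also have "\<dots> = avg n (\<lambda>p. (1 - real k / n) * of_bool (N p n i = k)
      + (real k - 1) / n * of_bool (Suc (N p n i) = k))"
    by (rule avg_cong) (auto simp: algebra_simps add_divide_distrib)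
  finally show ?thesis
    unfolding avg_add avg_cmult .
qed

section \<open>Anticoncentration and tails of clan sizes\<close>

text \<open>The tree is frozen at time \<open>m\<close>, and the offspring of a later vertex \<open>u\<close> is split off.\<close>

locale late_vertex =
  fixes m u :: nat
  assumes m: "2 \<le> m" "m < u"
begin

abbreviation N :: "(nat \<Rightarrow> nat) \<Rightarrow> nat \<Rightarrow> nat \<Rightarrow> nat" where
  "N p n i \<equiv> clan_size (insert u {1..m}) p n i"

lemma N_pos: "i \<in> {1..m} \<Longrightarrow> m \<le> n \<Longrightarrow> 1 \<le> N p n i"
  by (intro clan_size_pos) auto

lemma sum_N_less:
  assumes A: "A \<subseteq> insert u {1..m}" and k: "k \<in> {1..m}" "k \<notin> A" and n: "m \<le> n"
  shows "(\<Sum>i\<in>A. N p n i) < n"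
proof -
  let ?R = "insert u {1..m}"
  have fin: "finite A"
    using A finite_subset by auto
  have "(\<Sum>i\<in>insert k A. N p n i) = card (\<Union>i\<in>insert k A. clan ?R p n i)"
    using fin by (intro card_UN_disjoint[symmetric]) (auto simp: clan_def)
  also have "\<dots> \<le> card {1..n}"
    by (intro card_mono) (auto simp: clan_def)
  finally have "N p n k + (\<Sum>i\<in>A. N p n i) \<le> n"
    using fin k by simp
  then show ?thesis
    using N_pos[OF k(1) n, of p] by linarith
qed

text \<open>In one step the probability of the value \<open>k\<close> becomes a combination of the probabilities of \<open>k\<close> and
\<open>k - 1\<close> with weights \<open>1 - k / n\<close> and \<open>(k - 1) / n\<close>. These weights are nonnegative because at least one vertex lies
outside the clan, and they add up to \<open>1 - 1 / n\<close>, so the largest point probability shrinks by this factor.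
The arrival of \<open>u\<close> leaves the clan unchanged, which costs at most a factor \<open>2\<close>.\<close>

lemma prob_N_eq:
  assumes i: "i \<in> {1..m}" and n: "m \<le> n"
  shows "prob_hist n (\<lambda>p. N p n i = k) \<le> (if n < u then 1 else 2) * ((real m - 1) / (real n - 1))"
  using n
proof (induction n arbitrary: k rule: dec_induct)
  case base
  then show ?case
    using m prob_hist_le_1 by simp
next
  case (step n)
  let ?R = "insert u {1..m}"
  let ?B = "(if n < u then 1 else 2) * ((real m - 1) / (real n - 1))"
  have n1: "1 \<le> n" using m step by auto
  have B0: "0 \<le> ?B" using m step by simp
  show ?case
  proof (cases "Suc n = u")
    case True
    have "prob_hist (Suc n) (\<lambda>p. N p (Suc n) i = k) = prob_hist n (\<lambda>p. N p n i = k)"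
      using i True m avg_clan_sizes_Suc_root[OF n1, of ?R i i "\<lambda>a b. of_bool (a = k)"] by simp
    also have "\<dots> \<le> (real m - 1) / (real n - 1)"
      using step.IH[of k] True by simp
    also have "\<dots> \<le> 2 * ((real m - 1) / real n)"
    proof -
      have "(real m - 1) / (real n - 1) \<le> (real m - 1) / (real n / 2)"
        using m step by (intro divide_left_mono) auto
      then show ?thesis by (simp add: mult.commute)
    qed
    finally show ?thesis
      using True by auto
  next
    case False
    let ?P = "prob_hist n (\<lambda>p. N p n i = k)" and ?Q = "prob_hist n (\<lambda>p. Suc (N p n i) = k)"
    have nR: "Suc n \<notin> ?R" using False step by auto
    have eq: "prob_hist (Suc n) (\<lambda>p. N p (Suc n) i = k)
        = (1 - real k / n) * ?P + (real k - 1) / n * ?Q"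
      using prob_clan_size_Suc[OF n1 _ nR] m by simp
    obtain z where z: "z \<in> {1..m}" "z \<noteq> i"
      using m i by (metis atLeastAtMost_iff le_refl numeral_le_one_iff one_le_numeral order_trans
          semiring_norm(69))
    have less: "N p n i < n" for p
      using sum_N_less[of "{i}" z n p] z i step by auto
    have "(1 - real k / n) * ?P + (real k - 1) / n * ?Q \<le> (1 - 1 / n) * ?B"
    proof (cases "1 \<le> k \<and> k \<le> n")
      case k: True
      have "?Q \<le> ?B"
        using step.IH[of "k - 1"] k by (cases k) auto
      then have "(real k - 1) / n * ?Q \<le> (real k - 1) / n * ?B"
        using k by (intro mult_left_mono) auto
      moreover have "(1 - real k / n) * ?P \<le> (1 - real k / n) * ?B"
        using step.IH[of k] k n1 by (intro mult_left_mono) auto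
      ultimately have "(1 - real k / n) * ?P + (real k - 1) / n * ?Q
          \<le> ((1 - real k / n) + (real k - 1) / n) * ?B"
        by (simp only: distrib_right)
      also have "(1 - real k / n) + (real k - 1) / n = 1 - 1 / n"
        by (simp add: diff_divide_distrib)
      finally show ?thesis .
    next
      case k: False
      have "\<not> N p n i = k" "\<not> Suc (N p n i) = k" for p
        using k less[of p] N_pos[OF i step(1), of p] by linarith+
      then have "?P = 0" "?Q = 0"
        by (intro prob_hist_zero; simp)+
      moreover have "0 \<le> (1 - 1 / real n) * ?B"
        using n1 by (intro mult_nonneg_nonneg[OF _ B0]) auto
      ultimately show ?thesis
        by simp
    qed
    also have "(1 - 1 / n) * ?B = (if n < u then 1 else 2) * ((real m - 1) / real n)"
      using m step by (simp add: field_simps)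
    also have "(if n < u then 1 else 2) = (if Suc n < u then 1 else 2 :: real)"
      using False by auto
    finally show ?thesis
      unfolding eq by simp
  qed
qed

text \<open>As for a single clan, now with three weights that add up to \<open>1 - 2 / n\<close>. A third clan has to exist for the weights
to be nonnegative; this is where \<open>m \<ge> 3\<close> enters.\<close>

lemma prob_N_eq_pair:
  assumes m3: "3 \<le> m" and ij: "i \<in> {1..m}" "j \<in> {1..m}" "i \<noteq> j" and n: "m \<le> n"
  shows "prob_hist n (\<lambda>p. N p n i = k \<and> N p n j = l)
    \<le> (if n < u then 1 else 3) * ((real m - 1) * (real m - 2) / ((real n - 1) * (real n - 2)))"
  using n
proof (induction n arbitrary: k l rule: dec_induct)
  case base
  then show ?case
    using m m3 prob_hist_le_1 by simp
next
  case (step n)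
  let ?R = "insert u {1..m}"
  let ?M = "(real m - 1) * (real m - 2)"
  let ?B = "(if n < u then 1 else 3) * (?M / ((real n - 1) * (real n - 2)))"
  have n1: "1 \<le> n" using m step by auto
  have M0: "0 \<le> ?M" using m3 by simp
  then have B0: "0 \<le> ?B" using m3 step by simp
  show ?case
  proof (cases "Suc n = u")
    case True
    have "prob_hist (Suc n) (\<lambda>p. N p (Suc n) i = k \<and> N p (Suc n) j = l)
        = prob_hist n (\<lambda>p. N p n i = k \<and> N p n j = l)"
      using ij True m avg_clan_sizes_Suc_root[OF n1, of ?R i j "\<lambda>a b. of_bool (a = k \<and> b = l)"] by simp
    also have "\<dots> \<le> ?M / ((real n - 1) * (real n - 2))"
      using step.IH[of k l] True by simp
    also have "\<dots> \<le> ?M / (real n * (real n - 1) / 3)"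
    proof (rule divide_left_mono[OF _ M0])
      have "real n * (real n - 1) \<le> (3 * (real n - 2)) * (real n - 1)"
        using step m3 by (intro mult_right_mono) auto
      then show "real n * (real n - 1) / 3 \<le> (real n - 1) * (real n - 2)"
        by (subst mult.commute[of "real n - 1"]) linarith
    qed (use step m3 in auto)
    also have "\<dots> = 3 * (?M / ((real (Suc n) - 1) * (real (Suc n) - 2)))"
      by (simp add: mult.commute)
    finally show ?thesis
      using True by simp
  next
    case False
    let ?P = "prob_hist n (\<lambda>p. N p n i = k \<and> N p n j = l)"
    let ?Q = "prob_hist n (\<lambda>p. Suc (N p n i) = k \<and> N p n j = l)"
    let ?S = "prob_hist n (\<lambda>p. N p n i = k \<and> Suc (N p n j) = l)"
    have nR: "Suc n \<notin> ?R" using False step by auto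
    have eq: "prob_hist (Suc n) (\<lambda>p. N p (Suc n) i = k \<and> N p (Suc n) j = l)
        = (1 - (real k + real l) / n) * ?P + (real k - 1) / n * ?Q + (real l - 1) / n * ?S"
      using prob_clan_sizes_Suc[OF n1 _ nR ij(3)] m by simp
    obtain z where z: "z \<in> {1..m}" "z \<noteq> i" "z \<noteq> j"
    proof -
      have "\<not> {1, 2, 3} \<subseteq> {i, j}"
        using card_mono[of "{i, j}" "{1, 2, 3 :: nat}"] by (auto simp: card_insert_if)
      then show ?thesis
        using m3 that[of 1] that[of 2] that[of 3] by auto
    qed
    have less: "N p n i + N p n j < n" for p
      using sum_N_less[of "{i, j}" z n p] z ij step by auto
    have "(1 - (real k + real l) / n) * ?P + (real k - 1) / n * ?Q + (real l - 1) / n * ?S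
        \<le> (1 - 2 / n) * ?B"
    proof (cases "1 \<le> k \<and> 1 \<le> l \<and> k + l \<le> n")
      case k: True
      have "?Q \<le> ?B"
        using step.IH[of "k - 1" l] k by (cases k) auto
      then have Q: "(real k - 1) / n * ?Q \<le> (real k - 1) / n * ?B"
        using k by (intro mult_left_mono) auto
      have "?S \<le> ?B"
        using step.IH[of k "l - 1"] k by (cases l) auto
      then have S: "(real l - 1) / n * ?S \<le> (real l - 1) / n * ?B"
        using k by (intro mult_left_mono) auto
      have "real k + real l \<le> real n"
        using k by linarith
      then have "(1 - (real k + real l) / n) * ?P \<le> (1 - (real k + real l) / n) * ?B"
        using step.IH[of k l] n1 by (intro mult_left_mono) auto
      then have "(1 - (real k + real l) / n) * ?P + (real k - 1) / n * ?Q + (real l - 1) / n * ?S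
          \<le> ((1 - (real k + real l) / n) + (real k - 1) / n + (real l - 1) / n) * ?B"
        using Q S unfolding distrib_right by linarith
      also have "(1 - (real k + real l) / n) + (real k - 1) / n + (real l - 1) / n = 1 - 2 / n"
        by (simp add: diff_divide_distrib add_divide_distrib)
      finally show ?thesis .
    next
      case k: False
      have pos: "1 \<le> N p n i" "1 \<le> N p n j" for p
        using N_pos ij step(1) by auto
      have "\<not> (N p n i = k \<and> N p n j = l)" "\<not> (Suc (N p n i) = k \<and> N p n j = l)"
        "\<not> (N p n i = k \<and> Suc (N p n j) = l)" for p
        using k less[of p] pos[of p] by linarith+
      then have "?P = 0" "?Q = 0" "?S = 0"
        by (intro prob_hist_zero; simp)+
      moreover have "0 \<le> (1 - 2 / real n) * ?B"
        using B0 m3 step(1) by (intro mult_nonneg_nonneg) auto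
      ultimately show ?thesis
        by simp
    qed
    also have "(1 - 2 / n) * ?B = (if n < u then 1 else 3) * (?M / (real n * (real n - 1)))"
    proof -
      have n3: "real n \<ge> 3" using m3 step(1) by simp
      then have "(1 - 2 / n) / ((real n - 1) * (real n - 2)) = 1 / (real n * (real n - 1))"
        by (simp add: divide_simps)
      then show ?thesis
        by (metis (no_types, lifting) divide_inverse mult.assoc mult.left_commute mult_1)
    qed
    also have "(if n < u then 1 else 3) = (if Suc n < u then 1 else 3 :: real)"
      using False by auto
    also have "real n * (real n - 1) = (real (Suc n) - 1) * (real (Suc n) - 2)"
      by simp
    finally show ?thesis
      unfolding eq .
  qed
qed

text \<open>Given that the offspring of \<open>u\<close> has size \<open>k\<close>, the remaining \<open>n - k\<close> vertices form a recursive tree of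
their own, so the point probabilities of a clan of that tree are at most \<open>(m - 1) / (n - k - 1)\<close>. Clearing
denominators turns the conditional statement into one that passes through the recursion.\<close>

lemma prob_N_eq_given_last:
  assumes i: "i \<in> {1..m}" and n: "m \<le> n"
  shows "(real n - 1 - real k) * prob_hist n (\<lambda>p. N p n u = k \<and> N p n i = l)
    \<le> (real m - 1) * prob_hist n (\<lambda>p. N p n u = k)"
  using n
proof (induction n arbitrary: k l rule: dec_induct)
  case base
  have zero: "N p m u = 0" for p
  proof -
    have "clan (insert u {1..m}) p m u = {}"
      using anc_le[of "insert u {1..m}" p] m by (force simp: clan_def)
    then show ?thesis by simp
  qed
  show ?case
  proof (cases "k = 0")
    case True
    then show ?thesis
      using zero prob_hist_le_1[of m "\<lambda>p. N p m i = l"] m by (simp add: mult_left_le)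
  next
    case False
    then show ?thesis
      using zero by simp
  qed
next
  case (step n)
  let ?R = "insert u {1..m}"
  have n1: "1 \<le> n" using m step by auto
  have iu: "i \<noteq> u" using i m by auto
  show ?case
  proof (cases "Suc n = u")
    case True
    have root: "N p (Suc n) u = 1" if p: "p \<in> histories (Suc n)" for p
    proof -
      obtain x q where "x \<in> {1..n}" "q \<in> histories n" "p = q(Suc n := x)"
        using p unfolding histories_Suc(1)[OF n1] by (auto simp del: One_nat_def)
      then show ?thesis
        using clan_size_Suc_root[of q n x ?R "Suc n"] n1 True by simp
    qed
    have zero: "N p n u = 0" for p
    proof -
      have "clan (insert u {1..m}) p n u = {}"
      proof -
        have "y \<notin> clan (insert u {1..m}) p n u" for y
          using anc_le[of "insert u {1..m}" p y] True by (simp add: clan_def)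
        then show ?thesis by blast
      qed
      then show ?thesis by simp
    qed
    show ?thesis
    proof (cases "k = 1")
      case k: True
      have "prob_hist (Suc n) (\<lambda>p. N p (Suc n) u = k \<and> N p (Suc n) i = l)
          = prob_hist (Suc n) (\<lambda>p. N p (Suc n) i = l)"
        using root by (intro avg_cong) (simp add: k)
      also have "\<dots> = prob_hist n (\<lambda>p. N p n i = l)"
        using True i m avg_clan_sizes_Suc_root[OF n1, of ?R i i "\<lambda>a b. of_bool (a = l)"] by simp
      also have "\<dots> = prob_hist n (\<lambda>p. N p n u = 0 \<and> N p n i = l)"
        using zero by simp
      finally have "prob_hist (Suc n) (\<lambda>p. N p (Suc n) u = k \<and> N p (Suc n) i = l)
        = prob_hist n (\<lambda>p. N p n u = 0 \<and> N p n i = l)" .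
      moreover have "prob_hist (Suc n) (\<lambda>p. N p (Suc n) u = k) = 1"
        using avg_cong[of "Suc n" "\<lambda>p. of_bool (N p (Suc n) u = k)" "\<lambda>_. 1"] root by (simp add: k)
      ultimately show ?thesis
        using step.IH[of 0 l] zero k by simp
    next
      case False
      then have "prob_hist (Suc n) (\<lambda>p. N p (Suc n) u = k \<and> N p (Suc n) i = l) = 0"
        using root by (intro prob_hist_zero) simp
      then show ?thesis
        using m by (simp add: prob_hist_nonneg)
    qed
  next
    case False
    let ?P = "prob_hist n (\<lambda>p. N p n u = k \<and> N p n i = l)"
    let ?Q = "prob_hist n (\<lambda>p. Suc (N p n u) = k \<and> N p n i = l)"
    let ?S = "prob_hist n (\<lambda>p. N p n u = k \<and> Suc (N p n i) = l)"
    let ?p = "prob_hist n (\<lambda>p. N p n u = k)" and ?q = "prob_hist n (\<lambda>p. Suc (N p n u) = k)"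
    have nR: "Suc n \<notin> ?R" using False step by auto
    have eq: "prob_hist (Suc n) (\<lambda>p. N p (Suc n) u = k \<and> N p (Suc n) i = l)
        = (1 - (real k + real l) / n) * ?P + (real k - 1) / n * ?Q + (real l - 1) / n * ?S"
      using prob_clan_sizes_Suc[OF n1 _ nR, of u i] iu m by simp
    have eq': "prob_hist (Suc n) (\<lambda>p. N p (Suc n) u = k)
        = (1 - real k / n) * ?p + (real k - 1) / n * ?q"
      using prob_clan_size_Suc[OF n1 _ nR] m by simp
    obtain z where z: "z \<in> {1..m}" "z \<noteq> i"
      using m i by (metis atLeastAtMost_iff le_refl numeral_le_one_iff one_le_numeral order_trans
          semiring_norm(69))
    have less: "N p n u + N p n i < n" for p
      using sum_N_less[of "{u, i}" z n p] z i iu m step by auto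
    have pos: "1 \<le> N p n i" for p
      using N_pos[OF i step(1)] .
    have pq0: "0 \<le> ?p" "0 \<le> ?q" "0 \<le> ?P" "0 \<le> ?Q" "0 \<le> ?S"
      by (rule prob_hist_nonneg)+
    have kle: "real n * ((1 - real k / n) * ?p) \<ge> 0"
    proof (cases "k \<le> n")
      case False
      then have "?p = 0"
        using less by (intro prob_hist_zero) (meson le_add1 less_le_trans not_le order.strict_implies_order order_le_less_trans)
      then show ?thesis by simp
    qed (use pq0 in \<open>simp add: divide_le_eq\<close>)
    have A: "(real n - real k) * ((real n - real k - real l) * ?P + (real l - 1) * ?S)
        \<le> (real m - 1) * ((real n - real k) * ?p)"
    proof (cases "k + 2 \<le> n \<and> 1 \<le> l \<and> k + l \<le> n")
      case True
      have "?S \<le> (real m - 1) * ?p / (real n - 1 - real k)"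
        using step.IH[of k "l - 1"] True by (cases l) (auto simp: pos_le_divide_eq mult.commute)
      moreover have "?P \<le> (real m - 1) * ?p / (real n - 1 - real k)"
        using step.IH[of k l] True by (simp add: pos_le_divide_eq mult.commute)
      moreover have "0 \<le> real n - real k - real l" "0 \<le> real l - 1"
        using True by linarith+
      ultimately have "(real n - real k - real l) * ?P + (real l - 1) * ?S
          \<le> (real n - real k - real l) * ((real m - 1) * ?p / (real n - 1 - real k))
            + (real l - 1) * ((real m - 1) * ?p / (real n - 1 - real k))"
        by (intro add_mono mult_left_mono)
      also have "\<dots> = (real n - 1 - real k) * ((real m - 1) * ?p / (real n - 1 - real k))"
        unfolding distrib_right[symmetric] by (rule arg_cong2[where f = "(*)"]) simp_all
      also have "\<dots> = (real m - 1) * ?p"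
        using True by simp
      finally have "(real n - real k) * ((real n - real k - real l) * ?P + (real l - 1) * ?S)
          \<le> (real n - real k) * ((real m - 1) * ?p)"
        using True by (intro mult_left_mono) auto
      then show ?thesis by (simp add: algebra_simps)
    next
      case out: False
      have "\<not> (N p n u = k \<and> N p n i = l)" "\<not> (N p n u = k \<and> Suc (N p n i) = l)" for p
        using out less[of p] pos[of p] by linarith+
      then have "?P = 0" "?S = 0"
        by (intro prob_hist_zero; simp)+
      moreover have "0 \<le> (real n - real k) * ?p"
        using kle n1 by (simp add: algebra_simps)
      ultimately show ?thesis
        using m by simp
    qed
    have B: "(real k - 1) * ((real n - real k) * ?Q) \<le> (real m - 1) * ((real k - 1) * ?q)"
    proof (cases k)
      case 0
      then show ?thesis by simp
    next
      case (Suc k')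
      have "(real n - real k) * ?Q \<le> (real m - 1) * ?q"
        using step.IH[of k' l] Suc by (simp add: algebra_simps)
      then have "(real k - 1) * ((real n - real k) * ?Q) \<le> (real k - 1) * ((real m - 1) * ?q)"
        using Suc by (intro mult_left_mono) auto
      then show ?thesis by (simp add: algebra_simps)
    qed
    have "real n * ((real (Suc n) - 1 - real k)
          * ((1 - (real k + real l) / n) * ?P + (real k - 1) / n * ?Q + (real l - 1) / n * ?S))
        = (real n - real k) * ((real n - real k - real l) * ?P + (real l - 1) * ?S)
          + (real k - 1) * ((real n - real k) * ?Q)"
      using n1 by (simp add: field_simps)
    also have "\<dots> \<le> (real m - 1) * ((real n - real k) * ?p) + (real m - 1) * ((real k - 1) * ?q)"
      using A B by (rule add_mono)
    also have "\<dots> = real n * ((real m - 1) * ((1 - real k / n) * ?p + (real k - 1) / n * ?q))"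
      using n1 by (simp add: field_simps)
    finally show ?thesis
      unfolding eq eq' using n1 by simp
  qed
qed

end

text \<open>For a clan of size \<open>d\<close> the rising factorial \<open>d (d + 1) \<dots> (d + j - 1)\<close> grows by the deterministic
factor \<open>1 + j / n\<close> in expectation, exactly as the rising factorial of \<open>n\<close> itself does.\<close>

lemma avg_pochhammer_descendants:
  assumes w: "2 \<le> w" and n: "w \<le> n"
  shows "avg n (\<lambda>p. pochhammer (real (card (descendants p n w))) j)
    = fact j * pochhammer (real n) j / pochhammer (real w) j"
  using n
proof (induction n rule: dec_induct)
  case base
  have "card (descendants p w w) = 1" if p: "p \<in> histories w" for p
  proof -
    have "y = w" if "y \<in> descendants p w w" for y
      using that anc_le[of "{1, w}" p y] by (auto simp: clan_def)
    then have "descendants p w w = {w}"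
      using descendants_step(2)[OF p, of w w] w by auto
    then show ?thesis by simp
  qed
  then have "avg w (\<lambda>p. pochhammer (real (card (descendants p w w))) j) = avg w (\<lambda>p. fact j)"
    by (intro avg_cong) (simp add: pochhammer_fact)
  moreover have "pochhammer (real w) j \<noteq> 0"
    using w by (intro less_imp_neq[symmetric] pochhammer_pos) simp
  ultimately show ?case by simp
next
  case (step n)
  have n1: "1 \<le> n" using w step by simp
  let ?d = "\<lambda>p. real (card (descendants p n w))"
  have poch: "x * pochhammer (x + 1) j = (x + real j) * pochhammer x j" for x :: real
    by (metis mult.commute pochhammer_Suc pochhammer_rec)
  have "avg (Suc n) (\<lambda>p. pochhammer (real (card (descendants p (Suc n) w))) j)
    = avg n (\<lambda>p. (1 - (?d p + real (clan_size {1, w} p n 1)) / n) * pochhammer (?d p) j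
        + ?d p / n * pochhammer (real (Suc (card (descendants p n w)))) j
        + real (clan_size {1, w} p n 1) / n * pochhammer (?d p) j)"
    using avg_clan_sizes_Suc[OF n1, of "{1, w}" w 1 "\<lambda>a b. pochhammer (real a) j"] w step by simp
  also have "\<dots> = avg n (\<lambda>p. (real n + real j) / n * pochhammer (?d p) j)"
  proof (rule avg_cong)
    fix p
    let ?x = "?d p" and ?y = "real (clan_size {1, w} p n 1)"
    have "?x / n * pochhammer (real (Suc (card (descendants p n w)))) j
        = (?x + real j) * pochhammer ?x j / n"
      using poch[of ?x] by (simp add: add.commute)
    then show "(1 - (?x + ?y) / n) * pochhammer ?x j
        + ?x / n * pochhammer (real (Suc (card (descendants p n w)))) j + ?y / n * pochhammer ?x j
        = (real n + real j) / n * pochhammer ?x j"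
      using n1 by (simp add: field_simps)
  qed
  also have "\<dots> = (real n + real j) / n * (fact j * pochhammer (real n) j / pochhammer (real w) j)"
    unfolding avg_cmult step.IH ..
  also have "\<dots> = fact j * ((real n + real j) * pochhammer (real n) j / n) / pochhammer (real w) j"
    by simp
  also have "(real n + real j) * pochhammer (real n) j / n = pochhammer (real (Suc n)) j"
    using poch[of "real n"] n1 by (simp add: field_simps)
  finally show ?case .
qed

lemma powr_increment_ge:
  fixes e :: real
  assumes e: "e < 1" "e \<noteq> 0" and k: "1 \<le> k"
  shows "real (Suc k) powr (e - 1) \<le> (real (Suc k) powr e - real k powr e) / e"
proof -
  have "\<exists>z. real k < z \<and> z < real (Suc k) \<and>
    real (Suc k) powr e - real k powr e = (real (Suc k) - real k) * (e * z powr (e - 1))"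
    using k by (intro MVT2) (auto intro!: derivative_eq_intros)
  then obtain z where z: "real k < z" "z < real (Suc k)"
    "real (Suc k) powr e - real k powr e = e * z powr (e - 1)"
    by auto
  then have "(real (Suc k) powr e - real k powr e) / e = z powr (e - 1)"
    using e by simp
  moreover have "real (Suc k) powr (e - 1) \<le> z powr (e - 1)"
    using z k e by (intro powr_mono2') auto
  ultimately show ?thesis by simp
qed

lemma sum_powr_le:
  fixes s :: real
  assumes s: "0 < s" "s < 1"
  shows "(\<Sum>k\<in>{1..n}. real k powr (s - 1)) \<le> real n powr s / s"
proof (induction n)
  case (Suc n)
  show ?case
  proof (cases "n = 0")
    case True
    then show ?thesis using s by simp
  next
    case False
    then show ?thesis
      using Suc powr_increment_ge[of s n] s by (simp add: diff_divide_distrib)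
  qed
qed simp

lemma sum_powr_tail_le:
  fixes s :: real
  assumes s: "0 < s" and m: "1 \<le> m" "m \<le> n"
  shows "(\<Sum>k\<in>{m<..n}. real k powr (- s - 1)) \<le> (real m powr - s - real n powr - s) / s"
  using m(2)
proof (induction n rule: dec_induct)
  case (step n)
  have "{m<..Suc n} = insert (Suc n) {m<..n}"
    using step by auto
  then show ?case
    using step m powr_increment_ge[of "- s" n] s by (simp add: diff_divide_distrib)
qed simp

lemma pochhammer_ge_power: "0 \<le> x \<Longrightarrow> x ^ j \<le> pochhammer x j" for x :: real
proof (induction j)
  case (Suc j)
  have "x ^ j * x \<le> pochhammer x j * (x + real j)"
    using Suc order.trans[OF zero_le_power Suc.IH] by (intro mult_mono) auto
  then show ?case
    unfolding pochhammer_Suc power_Suc2 by simp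
qed simp

lemma pochhammer_nonneg': "0 \<le> x \<Longrightarrow> 0 \<le> pochhammer x j" for x :: real
  using order.trans[OF zero_le_power pochhammer_ge_power] by blast

lemma pochhammer_le_power: "0 \<le> x \<Longrightarrow> pochhammer x j \<le> (x + real j) ^ j" for x :: real
proof (induction j)
  case (Suc j)
  have "pochhammer x (Suc j) \<le> (x + real j) ^ j * (x + real j)"
    unfolding pochhammer_Suc using Suc by (intro mult_right_mono) auto
  also have "\<dots> \<le> (x + real (Suc j)) ^ j * (x + real (Suc j))"
    using Suc.prems by (intro mult_mono power_mono) auto
  finally show ?case
    unfolding power_Suc2 .
qed simp

text \<open>Markov's inequality for the sixth rising factorial moment, which is high enough for the exponent \<open>6/5\<close> in
\<open>prob_jordan2_le\<close>.\<close>

lemma prob_descendants_ge: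
  assumes w: "1 \<le> w" "w \<le> n" and t: "0 < t"
  shows "prob_hist n (\<lambda>p. t * n / w \<le> card (descendants p n w)) \<le> 720 * 7 ^ 6 * t powr - 6"
proof (cases "w = 1")
  case True
  show ?thesis
  proof (cases "t \<le> 1")
    case t1: True
    then have "1 \<le> t powr - 6"
      using powr_mono2'[of "-6" t 1] t by simp
    then show ?thesis
      using prob_hist_le_1[of n "\<lambda>p. t * n / w \<le> card (descendants p n w)"] by simp
  next
    case False
    have "\<not> t * n / w \<le> card (descendants p n w)" for p
    proof -
      have "card (descendants p n w) \<le> n"
        using card_mono[OF _ clan_subset[of "{1, w}" p n w]] by simp
      moreover have "real n < t * n"
        using False w by simp
      ultimately show ?thesis
        using True by simp
    qed
    then have "prob_hist n (\<lambda>p. t * n / w \<le> card (descendants p n w)) = 0"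
      by (intro prob_hist_zero) blast
    then show ?thesis by simp
  qed
next
  case False
  let ?a = "t * real n / real w"
  have a: "0 < ?a" using w t by simp
  have "prob_hist n (\<lambda>p. ?a \<le> card (descendants p n w))
      \<le> avg n (\<lambda>p. pochhammer (real (card (descendants p n w))) 6) / ?a ^ 6"
  proof (rule markov)
    fix p assume "?a \<le> card (descendants p n w)"
    then have "?a ^ 6 \<le> real (card (descendants p n w)) ^ 6"
      using a by (intro power_mono) auto
    also have "\<dots> \<le> pochhammer (real (card (descendants p n w))) 6"
      by (intro pochhammer_ge_power) auto
    finally show "?a ^ 6 \<le> pochhammer (real (card (descendants p n w))) 6" .
  qed (use a w t in \<open>auto simp: pochhammer_nonneg'\<close>)
  also have "avg n (\<lambda>p. pochhammer (real (card (descendants p n w))) 6)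
      = fact 6 * pochhammer (real n) 6 / pochhammer (real w) 6"
    using False w by (intro avg_pochhammer_descendants) auto
  also have "fact 6 * pochhammer (real n) 6 / pochhammer (real w) 6 \<le> fact 6 * (7 * real n) ^ 6 / real w ^ 6"
  proof (intro frac_le mult_left_mono)
    have "pochhammer (real n) 6 \<le> (real n + real 6) ^ 6"
      by (intro pochhammer_le_power) auto
    also have "\<dots> \<le> (7 * real n) ^ 6"
      using w by (intro power_mono) auto
    finally show "pochhammer (real n) 6 \<le> (7 * real n) ^ 6" .
    show "real w ^ 6 \<le> pochhammer (real w) 6"
      by (intro pochhammer_ge_power) auto
  qed (use w in auto)
  also have "fact 6 * (7 * real n) ^ 6 / real w ^ 6 / ?a ^ 6 = 720 * 7 ^ 6 * (1 / t ^ 6)"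
    using w t by (simp add: power_mult_distrib power_divide fact_numeral)
  also have "1 / t ^ 6 = t powr - 6"
    using t by (simp add: powr_minus_divide powr_numeral)
  finally show ?thesis
    using a by (simp add: divide_right_mono)
qed

context late_vertex
begin

lemma N_last: "p \<in> histories n \<Longrightarrow> clan (insert u {1..m}) p n u = descendants p n u"
  using m by (intro clan_last_root) auto

text \<open>Conditionally on the offspring of \<open>u\<close> having size \<open>k < n / 2\<close>, the clan of \<open>i\<close> is at most that large with probability
of order \<open>k m / n\<close>, and the mean of \<open>k\<close> is \<open>n / u\<close>. The remaining case \<open>k \<ge> n / 2\<close> has
probability at most \<open>2 / u\<close>.\<close>

lemma prob_N_le_last:
  assumes i: "i \<in> {1..m}" and n: "u \<le> n"
  shows "prob_hist n (\<lambda>p. N p n i \<le> N p n u) \<le> 4 * (real m / real u)"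
proof -
  let ?A = "{k. 2 * k < n}"
  have fin: "finite ?A"
    by (rule finite_subset[of _ "{..<n}"]) auto
  have mean: "avg n (\<lambda>p. real (N p n u)) = real n / real u"
  proof -
    have "avg n (\<lambda>p. real (N p n u)) = avg n (\<lambda>p. pochhammer (real (card (descendants p n u))) 1)"
      using N_last by (intro avg_cong) simp
    also have "\<dots> = real n / real u"
      using avg_pochhammer_descendants[of u n 1] m n by simp
    finally show ?thesis .
  qed
  have "prob_hist n (\<lambda>p. N p n i \<le> N p n u)
      \<le> prob_hist n (\<lambda>p. n / 2 \<le> N p n u \<or> (\<exists>k\<in>?A. \<exists>l\<in>{1..k}. N p n u = k \<and> N p n i = l))"
    using N_pos[OF i, of n] m n by (intro prob_hist_mono) fastforce
  also have "\<dots> \<le> prob_hist n (\<lambda>p. n / 2 \<le> N p n u)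
      + prob_hist n (\<lambda>p. \<exists>k\<in>?A. \<exists>l\<in>{1..k}. N p n u = k \<and> N p n i = l)"
    by (rule prob_hist_disj_le)
  also have "prob_hist n (\<lambda>p. n / 2 \<le> N p n u) \<le> 2 / u"
  proof -
    have "prob_hist n (\<lambda>p. n / 2 \<le> N p n u) \<le> avg n (\<lambda>p. real (N p n u)) / (n / 2)"
      using m n by (intro markov) auto
    also have "\<dots> = 2 / u"
      unfolding mean using m n by simp
    finally show ?thesis .
  qed
  also have "prob_hist n (\<lambda>p. \<exists>k\<in>?A. \<exists>l\<in>{1..k}. N p n u = k \<and> N p n i = l)
      \<le> (\<Sum>k\<in>?A. prob_hist n (\<lambda>p. \<exists>l\<in>{1..k}. N p n u = k \<and> N p n i = l))"
    by (rule prob_hist_Bex_le[OF fin])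
  also have "\<dots> \<le> (\<Sum>k\<in>?A. \<Sum>l\<in>{1..k}. prob_hist n (\<lambda>p. N p n u = k \<and> N p n i = l))"
    by (intro sum_mono prob_hist_Bex_le) auto
  also have "\<dots> \<le> (\<Sum>k\<in>?A. \<Sum>l\<in>{1..k}. 3 * real m / n * prob_hist n (\<lambda>p. N p n u = k))"
  proof (intro sum_mono)
    fix k l assume k: "k \<in> ?A"
    let ?P = "prob_hist n (\<lambda>p. N p n u = k \<and> N p n i = l)" and ?p = "prob_hist n (\<lambda>p. N p n u = k)"
    have "real n / 3 \<le> real n - 1 - real k"
      using k m n by simp
    then have "real n / 3 * ?P \<le> (real n - 1 - real k) * ?P"
      by (intro mult_right_mono prob_hist_nonneg)
    also have "\<dots> \<le> (real m - 1) * ?p"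
      using m n by (intro prob_N_eq_given_last[OF i]) auto
    also have "\<dots> \<le> real m * ?p"
      by (intro mult_right_mono prob_hist_nonneg) auto
    finally show "?P \<le> 3 * real m / n * ?p"
      using m n by (simp add: field_simps)
  qed
  also have "\<dots> = 3 * real m / n * avg n (\<lambda>p. \<Sum>k\<in>?A. real k * of_bool (N p n u = k))"
    unfolding avg_sum avg_cmult by (simp add: sum_distrib_left mult_ac)
  also have "avg n (\<lambda>p. \<Sum>k\<in>?A. real k * of_bool (N p n u = k)) \<le> avg n (\<lambda>p. real (N p n u))"
  proof (rule avg_mono)
    fix p
    have "(\<Sum>k\<in>?A. real k * of_bool (N p n u = k)) = (\<Sum>k\<in>?A. if N p n u = k then real k else 0)"
      by (intro sum.cong) auto
    then show "(\<Sum>k\<in>?A. real k * of_bool (N p n u = k)) \<le> real (N p n u)"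
      using fin by simp
  qed
  finally have "prob_hist n (\<lambda>p. N p n i \<le> N p n u) \<le> 2 / u + 3 * real m / n * (real n / real u)"
    unfolding mean by (simp add: mult_left_mono divide_right_mono)
  also have "\<dots> = (2 + 3 * real m) / u"
    using m n by (simp add: add_divide_distrib)
  also have "\<dots> \<le> 4 * real m / u"
    using m by (intro divide_right_mono) auto
  finally show ?thesis by simp
qed

lemma prob_N_le:
  fixes T :: real
  assumes i: "i \<in> {1..m}" and n: "u \<le> n" and T: "0 \<le> T"
  shows "prob_hist n (\<lambda>p. N p n i \<le> T) \<le> 2 * T * (m / n)"
proof -
  let ?K = "nat \<lfloor>T\<rfloor>"
  have "prob_hist n (\<lambda>p. N p n i \<le> T) \<le> prob_hist n (\<lambda>p. \<exists>k\<in>{1..?K}. N p n i = k)"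
    using N_pos[OF i, of n] m n T by (intro prob_hist_mono) (auto simp: le_nat_floor)
  also have "\<dots> \<le> (\<Sum>k\<in>{1..?K}. prob_hist n (\<lambda>p. N p n i = k))"
    by (intro prob_hist_Bex_le) auto
  also have "\<dots> \<le> (\<Sum>k\<in>{1..?K}. 2 * (m / n))"
  proof (intro sum_mono)
    fix k
    have "prob_hist n (\<lambda>p. N p n i = k) \<le> 2 * ((real m - 1) / (real n - 1))"
      using prob_N_eq[OF i, of n k] m n by simp
    also have "(real m - 1) / (real n - 1) \<le> m / n"
      using m n by (simp add: field_simps)
    finally show "prob_hist n (\<lambda>p. N p n i = k) \<le> 2 * (m / n)" by simp
  qed
  also have "\<dots> = real ?K * (2 * (m / n))"
    by simp
  also have "\<dots> \<le> T * (2 * (m / n))"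
    using T by (intro mult_right_mono) auto
  finally show ?thesis by (simp only: mult_ac)
qed

text \<open>Both sizes are of order \<open>n / m\<close>. If one of them exceeds \<open>n / m\<close>, the other is at most \<open>T m / n\<close>, and the bound for one
clan applies. Otherwise the joint point probabilities are of order \<open>(m / n)\<^sup>2\<close>, and the number of pairs
with \<open>k l \<le> T\<close> is estimated by the sum of \<open>(T / (k l))\<close> to the power \<open>3/4\<close>; an exponent below \<open>1\<close>
keeps the sums over \<open>k, l \<le> n / m\<close> free of logarithms.\<close>

lemma prob_product_le:
  assumes m3: "3 \<le> m" and ij: "i \<in> {1..m}" "j \<in> {1..m}" "i \<noteq> j" and n: "u \<le> n" and T: "0 < T"
  shows "prob_hist n (\<lambda>p. real (N p n i) * real (N p n j) \<le> T)
    \<le> 52 * (T * (m / n)\<^sup>2) powr (3/4)"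
proof (cases "T * (m / n)\<^sup>2 \<le> 1")
  case False
  then have "1 \<le> (T * (m / n)\<^sup>2) powr (3/4)"
    by (intro ge_one_powr_ge_zero) auto
  then show ?thesis
    using prob_hist_le_1[of n "\<lambda>p. real (N p n i) * real (N p n j) \<le> T"] by linarith
next
  case True
  define r where "r = real m / real n"
  have r: "0 < r" "r \<le> 1" using m n by (auto simp: r_def)
  let ?K = "nat \<lfloor>1 / r\<rfloor>"
  let ?B = "\<lambda>k l. prob_hist n (\<lambda>p. N p n i = k \<and> N p n j = l)"
  have rho: "T * r\<^sup>2 \<le> (T * r\<^sup>2) powr (3/4)"
    using True T r powr_mono'[of "3/4" 1 "T * r\<^sup>2"] by (simp add: r_def)
  have "prob_hist n (\<lambda>p. real (N p n i) * real (N p n j) \<le> T)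
    \<le> prob_hist n (\<lambda>p. (N p n i \<le> T * r \<or> N p n j \<le> T * r) \<or>
        (\<exists>k\<in>{1..?K}. \<exists>l\<in>{1..?K}. real k * real l \<le> T \<and> N p n i = k \<and> N p n j = l))"
  proof (rule prob_hist_mono)
    fix p assume prod: "real (N p n i) * real (N p n j) \<le> T"
    have pos: "1 \<le> N p n i" "1 \<le> N p n j"
      using N_pos ij m n by auto
    consider "1 / r < N p n j" | "1 / r < N p n i" | "N p n j \<le> 1 / r" "N p n i \<le> 1 / r"
      by linarith
    then show "(N p n i \<le> T * r \<or> N p n j \<le> T * r) \<or>
        (\<exists>k\<in>{1..?K}. \<exists>l\<in>{1..?K}. real k * real l \<le> T \<and> N p n i = k \<and> N p n j = l)"
    proof cases
      case 1
      then have "real (N p n i) * (1 / r) \<le> T"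
        using prod pos by (intro order.trans[OF _ prod] mult_left_mono) auto
      then show ?thesis
        using r by (simp add: field_simps)
    next
      case 2
      then have "(1 / r) * real (N p n j) \<le> T"
        using prod pos by (intro order.trans[OF _ prod] mult_right_mono) auto
      then show ?thesis
        using r by (simp add: field_simps)
    next
      case 3
      then have "N p n i \<in> {1..?K}" "N p n j \<in> {1..?K}"
        using pos by (auto simp: le_nat_floor)
      then show ?thesis
        using prod by blast
    qed
  qed
  also have "\<dots> \<le> prob_hist n (\<lambda>p. N p n i \<le> T * r \<or> N p n j \<le> T * r)
     + prob_hist n (\<lambda>p. \<exists>k\<in>{1..?K}. \<exists>l\<in>{1..?K}. real k * real l \<le> T \<and> N p n i = k \<and> N p n j = l)"
    by (rule prob_hist_disj_le)
  also have "prob_hist n (\<lambda>p. N p n i \<le> T * r \<or> N p n j \<le> T * r)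
      \<le> 2 * (T * r) * r + 2 * (T * r) * r"
    using prob_N_le[OF ij(1) n, of "T * r"] prob_N_le[OF ij(2) n, of "T * r"] T r
    by (intro order.trans[OF prob_hist_disj_le] add_mono) (auto simp: r_def)
  also have "2 * (T * r) * r + 2 * (T * r) * r \<le> 4 * (T * r\<^sup>2) powr (3/4)"
    using rho by (simp add: power2_eq_square mult.assoc)
  also have "prob_hist n (\<lambda>p. \<exists>k\<in>{1..?K}. \<exists>l\<in>{1..?K}. real k * real l \<le> T \<and> N p n i = k \<and> N p n j = l)
      \<le> (\<Sum>k\<in>{1..?K}. \<Sum>l\<in>{1..?K}. prob_hist n (\<lambda>p. real k * real l \<le> T \<and> N p n i = k \<and> N p n j = l))"
    by (intro order.trans[OF prob_hist_Bex_le] sum_mono prob_hist_Bex_le) auto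
  also have "\<dots> \<le> (\<Sum>k\<in>{1..?K}. \<Sum>l\<in>{1..?K}.
      3 * r\<^sup>2 * T powr (3/4) * (real k powr (1/4 - 1) * real l powr (1/4 - 1)))"
  proof (intro sum_mono)
    fix k l assume kl: "k \<in> {1..?K}" "l \<in> {1..?K}"
    let ?c = "T powr (3/4) * (real k powr (1/4 - 1) * real l powr (1/4 - 1))"
    show "prob_hist n (\<lambda>p. real k * real l \<le> T \<and> N p n i = k \<and> N p n j = l)
      \<le> 3 * r\<^sup>2 * T powr (3/4) * (real k powr (1/4 - 1) * real l powr (1/4 - 1))"
    proof (cases "real k * real l \<le> T")
      case True
      have "?B k l \<le> 3 * ((real m - 1) * (real m - 2) / ((real n - 1) * (real n - 2)))"
        using prob_N_eq_pair[OF m3 ij, of n k l] m n by simp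
      also have "(real m - 1) * (real m - 2) / ((real n - 1) * (real n - 2))
          = ((real m - 1) / (real n - 1)) * ((real m - 2) / (real n - 2))"
        by simp
      also have "\<dots> \<le> r * r"
        using m n m3 by (intro mult_mono) (auto simp: r_def field_simps)
      finally have B: "?B k l \<le> 3 * r\<^sup>2"
        by (simp add: power2_eq_square)
      have "1 \<le> (T / (real k * real l)) powr (3/4)"
        using True kl by (intro ge_one_powr_ge_zero) auto
      also have "\<dots> = ?c"
        using kl T by (simp add: powr_divide powr_mult powr_minus_divide)
      finally have "3 * r\<^sup>2 * 1 \<le> 3 * r\<^sup>2 * ?c"
        by (intro mult_left_mono) auto
      then show ?thesis
        using B True by (simp add: mult.assoc)
    next
      case False
      then show ?thesis by simp
    qed
  qed
  also have "\<dots> = 3 * r\<^sup>2 * T powr (3/4) * (\<Sum>k\<in>{1..?K}. real k powr (1/4 - 1))\<^sup>2"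
    by (simp only: sum_product power2_eq_square[of "sum _ _"]) (simp only: sum_distrib_left)
  also have "\<dots> \<le> 3 * r\<^sup>2 * T powr (3/4) * (4 * (1 / r) powr (1/4))\<^sup>2"
  proof (intro mult_left_mono power_mono)
    have "(\<Sum>k\<in>{1..?K}. real k powr (1/4 - 1)) \<le> 4 * real ?K powr (1/4)"
      using sum_powr_le[of "1/4" ?K] by simp
    also have "\<dots> \<le> 4 * (1 / r) powr (1/4)"
      using r by (intro mult_left_mono powr_mono2) auto
    finally show "(\<Sum>k\<in>{1..?K}. real k powr (1/4 - 1)) \<le> 4 * (1 / r) powr (1/4)" .
  qed (auto intro: sum_nonneg)
  also have "\<dots> = 48 * (T * r\<^sup>2) powr (3/4)"
  proof -
    have "r\<^sup>2 * ((1 / r) powr (1/4))\<^sup>2 = r powr 2 * (r powr (- (1/4)) * r powr (- (1/4)))"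
      using r by (simp add: powr_divide powr_minus_divide power2_eq_square powr_numeral)
    also have "\<dots> = r powr (2 * (3/4))"
      by (simp add: powr_add[symmetric])
    also have "\<dots> = (r powr 2) powr (3/4)"
      by (rule powr_powr[symmetric])
    also have "r powr 2 = r\<^sup>2"
      using r by simp
    finally have "r\<^sup>2 * ((1 / r) powr (1/4))\<^sup>2 = (r\<^sup>2) powr (3/4)" .
    then show ?thesis
      using T by (simp add: powr_mult power_mult_distrib mult_ac)
  qed
  finally show ?thesis
    by (simp add: r_def)
qed

end

section \<open>How often a late vertex beats an early one\<close>

text \<open>Freeze the tree at time \<open>m = max v 2\<close>, so that besides \<open>v\<close> there is a second vertex \<open>i\<close>. If \<open>u\<close> is
ranked at least as high as \<open>v\<close>, its offspring is at least as large as one of these two clans.\<close>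

lemma prob_jordan_le:
  assumes v: "1 \<le> v" and u: "max v 2 < u" "u \<le> n"
  shows "prob_hist n (\<lambda>p. jordan (history_tree n p) v \<le> jordan (history_tree n p) u) \<le> 16 * (v / u)"
proof -
  define m where "m = max v 2"
  interpret late_vertex m u
    using u by unfold_locales (auto simp: m_def)
  \<comment> \<open>Any vertex other than \<open>v\<close> that is present at time \<open>m\<close>.\<close>
  define i where "i = (if v = 1 then 2 else 1 :: nat)"
  have vi: "v \<in> {1..m}" "i \<in> {1..m}" "i \<noteq> v"
    using v by (auto simp: m_def i_def)
  have "prob_hist n (\<lambda>p. jordan (history_tree n p) v \<le> jordan (history_tree n p) u)
    \<le> prob_hist n (\<lambda>p. N p n v \<le> N p n u \<or> N p n i \<le> N p n u)"
  proof (rule prob_hist_mono)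
    fix p assume p: "p \<in> histories n"
      and le: "jordan (history_tree n p) v \<le> jordan (history_tree n p) u"
    let ?K = "clan_size {1..m} p n"
    have sub: "N p n k \<le> ?K k" if "k \<in> {1..m}" for k
      using that by (intro card_mono clan_antimono) auto
    have "?K v + ?K i = card (clan {1..m} p n v \<union> clan {1..m} p n i)"
      using clan_disjoint[of v i "{1..m}" p n] vi by (subst card_Un_disjoint) auto
    also have "\<dots> \<le> card {1..n}"
      by (intro card_mono) (auto simp: clan_def)
    finally have "?K i \<le> n - ?K v" by simp
    moreover have "min (?K v) (n - ?K v) \<le> jordan (history_tree n p) v"
      using u m vi by (intro jordan_ge_clan[OF p]) auto
    moreover have "jordan (history_tree n p) u \<le> N p n u"
      unfolding N_last[OF p] using u by (intro jordan_le_descendants[OF p]) auto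
    ultimately show "N p n v \<le> N p n u \<or> N p n i \<le> N p n u"
      using le sub[OF vi(1)] sub[OF vi(2)] by linarith
  qed
  also have "\<dots> \<le> 4 * (real m / real u) + 4 * (real m / real u)"
    using vi u by (intro order.trans[OF prob_hist_disj_le] add_mono prob_N_le_last) auto
  also have "\<dots> = 8 * real m / real u"
    by simp
  also have "\<dots> \<le> 16 * real v / real u"
    using v by (intro divide_right_mono) (auto simp: m_def)
  finally show ?thesis by simp
qed

definition least_product :: "(nat \<Rightarrow> nat) \<Rightarrow> nat \<Rightarrow> nat \<Rightarrow> nat \<Rightarrow> nat" where
  "least_product K a b c = min (K a * K b) (min (K a * K c) (K b * K c))"

lemma least_product_mono:
  "(\<And>i. i \<in> {a, b, c} \<Longrightarrow> K i \<le> K' i) \<Longrightarrow> least_product K a b c \<le> least_product K' a b c"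
  unfolding least_product_def by (intro min.mono mult_mono) auto

text \<open>The three vertices whose clans control the Jordan-2 score of \<open>v\<close> at time \<open>max v 3\<close>, where \<open>q\<close> is the
parent of \<open>v\<close>.\<close>

definition witnesses :: "nat \<Rightarrow> nat \<Rightarrow> nat \<times> nat \<times> nat" where
  "witnesses v q = (if 3 \<le> v then (v, q, if q = 1 then 2 else 1) else (1, 2, 3))"

lemma jordan2_ge_least_product:
  assumes p: "p \<in> histories n" and v: "1 \<le> v" and n: "max v 3 \<le> n" and w: "witnesses v (p v) = (a, b, c)"
  shows "least_product (clan_size {1..max v 3} p n) a b c \<le> jordan2 (history_tree n p) v"
proof (cases "3 \<le> v")
  case True
  then have "max v 3 = v" by simp
  then show ?thesis
    using jordan2_ge_late[OF p True] n w True unfolding least_product_def witnesses_def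
    by (auto simp: min_le_iff_disj split: if_splits)
next
  case False
  then have m: "max v 3 = 3" and v': "v \<in> {1, 2}" using v by auto
  show ?thesis
    using jordan2_ge_early[OF p v'] n w False unfolding least_product_def witnesses_def m
    by (auto simp: min_le_iff_disj)
qed

context late_vertex
begin

lemma prob_least_product_le:
  assumes m3: "3 \<le> m" and abc: "{a, b, c} \<subseteq> {1..m}" "a \<noteq> b" "a \<noteq> c" "b \<noteq> c"
    and n: "u \<le> n" and T: "0 < T"
  shows "prob_hist n (\<lambda>p. real (least_product (N p n) a b c) \<le> T) \<le> 156 * (T * (m / n)\<^sup>2) powr (3/4)"
proof -
  let ?Q = "\<lambda>i j p. real (N p n i) * real (N p n j) \<le> T"
  have "prob_hist n (\<lambda>p. real (least_product (N p n) a b c) \<le> T)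
    \<le> prob_hist n (\<lambda>p. ?Q a b p \<or> (?Q a c p \<or> ?Q b c p))"
    by (rule prob_hist_mono) (simp add: least_product_def min_le_iff_disj of_nat_min)
  also have "\<dots> \<le> prob_hist n (?Q a b) + (prob_hist n (?Q a c) + prob_hist n (?Q b c))"
    by (intro order.trans[OF prob_hist_disj_le] add_left_mono prob_hist_disj_le)
  also have "\<dots> \<le> 52 * (T * (m / n)\<^sup>2) powr (3/4)
      + (52 * (T * (m / n)\<^sup>2) powr (3/4) + 52 * (T * (m / n)\<^sup>2) powr (3/4))"
    using abc by (intro add_mono prob_product_le[OF m3 _ _ _ n T]) auto
  finally show ?thesis by simp
qed

text \<open>The clans do not depend on the parent of \<open>v\<close>, as \<open>v\<close> is itself a root; so the bound for fixed
vertices can be averaged over that parent.\<close>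

lemma prob_witnesses_le:
  assumes v: "1 \<le> v" "m = max v 3" and n: "u \<le> n" and T: "0 < T"
  shows "prob_hist n (\<lambda>p. case witnesses v (p v) of (a, b, c) \<Rightarrow> real (least_product (N p n) a b c) \<le> T)
    \<le> 156 * (T * (m / n)\<^sup>2) powr (3/4)"
proof (cases "3 \<le> v")
  case False
  then show ?thesis
    using prob_least_product_le[of 1 2 3 n T] v n T by (simp add: witnesses_def)
next
  case True
  let ?j = "\<lambda>q. if q = 1 then 2 else 1 :: nat"
  let ?F = "\<lambda>q p. of_bool (real (least_product (N p n) v q (?j q)) \<le> T) :: real"
  let ?B = "156 * (T * (m / n)\<^sup>2) powr (3/4)"
  have mv: "m = v" using v True by simp
  have "prob_hist n (\<lambda>p. case witnesses v (p v) of (a, b, c) \<Rightarrow> real (least_product (N p n) a b c) \<le> T)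
    = avg n (\<lambda>p. ?F (p v) p)"
    using True by (simp add: witnesses_def)
  also have "\<dots> = (\<Sum>q\<in>{1..<v}. avg n (?F q)) / (real v - 1)"
  proof (rule avg_parent)
    fix x y and p :: "nat \<Rightarrow> nat"
    have "N (p(v := y)) n = N p n"
      using mv v by (intro ext) (subst clan_update, auto)
    then show "?F x (p(v := y)) = ?F x p" by simp
  qed (use True n m mv in auto)
  also have "\<dots> \<le> (\<Sum>q\<in>{1..<v}. ?B) / (real v - 1)"
    using True mv n T by (intro divide_right_mono sum_mono prob_least_product_le) auto
  also have "\<dots> = ?B"
    using True by (simp add: of_nat_diff)
  finally show ?thesis .
qed

text \<open>On the event that \<open>u\<close> attaches to \<open>w\<close>, the two factors bounding the score of \<open>u\<close> are compared with the
typical sizes \<open>n / u\<close> and \<open>n / w\<close>, enlarged by \<open>\<tau>\<close>. With \<open>\<rho> = m\<^sup>2 / (u w)\<close> the tails are of order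
\<open>\<tau>\<close> to the power \<open>-6\<close>, and the product of two clans is small with probability of order
\<open>(\<tau>\<^sup>2 \<rho>)\<close> to the power \<open>3/4\<close>. The choice of \<open>\<tau>\<close> makes the two equal.\<close>

lemma prob_jordan2_le_given_parent:
  assumes v: "1 \<le> v" "m = max v 3" and n: "u \<le> n" and w: "1 \<le> w" "w < u"
  defines "\<tau> \<equiv> (real m ^ 2 / (real u * real w)) powr (- 1 / 10)"
  shows "prob_hist n (\<lambda>p. \<tau> * n / u \<le> card (descendants p n u)
      \<or> \<tau> * n / w \<le> clan_size {1, w, u} p n w
      \<or> (case witnesses v (p v) of (a, b, c) \<Rightarrow>
          real (least_product (N p n) a b c) \<le> 2 * \<tau>\<^sup>2 * n\<^sup>2 / (real u * real w)))
    \<le> 10 ^ 9 * (real m ^ 2 / (real u * real w)) powr (3/5)" (is "prob_hist n (\<lambda>p. ?A p \<or> ?B p \<or> ?C p) \<le> _")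
proof -
  define \<rho> where "\<rho> = real m ^ 2 / (real u * real w)"
  have rho: "0 < \<rho>" using m w by (simp add: \<rho>_def)
  have tau: "\<tau> = \<rho> powr (- 1 / 10)" "0 < \<tau>"
    using rho m w by (auto simp: \<tau>_def \<rho>_def)
  let ?T = "2 * \<tau>\<^sup>2 * n\<^sup>2 / (real u * real w)"
  have tau6: "\<tau> powr -6 = \<rho> powr (3/5)"
    unfolding tau by (simp add: powr_powr)
  have "prob_hist n (\<lambda>p. ?A p \<or> ?B p \<or> ?C p) \<le> prob_hist n ?A + (prob_hist n ?B + prob_hist n ?C)"
    by (intro order.trans[OF prob_hist_disj_le] add_left_mono prob_hist_disj_le)
  also have "prob_hist n ?A \<le> 720 * 7 ^ 6 * \<tau> powr -6"
    using m n tau by (intro prob_descendants_ge) auto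
  also have "prob_hist n ?B \<le> 720 * 7 ^ 6 * \<tau> powr -6"
  proof -
    have "prob_hist n ?B \<le> prob_hist n (\<lambda>p. \<tau> * n / w \<le> card (descendants p n w))"
    proof (rule prob_hist_mono)
      fix p assume "?B p"
      moreover have "clan_size {1, w, u} p n w \<le> card (descendants p n w)"
        by (intro card_mono clan_antimono) auto
      ultimately show "\<tau> * n / w \<le> card (descendants p n w)"
        by linarith
    qed
    also have "\<dots> \<le> 720 * 7 ^ 6 * \<tau> powr -6"
      using w n tau by (intro prob_descendants_ge) auto
    finally show ?thesis .
  qed
  also have "prob_hist n ?C \<le> 156 * (?T * (m / n)\<^sup>2) powr (3/4)"
    using w m n tau by (intro prob_witnesses_le v n) auto
  also have "?T * (m / n)\<^sup>2 = 2 * (\<tau>\<^sup>2 * \<rho>)"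
    using m n by (simp add: \<rho>_def power_divide)
  also have "\<tau>\<^sup>2 * \<rho> = \<rho> powr (4/5)"
  proof -
    have "\<tau>\<^sup>2 = \<rho> powr (- 1 / 5)"
      unfolding tau by (simp add: power2_eq_square powr_add[symmetric])
    then have "\<tau>\<^sup>2 * \<rho> = \<rho> powr (- 1 / 5) * \<rho> powr 1"
      using rho by simp
    then show ?thesis
      by (simp only: powr_add[symmetric]) simp
  qed
  also have "(2 * \<rho> powr (4/5)) powr (3/4) = 2 powr (3/4) * \<rho> powr (3/5)"
    by (simp add: powr_mult powr_powr)
  also have "\<dots> \<le> 2 * \<rho> powr (3/5)"
    using powr_mono[of "3/4" 1 "2 :: real"] by (intro mult_right_mono) auto
  finally have "prob_hist n (\<lambda>p. ?A p \<or> ?B p \<or> ?C p)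
    \<le> (720 * 7 ^ 6 + 720 * 7 ^ 6 + 312) * \<rho> powr (3/5)"
    unfolding tau6 by (simp add: algebra_simps)
  also have "\<dots> \<le> 10 ^ 9 * \<rho> powr (3/5)"
    by (intro mult_right_mono) auto
  finally show ?thesis
    unfolding \<rho>_def .
qed

end

text \<open>The offspring of the parent of \<open>u\<close> has a heavy tail, since that parent may be any early vertex; no
single threshold separates the scores of \<open>u\<close> and \<open>v\<close>. Conditioning on the parent \<open>w\<close> removes the heavy
tail, and the bounds for the individual \<open>w\<close> are summable because the exponent \<open>3/5\<close> is below \<open>1\<close>.
Being above \<open>1/2\<close>, it also leaves a summable power of \<open>u\<close>.\<close>

lemma prob_jordan2_le:
  assumes v: "1 \<le> v" and u: "max v 3 < u" "u \<le> n"
  shows "prob_hist n (\<lambda>p. jordan2 (history_tree n p) v \<le> jordan2 (history_tree n p) u)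
    \<le> 5 * 10 ^ 9 * (real (max v 3) / real u) powr (6/5)"
proof -
  define m where "m = max v 3"
  interpret late_vertex m u
    using u by unfold_locales (auto simp: m_def)
  define \<tau> where "\<tau> = (\<lambda>w. (real m ^ 2 / (real u * real w)) powr (- 1 / 10))"
  let ?A = "\<lambda>w p. \<tau> w * n / u \<le> card (descendants p n u)"
  let ?B = "\<lambda>w p. \<tau> w * n / w \<le> clan_size {1, w, u} p n w"
  let ?C = "\<lambda>w p. case witnesses v (p v) of (a, b, c) \<Rightarrow>
          real (least_product (N p n) a b c) \<le> 2 * (\<tau> w)\<^sup>2 * n\<^sup>2 / (real u * real w)"
  let ?F = "\<lambda>w p. of_bool (?A w p \<or> ?B w p \<or> ?C w p) :: real"
  have m3: "3 \<le> m" "v \<le> m" by (auto simp: m_def)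
  have "prob_hist n (\<lambda>p. jordan2 (history_tree n p) v \<le> jordan2 (history_tree n p) u)
    \<le> prob_hist n (\<lambda>p. ?A (p u) p \<or> ?B (p u) p \<or> ?C (p u) p)"
  proof (rule prob_hist_mono)
    fix p assume p: "p \<in> histories n"
      and le: "jordan2 (history_tree n p) v \<le> jordan2 (history_tree n p) u"
    define w where "w = p u"
    have w: "1 \<le> w" "w < u"
      using history_parent[OF p, of u] u m by (auto simp: w_def)
    obtain a b c where abc: "witnesses v (p v) = (a, b, c)"
      by (cases "witnesses v (p v)")
    let ?d = "real (card (descendants p n u))" and ?e = "real (clan_size {1, w, u} p n w)"
    show "?A (p u) p \<or> ?B (p u) p \<or> ?C (p u) p"
      unfolding w_def[symmetric]
    proof (rule ccontr)
      assume "\<not> (?A w p \<or> ?B w p \<or> ?C w p)"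
      then have d: "?d < \<tau> w * n / u" and e: "?e < \<tau> w * n / w" and C: "\<not> ?C w p"
        by auto
      have abcm: "{a, b, c} \<subseteq> {1..m}"
        using abc history_parent[OF p, of v] u v m3 by (auto simp: witnesses_def m_def split: if_splits)
      have "card (descendants p n (p u)) \<le> card (descendants p n u \<union> clan {1, p u, u} p n (p u))"
        using u m by (intro card_mono descendants_parent_subset[OF p]) auto
      also have "\<dots> \<le> card (descendants p n u) + clan_size {1, p u, u} p n (p u)"
        by (rule card_Un_le)
      finally have "card (descendants p n w) \<le> card (descendants p n u) + clan_size {1, w, u} p n w"
        unfolding w_def .
      moreover have "jordan2 (history_tree n p) u \<le> card (descendants p n u) * card (descendants p n w)"
        unfolding w_def using u m by (intro jordan2_le[OF p]) auto
      ultimately have "jordan2 (history_tree n p) u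
          \<le> card (descendants p n u) * (card (descendants p n u) + clan_size {1, w, u} p n w)"
        using mult_le_mono2 order.trans by blast
      then have "real (jordan2 (history_tree n p) u) \<le> ?d * (?d + ?e)"
        by (metis (mono_tags, lifting) of_nat_add of_nat_le_iff of_nat_mult)
      also have "\<dots> \<le> \<tau> w * n / u * (\<tau> w * n / w + \<tau> w * n / w)"
      proof (intro mult_mono add_mono)
        have "\<tau> w * n / u \<le> \<tau> w * n / w"
          using w by (intro divide_left_mono) (auto simp: \<tau>_def)
        then show "?d \<le> \<tau> w * n / w" using d by linarith
      qed (use d e in \<open>auto simp: \<tau>_def\<close>)
      also have "\<dots> = 2 * (\<tau> w)\<^sup>2 * n\<^sup>2 / (real u * real w)"
        by (simp add: power2_eq_square)
      finally have "real (jordan2 (history_tree n p) v) \<le> 2 * (\<tau> w)\<^sup>2 * n\<^sup>2 / (real u * real w)"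
        using le by simp
      moreover have "least_product (clan_size {1..m} p n) a b c \<le> jordan2 (history_tree n p) v"
        unfolding m_def using u by (intro jordan2_ge_least_product[OF p v _ abc]) auto
      moreover have "least_product (N p n) a b c \<le> least_product (clan_size {1..m} p n) a b c"
        using abcm by (intro least_product_mono card_mono clan_antimono) auto
      ultimately show False
        using C abc by simp
    qed
  qed
  also have "\<dots> = (\<Sum>w\<in>{1..<u}. avg n (?F w)) / (real u - 1)"
  proof (rule avg_parent)
    fix x y and p :: "nat \<Rightarrow> nat"
    have "N (p(u := y)) n = N p n" "clan {1, x, u} (p(u := y)) n x = clan {1, x, u} p n x"
      "descendants (p(u := y)) n u = descendants p n u" "(p(u := y)) v = p v"
      using m3 m by (auto simp: clan_update intro!: ext)
    then show "?F x (p(u := y)) = ?F x p" by simp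
  qed (use u in auto)
  also have "\<dots> \<le> (\<Sum>w\<in>{1..<u}. 10 ^ 9 * (real m ^ 2 / (real u * real w)) powr (3/5)) / (real u - 1)"
    using u m v unfolding \<tau>_def
    by (intro divide_right_mono sum_mono prob_jordan2_le_given_parent) (auto simp: m_def)
  also have "\<dots> = 10 ^ 9 * (real m powr (6/5) * real u powr - (3/5))
      * (\<Sum>w\<in>{1..u - 1}. real w powr (2/5 - 1)) / (real u - 1)"
  proof -
    have "(real m ^ 2 / (real u * real w)) powr (3/5)
        = (real m powr (6/5) * real u powr - (3/5)) * real w powr (2/5 - 1)" for w
    proof -
      have "(real m ^ 2) powr (3/5) = real m powr (6/5)"
        using m by (simp add: powr_powr flip: powr_numeral)
      then show ?thesis
        by (simp add: powr_divide powr_mult powr_minus_divide)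
    qed
    moreover have "{1..<u} = {1..u - 1}" by auto
    ultimately show ?thesis
      by (simp add: sum_distrib_left mult.assoc)
  qed
  also have "\<dots> \<le> 10 ^ 9 * (real m powr (6/5) * real u powr - (3/5)) * (5/2 * real u powr (2/5)) / (real u / 2)"
  proof (intro frac_le mult_left_mono)
    have "(\<Sum>w\<in>{1..u - 1}. real w powr (2/5 - 1)) \<le> real (u - 1) powr (2/5) / (2/5)"
      by (intro sum_powr_le) auto
    also have "\<dots> \<le> 5/2 * real u powr (2/5)"
      by (simp add: powr_mono2)
    finally show "(\<Sum>w\<in>{1..u - 1}. real w powr (2/5 - 1)) \<le> 5/2 * real u powr (2/5)" .
  qed (use m in auto)
  also have "\<dots> = 5 * 10 ^ 9 * real m powr (6/5) * (real u powr - (3/5) * real u powr (2/5) * real u powr - 1)"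
    using m by (simp add: powr_minus_divide)
  also have "real u powr - (3/5) * real u powr (2/5) * real u powr - 1 = real u powr - (6/5)"
    by (simp only: powr_add[symmetric]) simp
  also have "5 * 10 ^ 9 * real m powr (6/5) * real u powr - (6/5) = 5 * 10 ^ 9 * (real m / real u) powr (6/5)"
    by (simp add: powr_divide powr_minus_divide)
  finally show ?thesis
    unfolding m_def .
qed

section \<open>Rankings with random tie-breaking\<close>

definition tie_avg :: "nat \<Rightarrow> (nat \<Rightarrow> nat) \<Rightarrow> ((nat \<Rightarrow> nat) \<Rightarrow> real) \<Rightarrow> real" where
  "tie_avg n s F = (\<Sum>\<sigma>\<in>decreasing_rankings n s. F \<sigma>) / card (decreasing_rankings n s)"

lemma card_decreasing_rankings_pos: "0 < card (decreasing_rankings n s)"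
  by (simp add: card_gt_0_iff decreasing_rankings_nonempty finite_decreasing_rankings)

lemma tie_avg_add: "tie_avg n s (\<lambda>\<sigma>. F \<sigma> + G \<sigma>) = tie_avg n s F + tie_avg n s G"
  by (simp add: tie_avg_def sum.distrib add_divide_distrib)

lemma tie_avg_const [simp]: "tie_avg n s (\<lambda>\<sigma>. c) = c"
  using card_decreasing_rankings_pos[of n s] by (simp add: tie_avg_def)

lemma tie_avg_mono:
  "(\<And>\<sigma>. \<sigma> \<in> decreasing_rankings n s \<Longrightarrow> F \<sigma> \<le> G \<sigma>) \<Longrightarrow> tie_avg n s F \<le> tie_avg n s G"
  unfolding tie_avg_def by (intro divide_right_mono sum_mono) auto

lemma tie_avg_cong:
  "(\<And>\<sigma>. \<sigma> \<in> decreasing_rankings n s \<Longrightarrow> F \<sigma> = G \<sigma>) \<Longrightarrow> tie_avg n s F = tie_avg n s G"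
  unfolding tie_avg_def by simp

lemma tie_avg_sum: "tie_avg n s (\<lambda>\<sigma>. \<Sum>i\<in>A. F i \<sigma>) = (\<Sum>i\<in>A. tie_avg n s (F i))"
  unfolding tie_avg_def by (subst sum.swap) (simp add: sum_divide_distrib)

lemma tie_avg_nonneg:
  "(\<And>\<sigma>. \<sigma> \<in> decreasing_rankings n s \<Longrightarrow> 0 \<le> F \<sigma>) \<Longrightarrow> 0 \<le> tie_avg n s F"
  using tie_avg_mono[of n s "\<lambda>_. 0" F] by simp

abbreviation label_swap :: "nat \<Rightarrow> nat \<Rightarrow> nat \<Rightarrow> nat" where
  "label_swap \<equiv> Transposition.transpose"

lemma decreasing_rankings_transpose:
  assumes ab: "a \<in> {1..n}" "b \<in> {1..n}" and s: "\<sigma> \<in> decreasing_rankings n s"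
  shows "\<sigma> \<circ> label_swap a b \<in> decreasing_rankings n (s \<circ> label_swap a b)"
proof -
  have t: "label_swap a b permutes {1..n}"
    using ab by (intro permutes_swap_id) auto
  then have "label_swap a b v \<in> {1..n}" if "v \<in> {1..n}" for v
    using that by (simp only: permutes_in_image)
  then show ?thesis
    using s permutes_compose[OF t] unfolding decreasing_rankings_def by auto
qed

lemma tie_avg_transpose:
  assumes ab: "a \<in> {1..n}" "b \<in> {1..n}"
  shows "tie_avg n (s \<circ> label_swap a b) F = tie_avg n s (\<lambda>\<sigma>. F (\<sigma> \<circ> label_swap a b))"
proof -
  let ?t = "label_swap a b"
  have inv: "(f \<circ> ?t) \<circ> ?t = f" for f :: "nat \<Rightarrow> nat"
    by (simp add: fun_eq_iff)
  have bij: "bij_betw (\<lambda>\<sigma>. \<sigma> \<circ> ?t) (decreasing_rankings n s) (decreasing_rankings n (s \<circ> ?t))"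
  proof (rule bij_betwI[where g = "\<lambda>\<sigma>. \<sigma> \<circ> ?t"])
    show "(\<lambda>\<sigma>. \<sigma> \<circ> ?t) \<in> decreasing_rankings n (s \<circ> ?t) \<rightarrow> decreasing_rankings n s"
      using decreasing_rankings_transpose[OF ab, of _ "s \<circ> ?t"] unfolding inv by blast
  qed (use decreasing_rankings_transpose[OF ab] inv in auto)
  show ?thesis
    unfolding tie_avg_def bij_betw_same_card[OF bij, symmetric]
    by (subst sum.reindex_bij_betw[OF bij, symmetric]) simp
qed

lemma card_ranked_le:
  assumes \<sigma>: "\<sigma> permutes {1..n}" and v: "v \<in> {1..n}"
  shows "card {u \<in> {1..n}. \<sigma> u \<le> \<sigma> v} = \<sigma> v"
proof -
  have "\<sigma> ` {u \<in> {1..n}. \<sigma> u \<le> \<sigma> v} = {1..\<sigma> v}"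
  proof
    show "\<sigma> ` {u \<in> {1..n}. \<sigma> u \<le> \<sigma> v} \<subseteq> {1..\<sigma> v}"
      using permutes_in_image[OF \<sigma>] by fastforce
    show "{1..\<sigma> v} \<subseteq> \<sigma> ` {u \<in> {1..n}. \<sigma> u \<le> \<sigma> v}"
    proof
      fix k assume k: "k \<in> {1..\<sigma> v}"
      have "\<sigma> v \<in> {1..n}" using permutes_in_image[OF \<sigma>, of v] v by simp
      then have "k \<in> \<sigma> ` {1..n}" using k permutes_image[OF \<sigma>] by auto
      then show "k \<in> \<sigma> ` {u \<in> {1..n}. \<sigma> u \<le> \<sigma> v}" using k by auto
    qed
  qed
  moreover have "inj_on \<sigma> {u \<in> {1..n}. \<sigma> u \<le> \<sigma> v}"
    using permutes_inj_on[OF \<sigma>] by blast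
  ultimately show ?thesis
    by (metis card_atLeastAtMost card_image diff_Suc_1)
qed

lemma rank_le:
  assumes \<sigma>: "\<sigma> \<in> decreasing_rankings n s" and v: "v \<in> {1..n}"
  shows "\<sigma> v \<le> card {u \<in> {1..n}. s v \<le> s u}"
proof -
  have "{u \<in> {1..n}. \<sigma> u \<le> \<sigma> v} \<subseteq> {u \<in> {1..n}. s v \<le> s u}"
    using \<sigma> v unfolding decreasing_rankings_def by (force simp: not_less[symmetric])
  then have "card {u \<in> {1..n}. \<sigma> u \<le> \<sigma> v} \<le> card {u \<in> {1..n}. s v \<le> s u}"
    by (intro card_mono) auto
  then show ?thesis
    using card_ranked_le[OF _ v] \<sigma> unfolding decreasing_rankings_def by auto
qed

lemma rank_ge:
  assumes \<sigma>: "\<sigma> \<in> decreasing_rankings n s" and v: "v \<in> {1..n}"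
  shows "(\<Sum>u\<in>{v<..n}. of_bool (\<sigma> u < \<sigma> v)) \<le> real (\<sigma> v)"
proof -
  have "(\<Sum>u\<in>{v<..n}. of_bool (\<sigma> u < \<sigma> v)) = real (card {u \<in> {v<..n}. \<sigma> u < \<sigma> v})"
    by (simp add: of_bool_def sum.If_cases Int_def)
  also have "card {u \<in> {v<..n}. \<sigma> u < \<sigma> v} \<le> card {u \<in> {1..n}. \<sigma> u \<le> \<sigma> v}"
    by (intro card_mono) auto
  also have "\<dots> = \<sigma> v"
    using \<sigma> v by (intro card_ranked_le) (auto simp: decreasing_rankings_def)
  finally show ?thesis by simp
qed

section \<open>The risk as a double average\<close>

lemma add_leaf_history_tree:
  assumes "1 \<le> n"
  shows "add_leaf (history_tree n p) x (Suc n) = history_tree (Suc n) (p(Suc n := x))"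
proof -
  have "{2..Suc n} = insert (Suc n) {2..n}" using assms by auto
  moreover have "(\<Union>k\<in>{2..n}. {((p(Suc n := x)) k, k), (k, (p(Suc n := x)) k)})
      = (\<Union>k\<in>{2..n}. {(p k, k), (k, p k)})"
    by (intro SUP_cong) auto
  moreover have "{1..Suc n} = insert (Suc n) {1..n}" by auto
  ultimately show ?thesis
    unfolding add_leaf_def history_tree_def by auto
qed

lemma pmf_of_set_Times:
  assumes "finite A" "finite B" "A \<noteq> {}" "B \<noteq> {}"
  shows "pmf_of_set (A \<times> B) = pair_pmf (pmf_of_set A) (pmf_of_set B)"
  using assms by (intro pmf_eqI) (auto simp: pmf_pair split_paired_all indicator_def)

lemma recursive_tree_pmf_histories:
  "1 \<le> n \<Longrightarrow> recursive_tree_pmf n = map_pmf (history_tree n) (pmf_of_set (histories n))"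
proof (induction n rule: recursive_tree_pmf.induct)
  case 2
  have "histories (Suc 0) = {\<lambda>_. undefined}"
    by (simp add: histories_def)
  then show ?case
    by (simp add: pmf_of_set_singleton history_tree_def)
next
  case (3 n)
  let ?m = "Suc n"
  have "map_pmf (history_tree (Suc ?m)) (pmf_of_set (histories (Suc ?m)))
    = map_pmf (history_tree (Suc ?m)) (map_pmf (\<lambda>(x, p). p(Suc ?m := x))
        (pair_pmf (pmf_of_set {1..?m}) (pmf_of_set (histories ?m))))"
    unfolding histories_Suc(1)[of ?m, simplified] using histories_Suc(2)[of ?m]
    by (subst pmf_of_set_Times[symmetric]) (auto simp: map_pmf_of_set_inj)
  also have "\<dots> = bind_pmf (pmf_of_set {1..?m}) (\<lambda>x. bind_pmf (pmf_of_set (histories ?m)) (\<lambda>p.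
      return_pmf (add_leaf (history_tree ?m p) x (Suc ?m))))"
    by (simp add: pair_pmf_def map_bind_pmf add_leaf_history_tree)
  also have "\<dots> = bind_pmf (pmf_of_set (histories ?m)) (\<lambda>p. bind_pmf (pmf_of_set {1..?m}) (\<lambda>x.
      return_pmf (add_leaf (history_tree ?m p) x (Suc ?m))))"
    by (rule bind_commute_pmf)
  also have "\<dots> = recursive_tree_pmf (Suc ?m)"
    using 3 by (simp add: bind_map_pmf)
  finally show ?case by simp
qed simp

definition displacement ::
  "(nat pair_pre_digraph \<Rightarrow> nat \<Rightarrow> nat) \<Rightarrow> nat \<Rightarrow> nat \<Rightarrow> (nat \<Rightarrow> nat) \<Rightarrow> real" where
  "displacement c n v p = tie_avg n (c (history_tree n p)) (\<lambda>\<sigma>. \<bar>real (\<sigma> v) - real v\<bar>)"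

lemma displacement_nonneg: "0 \<le> displacement c n v p"
  unfolding displacement_def by (rule tie_avg_nonneg) simp

lemma risk_eq:
  assumes n: "1 \<le> n"
  shows "risk \<alpha> n (ranking_pmf c n) = (\<Sum>v\<in>{1..n}. avg n (displacement c n v) / real v powr \<alpha>)"
proof -
  let ?h = "\<lambda>\<sigma>. \<Sum>v\<in>{1..n}. \<bar>real (\<sigma> v) - real v\<bar> / real v powr \<alpha>"
  let ?f = "\<lambda>p. pmf_of_set (decreasing_rankings n (c (history_tree n p)))"
  have "risk \<alpha> n (ranking_pmf c n) = measure_pmf.expectation (pmf_of_set (histories n) \<bind> ?f) ?h"
    unfolding risk_def ranking_pmf_def recursive_tree_pmf_histories[OF n] bind_map_pmf ..
  also have "\<dots> = (\<Sum>p\<in>histories n. measure_pmf.expectation (?f p) ?h /\<^sub>R real (card (histories n)))"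
    by (intro pmf_expectation_bind_pmf_of_set)
      (auto simp: set_pmf_of_set finite_decreasing_rankings decreasing_rankings_nonempty)
  also have "\<dots> = avg n (\<lambda>p. tie_avg n (c (history_tree n p)) ?h)"
    by (simp add: integral_pmf_of_set finite_decreasing_rankings decreasing_rankings_nonempty
        tie_avg_def avg_def card_histories sum_divide_distrib[symmetric] divide_inverse
        sum_distrib_left[symmetric] mult.commute)
  also have "\<dots> = avg n (\<lambda>p. \<Sum>v\<in>{1..n}. displacement c n v p / real v powr \<alpha>)"
    unfolding tie_avg_sum by (simp add: displacement_def tie_avg_def sum_divide_distrib[symmetric] mult.commute)
  also have "\<dots> = (\<Sum>v\<in>{1..n}. avg n (\<lambda>p. displacement c n v p / real v powr \<alpha>))"
    by (rule avg_sum)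
  also have "\<dots> = (\<Sum>v\<in>{1..n}. avg n (displacement c n v) / real v powr \<alpha>)"
    by (simp add: avg_def sum_divide_distrib[symmetric] mult.commute)
  finally show ?thesis .
qed

text \<open>A rank is at most the number of vertices with at least the same score, and those not later than
\<open>v\<close> contribute at most \<open>v\<close>.\<close>

lemma avg_displacement_le:
  assumes v: "v \<in> {1..n}"
  shows "avg n (displacement c n v)
    \<le> 2 * real v + (\<Sum>u\<in>{v<..n}. prob_hist n (\<lambda>p. c (history_tree n p) v \<le> c (history_tree n p) u))"
proof -
  have "displacement c n v p
      \<le> 2 * real v + (\<Sum>u\<in>{v<..n}. of_bool (c (history_tree n p) v \<le> c (history_tree n p) u))" for p
  proof -
    let ?s = "c (history_tree n p)"
    have "displacement c n v p \<le> tie_avg n ?s (\<lambda>\<sigma>. 2 * real v + (\<Sum>u\<in>{v<..n}. of_bool (?s v \<le> ?s u)))"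
      unfolding displacement_def
    proof (rule tie_avg_mono)
      fix \<sigma> assume \<sigma>: "\<sigma> \<in> decreasing_rankings n ?s"
      have "\<sigma> v \<le> card {u \<in> {1..n}. ?s v \<le> ?s u}"
        by (rule rank_le[OF \<sigma> v])
      also have "\<dots> \<le> card ({1..v} \<union> {u \<in> {v<..n}. ?s v \<le> ?s u})"
        by (intro card_mono) auto
      also have "\<dots> \<le> v + card {u \<in> {v<..n}. ?s v \<le> ?s u}"
        by (rule order.trans[OF card_Un_le]) simp
      finally have "real (\<sigma> v) \<le> real v + real (card {u \<in> {v<..n}. ?s v \<le> ?s u})"
        by linarith
      also have "real (card {u \<in> {v<..n}. ?s v \<le> ?s u}) = (\<Sum>u\<in>{v<..n}. of_bool (?s v \<le> ?s u))"
        by (simp add: of_bool_def sum.If_cases Int_def)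
      finally have "real (\<sigma> v) \<le> real v + (\<Sum>u\<in>{v<..n}. of_bool (?s v \<le> ?s u))" .
      then show "\<bar>real (\<sigma> v) - real v\<bar> \<le> 2 * real v + (\<Sum>u\<in>{v<..n}. of_bool (?s v \<le> ?s u))"
        by linarith
    qed
    then show ?thesis by simp
  qed
  then have "avg n (displacement c n v)
      \<le> avg n (\<lambda>p. 2 * real v + (\<Sum>u\<in>{v<..n}. of_bool (c (history_tree n p) v \<le> c (history_tree n p) u)))"
    by (intro avg_mono)
  then show ?thesis
    unfolding avg_add avg_sum by simp
qed

lemma avg_displacement_ge:
  assumes v: "v \<in> {1..n}"
  shows "(\<Sum>u\<in>{v<..n}. avg n (\<lambda>p. tie_avg n (c (history_tree n p)) (\<lambda>\<sigma>. of_bool (\<sigma> u < \<sigma> v)))) - v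
    \<le> avg n (displacement c n v)"
proof -
  have "(\<Sum>u\<in>{v<..n}. tie_avg n (c (history_tree n p)) (\<lambda>\<sigma>. of_bool (\<sigma> u < \<sigma> v)))
    \<le> displacement c n v p + real v" for p
  proof -
    let ?s = "c (history_tree n p)"
    have "(\<Sum>u\<in>{v<..n}. tie_avg n ?s (\<lambda>\<sigma>. of_bool (\<sigma> u < \<sigma> v)))
      = tie_avg n ?s (\<lambda>\<sigma>. \<Sum>u\<in>{v<..n}. of_bool (\<sigma> u < \<sigma> v))"
      by (rule tie_avg_sum[symmetric])
    also have "\<dots> \<le> tie_avg n ?s (\<lambda>\<sigma>. \<bar>real (\<sigma> v) - real v\<bar> + real v)"
    proof (rule tie_avg_mono)
      fix \<sigma> assume "\<sigma> \<in> decreasing_rankings n ?s"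
      from rank_ge[OF this v]
      show "(\<Sum>u\<in>{v<..n}. of_bool (\<sigma> u < \<sigma> v)) \<le> \<bar>real (\<sigma> v) - real v\<bar> + real v"
        by linarith
    qed
    finally show ?thesis
      unfolding tie_avg_add displacement_def by simp
  qed
  then have "avg n (\<lambda>p. \<Sum>u\<in>{v<..n}. tie_avg n (c (history_tree n p)) (\<lambda>\<sigma>. of_bool (\<sigma> u < \<sigma> v)))
    \<le> avg n (\<lambda>p. displacement c n v p + real v)"
    by (intro avg_mono)
  then show ?thesis
    unfolding avg_add avg_sum by simp
qed

section \<open>Relabelling\<close>

definition relabel :: "('a \<Rightarrow> 'a) \<Rightarrow> 'a pair_pre_digraph \<Rightarrow> 'a pair_pre_digraph" where
  "relabel f t = \<lparr> pverts = f ` pverts t, parcs = map_prod f f ` parcs t \<rparr>"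

lemma vwalk_arcs_map: "vwalk_arcs (map f q) = map (map_prod f f) (vwalk_arcs q)"
  by (induction q rule: vwalk_arcs.induct) auto

lemma vpath_relabel:
  assumes "inj f"
  shows "vpath (map f q) (with_proj (relabel f t)) \<longleftrightarrow> vpath q (with_proj t)"
proof -
  have "inj (map_prod f f)"
    using assms by (rule prod.inj_map[OF _ assms])
  then show ?thesis
    using assms unfolding vpath_def vwalk_def
    by (simp add: relabel_def vwalk_arcs_map inj_image_subset_iff distinct_map inj_on_subset[OF assms subset_UNIV])
qed

lemma subtree_of_relabel:
  assumes f: "bij f"
  shows "subtree_of (relabel f t) (f u) (f v) = f ` subtree_of t u v"
proof -
  have inj: "inj f" and surj: "surj f"
    using f by (auto simp: bij_def)
  have ex: "(\<exists>q. P q) \<longleftrightarrow> (\<exists>q. P (map f q))" for P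
  proof
    assume "\<exists>q. P q"
    then obtain q where "P q" by blast
    moreover have "map f (map (inv f) q) = q"
      using surj by (simp add: o_def surj_f_inv_f map_idI)
    ultimately show "\<exists>q. P (map f q)" by metis
  qed blast
  have path: "(\<exists>q. vpath q (with_proj (relabel f t)) \<and> hd q = f u \<and> last q = f w \<and> f v \<in> set q)
    \<longleftrightarrow> (\<exists>q. vpath q (with_proj t) \<and> hd q = u \<and> last q = w \<and> v \<in> set q)" for w
  proof -
    have "vpath (map f q) (with_proj (relabel f t)) \<and> hd (map f q) = f u \<and> last (map f q) = f w
        \<and> f v \<in> set (map f q)
      \<longleftrightarrow> vpath q (with_proj t) \<and> hd q = u \<and> last q = w \<and> v \<in> set q" for q
    proof (cases "q = []")
      case True
      then show ?thesis by simp
    next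
      case False
      then show ?thesis
        using inj by (simp add: vpath_relabel hd_map last_map inj_eq inj_image_mem_iff)
    qed
    then show ?thesis
      by (subst ex) blast
  qed
  have "subtree_of (relabel f t) (f u) (f v)
    = f ` {w \<in> pverts t. \<exists>q. vpath q (with_proj (relabel f t)) \<and> hd q = f u \<and> last q = f w \<and> f v \<in> set q}"
    unfolding subtree_of_def by (auto simp: relabel_def)
  also have "\<dots> = f ` subtree_of t u v"
    unfolding path subtree_of_def ..
  finally show ?thesis .
qed

lemma neighbors_relabel:
  assumes "bij f"
  shows "neighbors (relabel f t) (f v) = f ` neighbors t v"
  using bij_is_inj[OF assms] unfolding neighbors_def relabel_def by (auto simp: inj_eq)

lemma card_subtree_of_relabel:
  assumes "bij f"
  shows "card (subtree_of (relabel f t) (f u) (f v)) = card (subtree_of t u v)"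
  unfolding subtree_of_relabel[OF assms]
  by (rule card_image) (rule inj_on_subset[OF bij_is_inj[OF assms] subset_UNIV])

lemma jordan_relabel:
  assumes "bij f"
  shows "jordan (relabel f t) (f v) = jordan t v"
  unfolding jordan_def neighbors_relabel[OF assms] image_image card_subtree_of_relabel[OF assms] ..

lemma jordan_minimizers_relabel:
  assumes "bij f"
  shows "jordan_minimizers (relabel f t) (f v) = f ` jordan_minimizers t v"
  unfolding jordan_minimizers_def is_arg_min_def neighbors_relabel[OF assms]
  by (auto simp: card_subtree_of_relabel[OF assms])

lemma jordan2_relabel:
  assumes "bij f"
  shows "jordan2 (relabel f t) (f v) = jordan2 t v"
  unfolding jordan2_def jordan_minimizers_relabel[OF assms] image_image jordan_relabel[OF assms] ..

section \<open>Exchanging two labels\<close>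

text \<open>The involution \<open>\<psi>\<close> exchanges the labels \<open>v\<close> and \<open>w\<close> and hence their ranks. So the four
displacements of \<open>v\<close> and \<open>w\<close> before and after the exchange measure the distances of two ranks to both labels,
and by the triangle inequality they add up to at least \<open>2 |w - v|\<close>.\<close>

lemma displacement_exchange:
  assumes inv: "\<And>p. p \<in> A \<Longrightarrow> \<psi> p \<in> A" "\<And>p. p \<in> A \<Longrightarrow> \<psi> (\<psi> p) = p"
    and A: "A \<subseteq> histories n"
    and tree: "\<And>p. p \<in> A \<Longrightarrow> history_tree n (\<psi> p) = relabel (label_swap v w) (history_tree n p)"
    and c: "\<And>f t x. bij f \<Longrightarrow> c (relabel f t) (f x) = c t x"
    and vw: "v \<in> {1..n}" "w \<in> {1..n}"
  shows "\<bar>real w - real v\<bar> * prob_hist n (\<lambda>p. p \<in> A)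
    \<le> avg n (displacement c n v) + avg n (displacement c n w)"
proof -
  let ?s = "\<lambda>p. c (history_tree n p)"
  let ?d = "\<lambda>p. displacement c n v p + displacement c n w p"
  have swap: "?s (\<psi> p) = ?s p \<circ> label_swap v w" if "p \<in> A" for p
  proof
    fix x
    show "?s (\<psi> p) x = (?s p \<circ> label_swap v w) x"
      using c[of "label_swap v w" "history_tree n p" "label_swap v w x"] tree[OF that] by simp
  qed
  have pair: "2 * \<bar>real w - real v\<bar> \<le> ?d p + ?d (\<psi> p)" if "p \<in> A" for p
  proof -
    have "2 * \<bar>real w - real v\<bar> = tie_avg n (?s p) (\<lambda>\<sigma>. 2 * \<bar>real w - real v\<bar>)"
      by simp
    also have "\<dots> \<le> tie_avg n (?s p) (\<lambda>\<sigma>. (\<bar>real (\<sigma> v) - real v\<bar> + \<bar>real (\<sigma> w) - real w\<bar>)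
        + (\<bar>real (\<sigma> w) - real v\<bar> + \<bar>real (\<sigma> v) - real w\<bar>))"
    proof (rule tie_avg_mono)
      fix \<sigma> :: "nat \<Rightarrow> nat"
      have "\<bar>real w - real v\<bar> \<le> \<bar>real (\<sigma> v) - real v\<bar> + \<bar>real (\<sigma> v) - real w\<bar>"
        and "\<bar>real w - real v\<bar> \<le> \<bar>real (\<sigma> w) - real w\<bar> + \<bar>real (\<sigma> w) - real v\<bar>"
        by linarith+
      then show "2 * \<bar>real w - real v\<bar> \<le> (\<bar>real (\<sigma> v) - real v\<bar> + \<bar>real (\<sigma> w) - real w\<bar>)
        + (\<bar>real (\<sigma> w) - real v\<bar> + \<bar>real (\<sigma> v) - real w\<bar>)"
        by linarith
    qed
    also have "\<dots> = ?d p + (tie_avg n (?s p) (\<lambda>\<sigma>. \<bar>real (\<sigma> w) - real v\<bar>)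
        + tie_avg n (?s p) (\<lambda>\<sigma>. \<bar>real (\<sigma> v) - real w\<bar>))"
      unfolding tie_avg_add displacement_def ..
    also have "tie_avg n (?s p) (\<lambda>\<sigma>. \<bar>real (\<sigma> w) - real v\<bar>) = displacement c n v (\<psi> p)"
      unfolding displacement_def swap[OF that] tie_avg_transpose[OF vw] by simp
    also have "tie_avg n (?s p) (\<lambda>\<sigma>. \<bar>real (\<sigma> v) - real w\<bar>) = displacement c n w (\<psi> p)"
      unfolding displacement_def swap[OF that] tie_avg_transpose[OF vw] by simp
    finally show ?thesis .
  qed
  have fin: "finite A"
    using A finite_subset finite_histories by blast
  have "2 * (\<Sum>p\<in>A. \<bar>real w - real v\<bar>) = (\<Sum>p\<in>A. 2 * \<bar>real w - real v\<bar>)"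
    by (simp add: sum_distrib_left)
  also have "\<dots> \<le> (\<Sum>p\<in>A. ?d p + ?d (\<psi> p))"
    using pair by (rule sum_mono)
  also have "\<dots> = (\<Sum>p\<in>A. ?d p) + (\<Sum>p\<in>A. ?d (\<psi> p))"
    by (rule sum.distrib)
  also have "(\<Sum>p\<in>A. ?d (\<psi> p)) = (\<Sum>p\<in>A. ?d p)"
    using inv by (intro sum.reindex_bij_witness[of A \<psi> \<psi>]) auto
  finally have "(\<Sum>p\<in>A. \<bar>real w - real v\<bar>) \<le> (\<Sum>p\<in>A. ?d p)"
    by simp
  also have "\<dots> \<le> (\<Sum>p\<in>histories n. ?d p)"
    using A by (intro sum_mono2) (auto simp: displacement_nonneg)
  finally have "(\<Sum>p\<in>A. \<bar>real w - real v\<bar>) / fact (n - 1) \<le> avg n ?d"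
    unfolding avg_def by (rule divide_right_mono) simp
  moreover have "\<bar>real w - real v\<bar> * prob_hist n (\<lambda>p. p \<in> A) = (\<Sum>p\<in>A. \<bar>real w - real v\<bar>) / fact (n - 1)"
    unfolding avg_def using A by (simp add: of_bool_def sum.If_cases Int_absorb1)
  ultimately show ?thesis
    by (simp add: avg_add)
qed

text \<open>The condition on \<open>p w\<close> makes the parent of \<open>w\<close> an admissible parent for \<open>v\<close>, and the one on the vertices between
\<open>v\<close> and \<open>w\<close> ensures that no child of \<open>v\<close> is older than \<open>w\<close>.\<close>

definition exchangeable :: "nat \<Rightarrow> nat \<Rightarrow> nat \<Rightarrow> (nat \<Rightarrow> nat) set" where
  "exchangeable n v w = {p \<in> histories n. p w < v \<and> (\<forall>k\<in>{v<..<w}. p k \<noteq> v)}"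

definition exchange :: "nat \<Rightarrow> nat \<Rightarrow> nat \<Rightarrow> (nat \<Rightarrow> nat) \<Rightarrow> nat \<Rightarrow> nat" where
  "exchange n v w p = restrict (label_swap v w \<circ> p \<circ> label_swap v w) {2..n}"

context
  fixes n v w :: nat
  assumes vw: "2 \<le> v" "v < w" "w \<le> n"
begin

lemma label_swap_in: "k \<in> {2..n} \<Longrightarrow> label_swap v w k \<in> {2..n}"
  using vw by (auto simp: Transposition.transpose_def)

lemma exchange_parent_less:
  assumes p: "p \<in> exchangeable n v w" and k: "k \<in> {2..n}"
  shows "1 \<le> label_swap v w (p (label_swap v w k))" "label_swap v w (p (label_swap v w k)) < k"
proof -
  have h: "p \<in> histories n" and pw: "p w < v" and pk: "\<And>k. k \<in> {v<..<w} \<Longrightarrow> p k \<noteq> v"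
    using p by (auto simp: exchangeable_def)
  note par = history_parent[OF h]
  have "1 \<le> label_swap v w (p (label_swap v w k)) \<and> label_swap v w (p (label_swap v w k)) < k"
  proof (cases "k = v \<or> k = w")
    case True
    then show ?thesis
      using par[of v] par[of w] pw vw by (auto simp: Transposition.transpose_def)
  next
    case False
    then have "w < k" if "p k = v"
      using that pk[of k] par[of k] k by force
    then show ?thesis
      using False par[of k] k vw by (auto simp: Transposition.transpose_def)
  qed
  then show "1 \<le> label_swap v w (p (label_swap v w k))" "label_swap v w (p (label_swap v w k)) < k"
    by auto
qed

lemma exchange_in_exchangeable:
  assumes p: "p \<in> exchangeable n v w"
  shows "exchange n v w p \<in> exchangeable n v w"
proof -
  have h: "p \<in> histories n" using p by (simp add: exchangeable_def)
  have "exchange n v w p \<in> histories n"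
    using exchange_parent_less[OF p] unfolding histories_def exchange_def by (auto simp: PiE_def Pi_def)
  moreover have "exchange n v w p w < v"
    using vw history_parent[OF h, of v] by (auto simp: exchange_def Transposition.transpose_def)
  moreover have "exchange n v w p k \<noteq> v" if "k \<in> {v<..<w}" for k
    using that vw history_parent[OF h, of k] by (auto simp: exchange_def Transposition.transpose_def)
  ultimately show ?thesis
    by (simp add: exchangeable_def)
qed

lemma exchange_exchange:
  assumes p: "p \<in> exchangeable n v w"
  shows "exchange n v w (exchange n v w p) = p"
proof
  fix k
  show "exchange n v w (exchange n v w p) k = p k"
  proof (cases "k \<in> {2..n}")
    case True
    then show ?thesis
      using label_swap_in[OF True] by (simp add: exchange_def)
  next
    case False
    then show ?thesis
      using p by (auto simp: exchange_def exchangeable_def histories_def PiE_def extensional_def)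
  qed
qed

lemma history_tree_exchange:
  "history_tree n (exchange n v w p) = relabel (label_swap v w) (history_tree n p)"
proof -
  let ?t = "label_swap v w"
  have perm: "?t ` {2..n} = {2..n}"
    using vw by (intro permutes_image permutes_swap_id) auto
  have "(\<Union>k\<in>{2..n}. {(exchange n v w p k, k), (k, exchange n v w p k)})
      = (\<Union>k\<in>?t ` {2..n}. {(exchange n v w p k, k), (k, exchange n v w p k)})"
    unfolding perm ..
  also have "\<dots> = (\<Union>k\<in>{2..n}. {(exchange n v w p (?t k), ?t k), (?t k, exchange n v w p (?t k))})"
    by simp
  also have "\<dots> = (\<Union>k\<in>{2..n}. {(?t (p k), ?t k), (?t k, ?t (p k))})"
    using label_swap_in by (intro SUP_cong) (auto simp: exchange_def)
  also have "\<dots> = map_prod ?t ?t ` (\<Union>k\<in>{2..n}. {(p k, k), (k, p k)})"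
    by (simp add: image_UN)
  finally have "(\<Union>k\<in>{2..n}. {(exchange n v w p k, k), (k, exchange n v w p k)})
      = map_prod ?t ?t ` (\<Union>k\<in>{2..n}. {(p k, k), (k, p k)})" .
  moreover have "?t ` {1..n} = {1..n}"
    using vw by (intro permutes_image permutes_swap_id) auto
  ultimately show ?thesis
    unfolding history_tree_def relabel_def by simp
qed

end

lemma prod_avoid:
  assumes "2 \<le> v" "Suc v \<le> w"
  shows "(\<Prod>k\<in>{v<..<w}. (real k - 2) / (real k - 1)) = (real v - 1) / (real w - 2)"
  using assms(2)
proof (induction w rule: dec_induct)
  case base
  have "{v<..<Suc v} = {}" by auto
  then show ?case using assms(1) by simp
next
  case (step w)
  have "{v<..<Suc w} = insert w {v<..<w}" using step by auto
  then show ?case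
    using step assms(1) by (simp add: field_simps)
qed

lemma card_avoid:
  assumes "v \<in> {1..<k}"
  shows "real (card {x \<in> {1..<k}. x \<noteq> v}) = real k - 2"
proof -
  have "{x \<in> {1..<k}. x \<noteq> v} = {1..<k} - {v}" by auto
  then show ?thesis
    using assms by (simp add: of_nat_diff)
qed

lemma prob_exchangeable:
  assumes vw: "2 \<le> v" "v < w" "w \<le> n"
  shows "prob_hist n (\<lambda>p. p \<in> exchangeable n v w) = (real v - 1)\<^sup>2 / ((real w - 1) * (real w - 2))"
proof -
  let ?Q = "\<lambda>k x. if k = w then x < v else x \<noteq> v"
  let ?g = "\<lambda>k. real (card {x \<in> {1..<k}. ?Q k x}) / (real k - 1)"
  have "prob_hist n (\<lambda>p. p \<in> exchangeable n v w)
      = prob_hist n (\<lambda>p. \<forall>k\<in>insert w {v<..<w}. ?Q k (p k))"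
    by (rule avg_cong) (auto simp: exchangeable_def)
  also have "\<dots> = (\<Prod>k\<in>insert w {v<..<w}. ?g k)"
    using vw by (intro prob_parents) auto
  also have "\<dots> = ?g w * (\<Prod>k\<in>{v<..<w}. ?g k)"
    by simp
  also have "?g w = (real v - 1) / (real w - 1)"
  proof -
    have "{x \<in> {1..<w}. ?Q w x} = {1..<v}" using vw by auto
    then show ?thesis using vw by (simp add: of_nat_diff)
  qed
  also have "(\<Prod>k\<in>{v<..<w}. ?g k) = (\<Prod>k\<in>{v<..<w}. (real k - 2) / (real k - 1))"
    using card_avoid[of v] vw by (intro prod.cong) auto
  also have "\<dots> = (real v - 1) / (real w - 2)"
    using vw by (intro prod_avoid) auto
  finally show ?thesis
    by (simp add: power2_eq_square)
qed

lemma avg_displacement_pair_ge: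
  assumes c: "\<And>f t x. bij f \<Longrightarrow> c (relabel f t) (f x) = c t x"
    and vw: "2 \<le> v" "v < w" "w \<le> n"
  shows "(real w - real v) * ((real v - 1)\<^sup>2 / ((real w - 1) * (real w - 2)))
    \<le> avg n (displacement c n v) + avg n (displacement c n w)"
proof -
  have "\<bar>real w - real v\<bar> * prob_hist n (\<lambda>p. p \<in> exchangeable n v w)
    \<le> avg n (displacement c n v) + avg n (displacement c n w)"
  proof (rule displacement_exchange[where \<psi> = "exchange n v w"])
    show "history_tree n (exchange n v w p) = relabel (label_swap v w) (history_tree n p)" for p
      by (rule history_tree_exchange[OF vw])
  qed (use vw c exchange_in_exchangeable[OF vw] exchange_exchange[OF vw]
      in \<open>auto simp: exchangeable_def\<close>)
  then show ?thesis
    using vw by (simp add: prob_exchangeable)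
qed

text \<open>With only two vertices the exchange of the labels is an automorphism of the tree.\<close>

lemma avg_displacement_two:
  assumes c: "\<And>f t x. bij f \<Longrightarrow> c (relabel f t) (f x) = c t x"
  shows "1 \<le> avg 2 (displacement c 2 1) + avg 2 (displacement c 2 2)"
proof -
  have "\<bar>real 2 - real 1\<bar> * prob_hist 2 (\<lambda>p. p \<in> histories 2)
    \<le> avg 2 (displacement c 2 1) + avg 2 (displacement c 2 2)"
  proof (rule displacement_exchange[where \<psi> = "\<lambda>p. p"])
    fix p assume p: "p \<in> histories 2"
    then have "p 2 = 1"
      using history_parent[OF p, of 2] by simp
    moreover have "{2..2 :: nat} = {2}" "{1..2 :: nat} = {1, 2}" by auto
    ultimately show "history_tree 2 p = relabel (label_swap 1 2) (history_tree 2 p)"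
      by (auto simp: history_tree_def relabel_def Transposition.transpose_def)
  qed (use c in auto)
  moreover have "prob_hist 2 (\<lambda>p. p \<in> histories 2) = 1"
    using avg_cong[of 2 "\<lambda>p. of_bool (p \<in> histories 2)" "\<lambda>_. 1"] by simp
  ultimately show ?thesis by simp
qed

section \<open>Transplanting what has grown on a vertex\<close>

text \<open>The vertex \<open>v\<close> is still a leaf after the arrival of \<open>u\<close>, so from then on \<open>u\<close> and \<open>v\<close> have the same prospects.
Unlike the exchange of labels above, the transplantation leaves the parents of \<open>u\<close> and \<open>v\<close> in place and exchanges only
what is attached to them later. It does not preserve the shape of the tree, but it
is possible with probability of order \<open>v / u\<close> instead of \<open>(v / u)\<^sup>2\<close>.\<close>

definition transplantable :: "nat \<Rightarrow> nat \<Rightarrow> nat \<Rightarrow> (nat \<Rightarrow> nat) set" where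
  "transplantable n v u = {p \<in> histories n. \<forall>k\<in>{v<..u}. p k \<noteq> v}"

definition transplant :: "nat \<Rightarrow> nat \<Rightarrow> nat \<Rightarrow> (nat \<Rightarrow> nat) \<Rightarrow> nat \<Rightarrow> nat" where
  "transplant n v u p k = (if k \<in> {u<..n} then label_swap v u (p k) else p k)"

context
  fixes n v u :: nat
  assumes vu: "2 \<le> v" "v < u" "u \<le> n"
begin

lemma transplant_in_histories:
  assumes p: "p \<in> histories n"
  shows "transplant n v u p \<in> histories n"
proof -
  have "transplant n v u p k \<in> {1..<k}" if k: "k \<in> {2..n}" for k
    using history_parent[OF p, of k] k vu by (auto simp: transplant_def Transposition.transpose_def)
  moreover have "transplant n v u p k = undefined" if "k \<notin> {2..n}" for k
    using that p vu by (auto simp: transplant_def histories_def PiE_def extensional_def)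
  ultimately show ?thesis
    unfolding histories_def PiE_def Pi_def extensional_def by blast
qed

lemma transplant_in_transplantable:
  assumes "p \<in> transplantable n v u"
  shows "transplant n v u p \<in> transplantable n v u"
  using assms transplant_in_histories by (auto simp: transplantable_def transplant_def)

lemma transplant_transplant: "transplant n v u (transplant n v u p) = p"
  by (rule ext) (simp add: transplant_def)

lemma anc_transplant:
  assumes p: "p \<in> histories n" and y: "y \<in> {u<..n}"
  shows "anc {1..u} (transplant n v u p) y = label_swap v u (anc {1..u} p y)"
  using y
proof (induction y rule: less_induct)
  case (less y)
  let ?q = "transplant n v u p"
  have q: "?q \<in> histories n"
    by (rule transplant_in_histories[OF p])
  have step: "anc {1..u} p y = anc {1..u} p (p y)" "anc {1..u} ?q y = anc {1..u} ?q (?q y)"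
    using less.prems vu by (auto intro!: anc_parent[OF p] anc_parent[OF q])
  have py: "1 \<le> p y" "p y < y"
    using history_parent[OF p, of y] less.prems vu by auto
  have qy: "?q y = label_swap v u (p y)"
    using less.prems by (simp add: transplant_def)
  show ?case
  proof (cases "p y \<le> u")
    case True
    then have "label_swap v u (p y) \<in> {1..u}"
      using py vu by (auto simp: Transposition.transpose_def)
    then show ?thesis
      using True py unfolding step qy by simp
  next
    case False
    then have "label_swap v u (p y) = p y"
      using vu by (auto simp: Transposition.transpose_def)
    then show ?thesis
      using False py less.IH[of "p y"] less.prems unfolding step qy by auto
  qed
qed

lemma clan_size_late:
  assumes i: "i \<in> {1..u}"
  shows "clan_size {1..u} p n i = Suc (card {y \<in> {u<..n}. anc {1..u} p y = i})"
proof -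
  have "clan {1..u} p n i = insert i {y \<in> {u<..n}. anc {1..u} p y = i}"
  proof (intro equalityI subsetI)
    fix y assume "y \<in> clan {1..u} p n i"
    then show "y \<in> insert i {y \<in> {u<..n}. anc {1..u} p y = i}"
      using anc_root[of y "{1..u}" p] by (cases "y \<le> u") (auto simp: clan_def)
  qed (use i vu in \<open>auto simp: clan_def\<close>)
  then show ?thesis
    using i by simp
qed

lemma clan_size_transplant:
  assumes p: "p \<in> histories n"
  shows "clan_size {1..u} (transplant n v u p) n v = clan_size {1..u} p n u"
    and "clan_size {1..u} (transplant n v u p) n u = clan_size {1..u} p n v"
proof -
  have "{y \<in> {u<..n}. anc {1..u} (transplant n v u p) y = v} = {y \<in> {u<..n}. anc {1..u} p y = u}"
    and "{y \<in> {u<..n}. anc {1..u} (transplant n v u p) y = u} = {y \<in> {u<..n}. anc {1..u} p y = v}"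
    using anc_transplant[OF p] by (auto simp: Transposition.transpose_def split: if_splits)
  then show "clan_size {1..u} (transplant n v u p) n v = clan_size {1..u} p n u"
    and "clan_size {1..u} (transplant n v u p) n u = clan_size {1..u} p n v"
    using vu by (simp_all add: clan_size_late del: One_nat_def)
qed

lemma descendants_transplantable:
  assumes p: "p \<in> transplantable n v u"
  shows "descendants p n v = clan {1..u} p n v"
proof
  have h: "p \<in> histories n" and nv: "\<And>k. k \<in> {v<..u} \<Longrightarrow> p k \<noteq> v"
    using p by (auto simp: transplantable_def)
  have other: "anc {1, v} p i \<noteq> v" if "i \<in> {1..u}" "i \<noteq> v" for i
    using that
  proof (induction i rule: less_induct)
    case (less i)
    show ?case
    proof (cases "i = 1")
      case True
      then show ?thesis using vu by simp
    next
      case False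
      have "anc {1, v} p i = anc {1, v} p (p i)"
        using False less.prems vu by (intro anc_parent[OF h]) auto
      moreover have pi: "1 \<le> p i" "p i < i"
        using history_parent[OF h, of i] False less.prems vu by auto
      moreover have "p i \<noteq> v"
        using nv[of i] less.prems pi by (cases "v < i") auto
      ultimately show ?thesis
        using less.IH[of "p i"] less.prems by auto
    qed
  qed
  show "clan {1..u} p n v \<subseteq> descendants p n v"
    using vu by (intro clan_antimono) auto
  show "descendants p n v \<subseteq> clan {1..u} p n v"
  proof
    fix y assume y: "y \<in> descendants p n v"
    let ?i = "anc {1..u} p y"
    have "?i \<in> {1..u}"
      using y vu by (intro anc_in[OF h]) (auto simp: clan_def)
    moreover have "anc {1, v} p ?i = v"
      using y vu anc_anc[of "{1, v}" "{1..u}" p y] by (simp add: clan_def)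
    ultimately have "?i = v"
      using other by blast
    then show "y \<in> clan {1..u} p n v"
      using y by (simp add: clan_def)
  qed
qed

text \<open>At time \<open>u\<close> both \<open>u\<close> and \<open>v\<close> are leaves, so their scores are at most their clans, and they are equal to
them unless a clan makes up more than half of the tree. In that case the score is still larger than the other clan,
because vertex \<open>1\<close> lies outside both.\<close>

lemma jordan_transplantable:
  assumes p: "p \<in> transplantable n v u"
  defines "K \<equiv> clan_size {1..u} p n"
  shows "K v < K u \<Longrightarrow> jordan (history_tree n p) v < jordan (history_tree n p) u"
    and "K v = K u \<Longrightarrow> jordan (history_tree n p) v = jordan (history_tree n p) u"
proof -
  let ?j = "jordan (history_tree n p)"
  have h: "p \<in> histories n" using p by (simp add: transplantable_def)
  have n2: "2 \<le> n" using vu by simp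
  have v_le: "?j v \<le> K v"
    using jordan_le_descendants[OF h n2, of v] vu unfolding descendants_transplantable[OF p] K_def by simp
  have u_le: "?j u \<le> K u"
    using jordan_le_descendants[OF h n2, of u] clan_last_root[OF h, of "{1..u}" u] vu
    unfolding K_def by simp
  have ge: "min (K x) (n - K x) \<le> ?j x" if "x \<in> {v, u}" for x
    unfolding K_def using that vu by (intro jordan_ge_clan[OF h n2]) auto
  have K1: "1 \<le> K 1"
    unfolding K_def using vu by (intro clan_size_pos) auto
  have two: "K v + K 1 \<le> n - K u" "K u + K 1 \<le> n - K v"
    unfolding K_def using vu by (intro two_clans_le; simp)+
  show "K v < K u \<Longrightarrow> ?j v < ?j u"
    using v_le ge[of u] K1 two by simp
  show "K v = K u \<Longrightarrow> ?j v = ?j u"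
    using v_le u_le ge[of u] ge[of v] K1 two by simp
qed

lemma prob_transplantable:
  "prob_hist n (\<lambda>p. p \<in> transplantable n v u) = (real v - 1) / (real u - 1)"
proof -
  have "prob_hist n (\<lambda>p. p \<in> transplantable n v u) = prob_hist n (\<lambda>p. \<forall>k\<in>{v<..u}. p k \<noteq> v)"
    by (rule avg_cong) (simp add: transplantable_def)
  also have "\<dots> = (\<Prod>k\<in>{v<..u}. real (card {x \<in> {1..<k}. x \<noteq> v}) / (real k - 1))"
    using vu by (intro prob_parents) auto
  also have "\<dots> = (\<Prod>k\<in>{v<..<Suc u}. (real k - 2) / (real k - 1))"
    using card_avoid[of v] vu by (intro prod.cong) auto
  also have "\<dots> = (real v - 1) / (real u - 1)"
    using vu by (subst prod_avoid) auto
  finally show ?thesis .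
qed

text \<open>Transplantation exchanges the roles of \<open>u\<close> and \<open>v\<close>, and ties are broken evenly, so on the event of
\<open>prob_transplantable\<close> either vertex precedes the other with probability one half.\<close>

lemma avg_overtake_ge:
  "(real v - 1) / (2 * (real u - 1))
    \<le> avg n (\<lambda>p. tie_avg n (jordan (history_tree n p)) (\<lambda>\<sigma>. of_bool (\<sigma> u < \<sigma> v)))"
proof -
  let ?A = "transplantable n v u" and ?\<psi> = "transplant n v u"
  let ?j = "\<lambda>p. jordan (history_tree n p)"
  let ?q = "\<lambda>p. tie_avg n (?j p) (\<lambda>\<sigma>. of_bool (\<sigma> u < \<sigma> v)) :: real"
  have uv: "u \<in> {1..n}" "v \<in> {1..n}" using vu by auto
  have q0: "0 \<le> ?q p" for p by (rule tie_avg_nonneg) simp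
  have above: "?q p = 1" if "?j p v < ?j p u" for p
  proof -
    have "?q p = tie_avg n (?j p) (\<lambda>\<sigma>. 1)"
      using that uv by (intro tie_avg_cong) (auto simp: decreasing_rankings_def)
    then show ?thesis by simp
  qed
  have tie: "?q p = 1 / 2" if "?j p v = ?j p u" for p
  proof -
    have "?j p \<circ> label_swap u v = ?j p"
      using that by (auto simp: fun_eq_iff Transposition.transpose_def)
    then have "?q p = tie_avg n (?j p) (\<lambda>\<sigma>. of_bool (\<sigma> v < \<sigma> u))"
      using tie_avg_transpose[OF uv, of "?j p" "\<lambda>\<sigma>. of_bool (\<sigma> u < \<sigma> v)"] by simp
    then have "?q p + ?q p = tie_avg n (?j p) (\<lambda>\<sigma>. of_bool (\<sigma> u < \<sigma> v) + of_bool (\<sigma> v < \<sigma> u))"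
      by (simp add: tie_avg_add)
    also have "\<dots> = tie_avg n (?j p) (\<lambda>\<sigma>. 1)"
    proof (rule tie_avg_cong)
      fix \<sigma> assume "\<sigma> \<in> decreasing_rankings n (?j p)"
      then have "\<sigma> u \<noteq> \<sigma> v"
        using vu permutes_inj[of \<sigma>] by (auto simp: decreasing_rankings_def inj_eq)
      then show "of_bool (\<sigma> u < \<sigma> v) + of_bool (\<sigma> v < \<sigma> u) = (1 :: real)" by auto
    qed
    finally show ?thesis by simp
  qed
  have pair: "1 \<le> ?q p + ?q (?\<psi> p)" if p: "p \<in> ?A" for p
  proof -
    let ?K = "clan_size {1..u} p n"
    have h: "p \<in> histories n" using p by (simp add: transplantable_def)
    note K = clan_size_transplant[OF h]
    note P = jordan_transplantable[OF p]
      and Q = jordan_transplantable[OF transplant_in_transplantable[OF p], unfolded K]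
    consider "?K v < ?K u" | "?K v = ?K u" | "?K u < ?K v" by linarith
    then show ?thesis
    proof cases
      case 1
      then show ?thesis using above[OF P(1)] q0[of "?\<psi> p"] by simp
    next
      case 2
      then show ?thesis using tie[OF P(2)] tie[OF Q(2)] by simp
    next
      case 3
      then show ?thesis using above[OF Q(1)] q0[of p] by simp
    qed
  qed
  have fin: "finite ?A"
    by (rule finite_subset[OF _ finite_histories[of n]]) (auto simp: transplantable_def)
  have "real (card ?A) = (\<Sum>p\<in>?A. 1)" by simp
  also have "\<dots> \<le> (\<Sum>p\<in>?A. ?q p + ?q (?\<psi> p))"
    using pair by (rule sum_mono)
  also have "\<dots> = (\<Sum>p\<in>?A. ?q p) + (\<Sum>p\<in>?A. ?q (?\<psi> p))"
    by (rule sum.distrib)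
  also have "(\<Sum>p\<in>?A. ?q (?\<psi> p)) = (\<Sum>p\<in>?A. ?q p)"
    using transplant_in_transplantable
    by (intro sum.reindex_bij_witness[of ?A ?\<psi> ?\<psi>]) (auto simp: transplant_transplant)
  also have "(\<Sum>p\<in>?A. ?q p) \<le> (\<Sum>p\<in>histories n. ?q p)"
    using q0 by (intro sum_mono2) (auto simp: transplantable_def)
  finally have "real (card ?A) / 2 \<le> (\<Sum>p\<in>histories n. ?q p)" by simp
  then have "real (card ?A) / 2 / fact (n - 1) \<le> avg n ?q"
    unfolding avg_def by (rule divide_right_mono) simp
  moreover have "prob_hist n (\<lambda>p. p \<in> ?A) = real (card ?A) / fact (n - 1)"
    unfolding avg_def using fin
    by (simp add: of_bool_def sum.If_cases Int_absorb1 transplantable_def Int_def)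
  moreover have "(real v - 1) / (2 * (real u - 1)) = (real v - 1) / (real u - 1) / 2"
    by simp
  ultimately show ?thesis
    unfolding prob_transplantable by simp
qed

end

section \<open>Expected displacement of each vertex\<close>

lemma sum_inverse_le:
  assumes "1 \<le> v" "v \<le> n"
  shows "(\<Sum>u\<in>{v<..n}. 1 / real u) \<le> ln (real n) - ln (real v)"
  using assms(2)
proof (induction n rule: dec_induct)
  case (step n)
  have "{v<..Suc n} = insert (Suc n) {v<..n}" using step by auto
  moreover have "1 / real (Suc n) \<le> ln (real (Suc n)) - ln (real n)"
  proof -
    have "ln (real n / real (Suc n)) \<le> real n / real (Suc n) - 1"
      using step assms by (intro ln_le_minus_one) auto
    then show ?thesis
      using step assms by (simp add: ln_div field_simps)
  qed
  ultimately show ?case using step by simp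
qed simp

lemma sum_inverse_ge:
  assumes "1 \<le> v" "v \<le> n"
  shows "ln (real n) - ln (real v) \<le> (\<Sum>u\<in>{v<..n}. 1 / (real u - 1))"
  using assms(2)
proof (induction n rule: dec_induct)
  case (step n)
  have "{v<..Suc n} = insert (Suc n) {v<..n}" using step by auto
  moreover have "ln (real (Suc n)) - ln (real n) \<le> 1 / (real (Suc n) - 1)"
  proof -
    have "ln (real (Suc n) / real n) \<le> real (Suc n) / real n - 1"
      using step assms by (intro ln_le_minus_one) auto
    then show ?thesis
      using step assms by (simp add: ln_div field_simps)
  qed
  ultimately show ?case using step by simp
qed simp

text \<open>The logarithm is the sum of the inversion probabilities \<open>v / u\<close> over all \<open>u\<close> between \<open>v\<close> and \<open>n\<close>.\<close>

lemma avg_displacement_jordan_le: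
  assumes v: "v \<in> {1..n}"
  shows "avg n (displacement jordan n v) \<le> 16 * real v * (1 + (ln (real n) - ln (real v)))"
proof -
  have "avg n (displacement jordan n v) \<le> 2 * real v
      + (\<Sum>u\<in>{v<..n}. prob_hist n (\<lambda>p. jordan (history_tree n p) v \<le> jordan (history_tree n p) u))"
    by (rule avg_displacement_le[OF v])
  also have "\<dots> \<le> 2 * real v + (\<Sum>u\<in>{v<..n}. 16 * real v * (1 / real u))"
  proof (intro add_left_mono sum_mono)
    fix u assume u: "u \<in> {v<..n}"
    show "prob_hist n (\<lambda>p. jordan (history_tree n p) v \<le> jordan (history_tree n p) u)
      \<le> 16 * real v * (1 / real u)"
    proof (cases "max v 2 < u")
      case True
      then show ?thesis using prob_jordan_le[of v u n] u v by simp
    next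
      case False
      then have "u = 2" "v = 1" using u v by auto
      then show ?thesis
        using prob_hist_le_1[of n "\<lambda>p. jordan (history_tree n p) v \<le> jordan (history_tree n p) u"] by simp
    qed
  qed
  also have "\<dots> = 2 * real v + 16 * real v * (\<Sum>u\<in>{v<..n}. 1 / real u)"
    by (simp only: sum_distrib_left)
  also have "\<dots> \<le> 16 * real v + 16 * real v * (ln (real n) - ln (real v))"
    using v by (intro add_mono mult_left_mono sum_inverse_le) auto
  finally show ?thesis
    by (simp add: algebra_simps)
qed

lemma avg_displacement_jordan2_le:
  assumes v: "v \<in> {1..n}"
  shows "avg n (displacement jordan2 n v) \<le> 10 ^ 12 * real v"
proof -
  let ?m = "max v 3"
  have "avg n (displacement jordan2 n v) \<le> 2 * real v
      + (\<Sum>u\<in>{v<..n}. prob_hist n (\<lambda>p. jordan2 (history_tree n p) v \<le> jordan2 (history_tree n p) u))"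
    by (rule avg_displacement_le[OF v])
  also have "\<dots> \<le> 2 * real v + (\<Sum>u\<in>{v<..n}. 5 * 10 ^ 9 * real ?m powr (6/5) * real u powr (- (1/5) - 1))"
  proof (intro add_left_mono sum_mono)
    fix u assume u: "u \<in> {v<..n}"
    have eq: "5 * 10 ^ 9 * (real ?m / real u) powr (6/5)
        = 5 * 10 ^ 9 * real ?m powr (6/5) * real u powr (- (1/5) - 1)"
      by (simp add: powr_divide powr_minus_divide)
    show "prob_hist n (\<lambda>p. jordan2 (history_tree n p) v \<le> jordan2 (history_tree n p) u)
      \<le> 5 * 10 ^ 9 * real ?m powr (6/5) * real u powr (- (1/5) - 1)"
    proof (cases "?m < u")
      case True
      then show ?thesis using prob_jordan2_le[of v u n] u v unfolding eq by simp
    next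
      case False
      then have "1 \<le> (real ?m / real u) powr (6/5)"
        using u by (intro ge_one_powr_ge_zero) auto
      then show ?thesis
        using prob_hist_le_1[of n "\<lambda>p. jordan2 (history_tree n p) v \<le> jordan2 (history_tree n p) u"]
        unfolding eq[symmetric] by simp
    qed
  qed
  also have "\<dots> = 2 * real v + 5 * 10 ^ 9 * real ?m powr (6/5) * (\<Sum>u\<in>{v<..n}. real u powr (- (1/5) - 1))"
    by (simp only: sum_distrib_left)
  also have "(\<Sum>u\<in>{v<..n}. real u powr (- (1/5) - 1)) \<le> 5 * real v powr (- (1/5))"
    using sum_powr_tail_le[of "1/5" v n] v by (auto intro: order.trans)
  also have "real ?m powr (6/5) \<le> 9 * real v powr (6/5)"
  proof -
    have "real ?m powr (6/5) \<le> (3 * real v) powr (6/5)"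
      using v by (intro powr_mono2) auto
    also have "\<dots> = 3 powr (6/5) * real v powr (6/5)"
      by (simp add: powr_mult)
    also have "\<dots> \<le> 3 powr 2 * real v powr (6/5)"
      by (intro mult_right_mono powr_mono) auto
    finally show ?thesis by simp
  qed
  finally have "avg n (displacement jordan2 n v)
      \<le> 2 * real v + 5 * 10 ^ 9 * (9 * real v powr (6/5)) * (5 * real v powr (- (1/5)))"
    by (simp add: mult_left_mono mult_right_mono)
  also have "\<dots> = 2 * real v + 225 * 10 ^ 9 * (real v powr (6/5) * real v powr (- (1/5)))"
    by simp
  also have "real v powr (6/5) * real v powr (- (1/5)) = real v"
    using v by (simp add: powr_add[symmetric])
  finally show ?thesis
    by simp
qed

lemma avg_displacement_jordan_ge:
  assumes v: "2 \<le> v" "v \<le> n"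
  shows "real v * ((ln (real n) - ln (real v)) / 4 - 1) \<le> avg n (displacement jordan n v)"
proof -
  have "real v * ((ln (real n) - ln (real v)) / 4 - 1) = real v / 4 * (ln (real n) - ln (real v)) - real v"
    by (simp add: algebra_simps)
  also have "\<dots> \<le> (real v - 1) / 2 * (\<Sum>u\<in>{v<..n}. 1 / (real u - 1)) - real v"
    using v sum_inverse_ge[of v n]
    by (intro diff_right_mono mult_mono) auto
  also have "\<dots> = (\<Sum>u\<in>{v<..n}. (real v - 1) / (2 * (real u - 1))) - real v"
    by (simp add: sum_distrib_left)
  also have "\<dots> \<le> (\<Sum>u\<in>{v<..n}.
      avg n (\<lambda>p. tie_avg n (jordan (history_tree n p)) (\<lambda>\<sigma>. of_bool (\<sigma> u < \<sigma> v)))) - real v"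
    using v by (intro diff_right_mono sum_mono avg_overtake_ge) auto
  also have "\<dots> \<le> avg n (displacement jordan n v)"
    using v by (intro avg_displacement_ge) auto
  finally show ?thesis .
qed

section \<open>Summing up\<close>

lemma sum_powr_le':
  fixes s :: real
  assumes s: "0 < s"
  shows "(\<Sum>k\<in>{1..n}. real k powr (s - 1)) \<le> (1 + 1 / s) * real n powr s"
proof (cases "s < 1")
  case True
  have "(1 + 1 / s) * real n powr s = real n powr s + real n powr s / s"
    by (simp add: distrib_right)
  then show ?thesis
    using sum_powr_le[OF s True, of n] powr_ge_zero[of "real n" s] by linarith
next
  case False
  have "(\<Sum>k\<in>{1..n}. real k powr (s - 1)) \<le> (\<Sum>k\<in>{1..n}. real n powr (s - 1))"
    using False by (intro sum_mono powr_mono2) auto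
  also have "\<dots> = real n * real n powr (s - 1)"
    by simp
  also have "\<dots> = real n powr s"
    by (cases "n = 0") (auto simp: powr_diff)
  also have "\<dots> \<le> (1 + 1 / s) * real n powr s"
    using s by (simp add: distrib_right)
  finally show ?thesis .
qed

lemma ln_ge_half:
  assumes "2 \<le> n"
  shows "1 / 2 \<le> ln (real n)"
proof -
  have "ln 2 \<le> ln (real n)"
    using assms by simp
  then show ?thesis
    using ln2_ge_two_thirds by simp
qed

lemma sum_powr_le_f_rate:
  assumes "\<alpha> > 0"
  shows "\<exists>C>0. \<forall>n\<ge>2. (\<Sum>v\<in>{1..n}. real v powr (1 - \<alpha>)) \<le> C * f_rate \<alpha> n"
proof -
  consider "\<alpha> < 2" | "\<alpha> = 2" | "\<alpha> > 2" by linarith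
  then show ?thesis
  proof cases
    case 1
    then have "(\<Sum>v\<in>{1..n}. real v powr (1 - \<alpha>)) \<le> (1 + 1 / (2 - \<alpha>)) * f_rate \<alpha> n" for n
      using sum_powr_le'[of "2 - \<alpha>" n] by (simp add: f_rate_def)
    then show ?thesis
      using 1 by (intro exI[of _ "1 + 1 / (2 - \<alpha>)"]) (auto intro: add_pos_pos)
  next
    case 2
    have "(\<Sum>v\<in>{1..n}. real v powr (1 - \<alpha>)) \<le> 3 * f_rate \<alpha> n" if n: "2 \<le> n" for n
    proof -
      have "{1..n} = insert 1 {1<..n}" using n by auto
      then have "(\<Sum>v\<in>{1..n}. real v powr (1 - \<alpha>)) = 1 + (\<Sum>v\<in>{1<..n}. 1 / real v)"
        using 2 by (simp add: powr_minus_divide)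
      also have "\<dots> \<le> 1 + ln (real n)"
        using sum_inverse_le[of 1 n] n by simp
      finally show ?thesis
        using ln_ge_half[OF n] 2 by (simp add: f_rate_def)
    qed
    then show ?thesis by (intro exI[of _ 3]) auto
  next
    case 3
    have "(\<Sum>v\<in>{1..n}. real v powr (1 - \<alpha>)) \<le> (1 + 1 / (\<alpha> - 2)) * f_rate \<alpha> n" if n: "2 \<le> n" for n
    proof -
      have "{1..n} = insert 1 {1<..n}" using n by auto
      then have "(\<Sum>v\<in>{1..n}. real v powr (1 - \<alpha>)) = 1 + (\<Sum>v\<in>{1<..n}. real v powr (- (\<alpha> - 2) - 1))"
        by simp
      also have "(\<Sum>v\<in>{1<..n}. real v powr (- (\<alpha> - 2) - 1)) \<le> (1 - real n powr - (\<alpha> - 2)) / (\<alpha> - 2)"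
        using sum_powr_tail_le[of "\<alpha> - 2" 1 n] 3 n by simp
      also have "\<dots> \<le> 1 / (\<alpha> - 2)"
        using 3 by (intro divide_right_mono) auto
      finally show ?thesis
        using 3 by (simp add: f_rate_def)
    qed
    then show ?thesis
      using 3 by (intro exI[of _ "1 + 1 / (\<alpha> - 2)"]) (auto intro: add_pos_pos)
  qed
qed

text \<open>For \<open>\<alpha> < 2\<close> the sum is dominated by \<open>v\<close> of order \<open>n\<close>, where the logarithm is bounded; it is
absorbed by a small power of \<open>n / v\<close>.\<close>

lemma sum_powr_ln_le_g_rate:
  assumes "\<alpha> > 0"
  shows "\<exists>C>0. \<forall>n\<ge>2. (\<Sum>v\<in>{1..n}. real v powr (1 - \<alpha>) * (1 + (ln (real n) - ln (real v)))) \<le> C * g_rate \<alpha> n"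
proof -
  obtain C where C: "C > 0" "\<And>n. 2 \<le> n \<Longrightarrow> (\<Sum>v\<in>{1..n}. real v powr (1 - \<alpha>)) \<le> C * f_rate \<alpha> n"
    using sum_powr_le_f_rate[OF assms] by blast
  show ?thesis
  proof (cases "\<alpha> < 2")
    case False
    have "(\<Sum>v\<in>{1..n}. real v powr (1 - \<alpha>) * (1 + (ln (real n) - ln (real v)))) \<le> 3 * C * g_rate \<alpha> n"
      if n: "2 \<le> n" for n
    proof -
      have "(\<Sum>v\<in>{1..n}. real v powr (1 - \<alpha>) * (1 + (ln (real n) - ln (real v))))
          \<le> (\<Sum>v\<in>{1..n}. real v powr (1 - \<alpha>) * (3 * ln (real n)))"
      proof (intro sum_mono mult_left_mono)
        fix v assume "v \<in> {1..n}"
        then have "0 \<le> ln (real v)" by simp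
        then show "1 + (ln (real n) - ln (real v)) \<le> 3 * ln (real n)"
          using ln_ge_half[OF n] by linarith
      qed auto
      also have "\<dots> = (\<Sum>v\<in>{1..n}. real v powr (1 - \<alpha>)) * (3 * ln (real n))"
        by (simp only: sum_distrib_right)
      also have "\<dots> \<le> C * f_rate \<alpha> n * (3 * ln (real n))"
        using C(2)[OF n] n by (intro mult_right_mono) auto
      also have "\<dots> = 3 * C * g_rate \<alpha> n"
        using False by (simp add: f_rate_def g_rate_def power2_eq_square)
      finally show ?thesis .
    qed
    then show ?thesis
      using C(1) by (intro exI[of _ "3 * C"]) auto
  next
    case True
    \<comment> \<open>Half of the available exponent \<open>2 - \<alpha>\<close> pays for the logarithm.\<close>
    define e where "e = (2 - \<alpha>) / 2"
    have e: "0 < e" using True by (simp add: e_def)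
    let ?C = "C + 1 / e * (1 + 1 / e)"
    have "(\<Sum>v\<in>{1..n}. real v powr (1 - \<alpha>) * (1 + (ln (real n) - ln (real v)))) \<le> ?C * g_rate \<alpha> n"
      if n: "2 \<le> n" for n
    proof -
      have "(\<Sum>v\<in>{1..n}. real v powr (1 - \<alpha>) * (1 + (ln (real n) - ln (real v))))
          \<le> (\<Sum>v\<in>{1..n}. real v powr (1 - \<alpha>) + real n powr e / e * real v powr (e - 1))"
      proof (rule sum_mono)
        fix v assume v: "v \<in> {1..n}"
        have "ln (real n) - ln (real v) = ln (real n / real v)"
          using v by (simp add: ln_div)
        also have "\<dots> \<le> (real n / real v) powr e / e"
          using v e by (intro ln_powr_bound) auto
        finally have "real v powr (1 - \<alpha>) * (ln (real n) - ln (real v))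
            \<le> real v powr (1 - \<alpha>) * ((real n / real v) powr e / e)"
          by (intro mult_left_mono) auto
        also have "\<dots> = real n powr e / e * (real v powr (1 - \<alpha>) * real v powr - e)"
          using v by (simp add: powr_divide powr_minus_divide mult_ac)
        also have "real v powr (1 - \<alpha>) * real v powr - e = real v powr (e - 1)"
          unfolding powr_add[symmetric] by (simp add: e_def field_simps)
        finally show "real v powr (1 - \<alpha>) * (1 + (ln (real n) - ln (real v)))
            \<le> real v powr (1 - \<alpha>) + real n powr e / e * real v powr (e - 1)"
          by (simp add: distrib_left)
      qed
      also have "\<dots> = (\<Sum>v\<in>{1..n}. real v powr (1 - \<alpha>)) + real n powr e / e * (\<Sum>v\<in>{1..n}. real v powr (e - 1))"
        by (simp only: sum.distrib sum_distrib_left)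
      also have "\<dots> \<le> C * f_rate \<alpha> n + real n powr e / e * ((1 + 1 / e) * real n powr e)"
        using C(2)[OF n] e sum_powr_le'[OF e, of n] by (intro add_mono mult_left_mono) auto
      also have "real n powr e / e * ((1 + 1 / e) * real n powr e) = 1 / e * (1 + 1 / e) * (real n powr e * real n powr e)"
        by simp
      also have "real n powr e * real n powr e = real n powr (2 - \<alpha>)"
        unfolding powr_add[symmetric] by (simp add: e_def)
      finally show ?thesis
        using True by (simp add: f_rate_def g_rate_def distrib_right)
    qed
    moreover have "0 < ?C" using C(1) e by (simp add: add_pos_pos)
    ultimately show ?thesis by blast
  qed
qed

lemma risk_ge_two_terms:
  assumes "v \<in> {1..n}" "w \<in> {1..n}" "v < w" "\<alpha> > 0"
  shows "(avg n (displacement c n v) + avg n (displacement c n w)) / real w powr \<alpha> \<le> risk \<alpha> n (ranking_pmf c n)"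
proof -
  let ?W = "\<lambda>v. avg n (displacement c n v)"
  have W0: "0 \<le> ?W x" for x by (intro avg_nonneg displacement_nonneg)
  have "(?W v + ?W w) / real w powr \<alpha> \<le> ?W v / real v powr \<alpha> + ?W w / real w powr \<alpha>"
    using assms W0 by (auto simp: add_divide_distrib intro!: divide_left_mono powr_mono2)
  also have "\<dots> = (\<Sum>x\<in>{v, w}. ?W x / real x powr \<alpha>)"
    using assms by simp
  also have "\<dots> \<le> (\<Sum>x\<in>{1..n}. ?W x / real x powr \<alpha>)"
    using assms W0 by (intro sum_mono2) auto
  also have "\<dots> = risk \<alpha> n (ranking_pmf c n)"
    using assms by (intro risk_eq[symmetric]) auto
  finally show ?thesis .
qed

lemma risk_ge_one_term:
  assumes "A \<subseteq> {1..n}" "1 \<le> n"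
  shows "(\<Sum>v\<in>A. avg n (displacement c n v) / real v powr \<alpha>) \<le> risk \<alpha> n (ranking_pmf c n)"
  unfolding risk_eq[OF assms(2)] using assms
  by (intro sum_mono2) (auto intro!: avg_nonneg displacement_nonneg divide_nonneg_nonneg)

context
  fixes c :: "nat pair_pre_digraph \<Rightarrow> nat \<Rightarrow> nat"
  assumes c: "\<And>f t x. bij f \<Longrightarrow> c (relabel f t) (f x) = c t x"
begin

text \<open>This settles \<open>\<alpha> > 2\<close> for the Jordan-2 score, and small \<open>n\<close> in all other cases.\<close>

lemma risk_bounded_below:
  assumes a: "\<alpha> > 0" and n: "2 \<le> n"
  shows "1 / (2 * 3 powr \<alpha>) \<le> risk \<alpha> n (ranking_pmf c n)"
proof (cases "n = 2")
  case True
  have two: "1 \<le> avg 2 (displacement c 2 1) + avg 2 (displacement c 2 2)"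
    by (rule avg_displacement_two) (rule c)
  have "1 / (2 * 3 powr \<alpha>) \<le> 1 / (real 2 powr \<alpha>)"
  proof (rule divide_left_mono)
    have "(2 :: real) powr \<alpha> \<le> 3 powr \<alpha>" using a by (intro powr_mono2) auto
    then show "real 2 powr \<alpha> \<le> 2 * 3 powr \<alpha>"
      using powr_ge_zero[of 3 \<alpha>] unfolding of_nat_numeral by linarith
  qed auto
  also have "\<dots> \<le> (avg 2 (displacement c 2 1) + avg 2 (displacement c 2 2)) / real 2 powr \<alpha>"
    using two by (intro divide_right_mono) (auto simp del: One_nat_def)
  also have "\<dots> \<le> risk \<alpha> n (ranking_pmf c n)"
    unfolding True using a by (intro risk_ge_two_terms) auto
  finally show ?thesis .
next
  case False
  have "1 / (2 * 3 powr \<alpha>) = (real 3 - real 2) * ((real 2 - 1)\<^sup>2 / ((real 3 - 1) * (real 3 - 2))) / real 3 powr \<alpha>"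
    by simp
  also have "\<dots> \<le> (avg n (displacement c n 2) + avg n (displacement c n 3)) / real 3 powr \<alpha>"
    using c n False by (intro divide_right_mono avg_displacement_pair_ge) auto
  also have "\<dots> \<le> risk \<alpha> n (ranking_pmf c n)"
    using a n False by (intro risk_ge_two_terms) auto
  finally show ?thesis .
qed

text \<open>Apply the exchange bound to the pairs \<open>v\<close> and \<open>2 v\<close>: the labels can be exchanged with probability at least
\<open>1/6\<close>, and each vertex occurs at most once as the smaller and once as the larger element of a pair.\<close>

lemma risk_ge_sum:
  assumes a: "\<alpha> > 0" and n: "2 \<le> n"
  shows "(\<Sum>v\<in>{2..n div 2}. real v * (2 * real v) powr - \<alpha>) / 12 \<le> risk \<alpha> n (ranking_pmf c n)"
proof -
  let ?W = "\<lambda>v. avg n (displacement c n v)" and ?r = "risk \<alpha> n (ranking_pmf c n)"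
  have W0: "0 \<le> ?W x" for x by (intro avg_nonneg displacement_nonneg)
  have "(\<Sum>v\<in>{2..n div 2}. real v * (2 * real v) powr - \<alpha>) / 6
      = (\<Sum>v\<in>{2..n div 2}. real v / 6 * (2 * real v) powr - \<alpha>)"
    by (simp add: sum_divide_distrib)
  also have "\<dots> \<le> (\<Sum>v\<in>{2..n div 2}. ?W v / real v powr \<alpha> + ?W (2 * v) / real (2 * v) powr \<alpha>)"
  proof (rule sum_mono)
    fix v assume v: "v \<in> {2..n div 2}"
    have "real v / 6 \<le> (real (2 * v) - real v) * ((real v - 1)\<^sup>2 / ((real (2 * v) - 1) * (real (2 * v) - 2)))"
    proof -
      have "(real v - 1)\<^sup>2 / ((2 * real v - 1) * (2 * real v - 2)) = (real v - 1) / (2 * (2 * real v - 1))"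
        using v by (simp add: power2_eq_square divide_simps) (simp add: algebra_simps)
      moreover have "1 / 6 \<le> (real v - 1) / (2 * (2 * real v - 1))"
        using v by (simp add: field_simps)
      ultimately have "real v * (1 / 6) \<le> real v * ((real v - 1)\<^sup>2 / ((2 * real v - 1) * (2 * real v - 2)))"
        by (intro mult_left_mono) auto
      then show ?thesis by simp
    qed
    also have "\<dots> \<le> ?W v + ?W (2 * v)"
      using v by (intro avg_displacement_pair_ge c) auto
    finally have "real v / 6 * (2 * real v) powr - \<alpha> \<le> (?W v + ?W (2 * v)) * (2 * real v) powr - \<alpha>"
      by (intro mult_right_mono) auto
    also have "\<dots> = ?W v / (2 * real v) powr \<alpha> + ?W (2 * v) / real (2 * v) powr \<alpha>"
      by (simp add: powr_minus_divide add_divide_distrib)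
    also have "\<dots> \<le> ?W v / real v powr \<alpha> + ?W (2 * v) / real (2 * v) powr \<alpha>"
      using v a W0 by (intro add_right_mono divide_left_mono powr_mono2) auto
    finally show "real v / 6 * (2 * real v) powr - \<alpha>
        \<le> ?W v / real v powr \<alpha> + ?W (2 * v) / real (2 * v) powr \<alpha>" .
  qed
  also have "\<dots> = (\<Sum>v\<in>{2..n div 2}. ?W v / real v powr \<alpha>)
      + (\<Sum>v\<in>{2..n div 2}. ?W (2 * v) / real (2 * v) powr \<alpha>)"
    by (rule sum.distrib)
  also have "(\<Sum>v\<in>{2..n div 2}. ?W (2 * v) / real (2 * v) powr \<alpha>)
      = (\<Sum>w\<in>(\<lambda>v. 2 * v) ` {2..n div 2}. ?W w / real w powr \<alpha>)"
    by (subst sum.reindex) (auto simp: inj_on_def)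
  also have "\<dots> \<le> ?r"
    using n by (intro risk_ge_one_term) auto
  also have "(\<Sum>v\<in>{2..n div 2}. ?W v / real v powr \<alpha>) \<le> ?r"
    using n by (intro risk_ge_one_term) auto
  finally show ?thesis by simp
qed

end

text \<open>Finitely many \<open>n\<close> only affect the constant, as long as the risk stays away from zero.\<close>

lemma eventually_ge_imp_ge:
  fixes r g :: "nat \<Rightarrow> real"
  assumes "0 < c0" "\<And>n. 2 \<le> n \<Longrightarrow> c0 \<le> r n"
    and "0 < c1" "\<And>n. n0 \<le> n \<Longrightarrow> 2 \<le> n \<Longrightarrow> c1 * g n \<le> r n"
  shows "\<exists>c>0. \<forall>n\<ge>2. c * g n \<le> r n"
proof -
  define B where "B = 1 + (\<Sum>n\<in>{2..<n0}. \<bar>g n\<bar>)"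
  have B: "1 \<le> B" by (simp add: B_def sum_nonneg)
  let ?c = "min c1 (c0 / B)"
  have "?c * g n \<le> r n" if n: "2 \<le> n" for n
  proof (cases "g n \<le> 0")
    case True
    then have "?c * g n \<le> 0"
      using assms B by (intro mult_nonneg_nonpos) auto
    then show ?thesis using assms(1) assms(2)[OF n] by linarith
  next
    case g: False
    show ?thesis
    proof (cases "n0 \<le> n")
      case True
      have "?c * g n \<le> c1 * g n"
        using g by (intro mult_right_mono) auto
      then show ?thesis using assms(4)[OF True n] by linarith
    next
      case False
      then have "\<bar>g n\<bar> \<le> (\<Sum>n\<in>{2..<n0}. \<bar>g n\<bar>)"
        using n by (intro member_le_sum) auto
      then have "g n \<le> B" by (simp add: B_def)
      have "?c * g n \<le> c0 / B * g n"
        using g by (intro mult_right_mono) auto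
      also have "\<dots> \<le> c0 / B * B"
        using \<open>g n \<le> B\<close> assms(1) B by (intro mult_left_mono) auto
      also have "\<dots> = c0" using B by simp
      finally show ?thesis using assms(2)[OF n] by linarith
    qed
  qed
  moreover have "0 < ?c" using assms B by simp
  ultimately show ?thesis by blast
qed

lemma sum_halves_ge:
  assumes a: "\<alpha> > 0" and n: "4 \<le> n"
  shows "real n powr (2 - \<alpha>) / 32 \<le> (\<Sum>v\<in>{2..n div 2}. real v * (2 * real v) powr - \<alpha>)"
proof -
  have "real n / 8 * (real n / 4 * real n powr - \<alpha>)
      \<le> real (card {n div 4<..n div 2}) * (real n / 4 * real n powr - \<alpha>)"
  proof (intro mult_right_mono)
    \<comment> \<open>The upper half \<open>(n/4, n/2]\<close> of the range has at least \<open>n / 8\<close> elements.\<close>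
    have "2 * (n div 4) \<le> n div 2"
      using div_times_less_eq_dividend[of n 4] by (simp add: less_eq_div_iff_mult_less_eq)
    moreover have "n < 4 * (n div 4) + 4" "1 \<le> n div 4"
      using dividend_less_times_div[of 4 n] n by (simp_all add: less_eq_div_iff_mult_less_eq)
    ultimately have "n \<le> 8 * (n div 2 - n div 4)" by linarith
    then have "real n \<le> 8 * real (n div 2 - n div 4)" by linarith
    then show "real n / 8 \<le> real (card {n div 4<..n div 2})" by simp
  qed auto
  also have "\<dots> = (\<Sum>v\<in>{n div 4<..n div 2}. real n / 4 * real n powr - \<alpha>)"
    by simp
  also have "\<dots> \<le> (\<Sum>v\<in>{n div 4<..n div 2}. real v * (2 * real v) powr - \<alpha>)"
  proof (intro sum_mono mult_mono)
    fix v assume v: "v \<in> {n div 4<..n div 2}"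
    then show "real n / 4 \<le> real v"
      using dividend_less_times_div[of 4 n] by simp
    show "real n powr - \<alpha> \<le> (2 * real v) powr - \<alpha>"
      using v a by (intro powr_mono2') auto
  qed auto
  also have "\<dots> \<le> (\<Sum>v\<in>{2..n div 2}. real v * (2 * real v) powr - \<alpha>)"
    using n by (intro sum_mono2) auto
  finally have "real n / 8 * (real n / 4 * real n powr - \<alpha>)
    \<le> (\<Sum>v\<in>{2..n div 2}. real v * (2 * real v) powr - \<alpha>)" .
  moreover have "real n powr (2 - \<alpha>) = real n * real n * real n powr - \<alpha>"
    using n by (simp add: powr_diff powr_minus_divide power2_eq_square)
  ultimately show ?thesis by simp
qed

lemma risk_ge_f_rate:
  assumes c: "\<And>f t x. bij f \<Longrightarrow> c (relabel f t) (f x) = c t x" and a: "\<alpha> > 0"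
  shows "\<exists>C>0. \<forall>n\<ge>2. C * f_rate \<alpha> n \<le> risk \<alpha> n (ranking_pmf c n)"
proof -
  have base: "0 < 1 / (2 * 3 powr \<alpha>)" by simp
  note below = risk_bounded_below[OF c a]
  note sum = risk_ge_sum[OF c a]
  consider "\<alpha> < 2" | "\<alpha> = 2" | "\<alpha> > 2" by linarith
  then show ?thesis
  proof cases
    case 1
    show ?thesis
    proof (rule eventually_ge_imp_ge[OF base below])
      show "0 < (1 / 384 :: real)" by simp
      fix n :: nat assume "4 \<le> n" "2 \<le> n"
      then show "1 / 384 * f_rate \<alpha> n \<le> risk \<alpha> n (ranking_pmf c n)"
        using sum_halves_ge[OF a, of n] sum[of n] 1 by (simp add: f_rate_def)
    qed
  next
    case 2
    show ?thesis
    proof (rule eventually_ge_imp_ge[OF base below])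
      show "0 < (1 / 96 :: real)" by simp
      fix n :: nat assume n: "16 \<le> n" "2 \<le> n"
      let ?M = "n div 2"
      have "ln (real n) / 2 \<le> ln (real (Suc ?M)) - ln 2"
      proof -
        have "ln 16 \<le> ln (real n)" using n by simp
        moreover have "ln (16 :: real) = 4 * ln 2"
          using ln_realpow[of "2 :: real" 4] by simp
        moreover have "ln (real n) - ln 2 \<le> ln (real (Suc ?M))"
        proof -
          have "real n / 2 \<le> real (Suc ?M)" by simp
          then have "ln (real n / 2) \<le> ln (real (Suc ?M))" using n by (subst ln_le_cancel_iff) auto
          then show ?thesis using n by (simp add: ln_div)
        qed
        ultimately show ?thesis by linarith
      qed
      also have "\<dots> \<le> (\<Sum>u\<in>{2<..Suc ?M}. 1 / (real u - 1))"
        using sum_inverse_ge[of 2 "Suc ?M"] n by simp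
      also have "\<dots> = (\<Sum>v\<in>{2..?M}. 1 / real v)"
        by (rule sum.reindex_bij_witness[of _ Suc "\<lambda>u. u - 1"]) auto
      also have "\<dots> = (\<Sum>v\<in>{2..?M}. 4 * (real v * (2 * real v) powr - \<alpha>))"
        using 2 by (intro sum.cong) (auto simp: powr_minus_divide power2_eq_square)
      finally have "ln (real n) / 8 \<le> (\<Sum>v\<in>{2..?M}. real v * (2 * real v) powr - \<alpha>)"
        by (simp add: sum_distrib_left[symmetric])
      then show "1 / 96 * f_rate \<alpha> n \<le> risk \<alpha> n (ranking_pmf c n)"
        using sum[of n] n 2 by (simp add: f_rate_def)
    qed
  next
    case 3
    then show ?thesis
      using below base by (intro exI[of _ "1 / (2 * 3 powr \<alpha>)"]) (auto simp: f_rate_def)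
  qed
qed

text \<open>For \<open>\<alpha> > 2\<close> the displacement of vertex \<open>2\<close> alone is of order \<open>log n\<close>. For \<open>\<alpha> = 2\<close> the
vertices up to the square root of \<open>n\<close> are used, as each of them has a displacement of order \<open>v log n\<close>.\<close>

lemma risk_jordan_ge_g_rate:
  assumes a: "\<alpha> > 0"
  shows "\<exists>C>0. \<forall>n\<ge>2. C * g_rate \<alpha> n \<le> risk \<alpha> n (ranking_pmf jordan n)"
proof -
  have base: "0 < 1 / (2 * 3 powr \<alpha>)" by simp
  note below = risk_bounded_below[OF jordan_relabel a]
  have large: "exp x \<le> real n" if "nat \<lceil>exp x\<rceil> \<le> n" for x :: real and n
    using that by linarith
  consider "\<alpha> < 2" | "\<alpha> = 2" | "\<alpha> > 2" by linarith
  then show ?thesis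
  proof cases
    case 1
    then have "g_rate \<alpha> = f_rate \<alpha>"
      by (auto simp: g_rate_def f_rate_def)
    then show ?thesis
      using risk_ge_f_rate[OF jordan_relabel a] by simp
  next
    case 2
    show ?thesis
    proof (rule eventually_ge_imp_ge[OF base below])
      show "0 < (1 / 64 :: real)" by simp
      fix n :: nat assume n: "nat \<lceil>exp (16 :: real)\<rceil> \<le> n" "2 \<le> n"
      define L where "L = ln (real n)"
      have L: "16 \<le> L"
        using large[OF n(1)] n(2) by (simp add: L_def ln_ge_iff)
      let ?M = "nat \<lfloor>sqrt (real n)\<rfloor>"
      have M: "real ?M \<le> sqrt (real n)" "sqrt (real n) \<le> real (Suc ?M)"
        by simp (simp, linarith)
      have lnsqrt: "ln (sqrt (real n)) = L / 2"
        using n by (simp add: L_def ln_sqrt)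
      have M_ge: "2 \<le> Suc ?M"
      proof -
        have "1 \<le> sqrt (real n)" using n by simp
        then show ?thesis by linarith
      qed
      have pos: "0 < sqrt (real n)" "0 < real (Suc ?M)"
        using n(2) M_ge by (simp_all only: real_sqrt_gt_0_iff of_nat_0_less_iff)
      have sqrt_le: "sqrt (real n) \<le> real n"
        using n by (intro real_le_lsqrt) (auto simp: power2_eq_square)
      have "L / 4 \<le> L / 2 - ln 2"
        using L ln_le_minus_one[of "2 :: real"] by simp
      also have "\<dots> \<le> ln (real (Suc ?M)) - ln 2"
        unfolding lnsqrt[symmetric] using M(2) pos by (intro diff_right_mono iffD2[OF ln_le_cancel_iff])
      also have "\<dots> \<le> (\<Sum>u\<in>{2<..Suc ?M}. 1 / (real u - 1))"
        using sum_inverse_ge[of 2 "Suc ?M"] M_ge by simp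
      also have "\<dots> = (\<Sum>v\<in>{2..?M}. 1 / real v)"
        by (rule sum.reindex_bij_witness[of _ Suc "\<lambda>u. u - 1"]) auto
      finally have "L / 16 * (L / 4) \<le> L / 16 * (\<Sum>v\<in>{2..?M}. 1 / real v)"
        using L by (intro mult_left_mono) auto
      also have "\<dots> = (\<Sum>v\<in>{2..?M}. L / 16 * (1 / real v))"
        by (rule sum_distrib_left)
      also have "\<dots> \<le> (\<Sum>v\<in>{2..?M}. avg n (displacement jordan n v) / real v powr \<alpha>)"
      proof (rule sum_mono)
        fix v assume v: "v \<in> {2..?M}"
        then have "real v \<le> sqrt (real n)" using M(1) by (meson atLeastAtMost_iff of_nat_le_iff order_trans)
        then have "ln (real v) \<le> L / 2"
          unfolding lnsqrt[symmetric] using v n by (subst ln_le_cancel_iff) auto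
        then have "(L - L / 2) / 4 \<le> (L - ln (real v)) / 4"
          by (intro divide_right_mono diff_left_mono) auto
        then have "L / 16 \<le> (L - ln (real v)) / 4 - 1"
          using L by (simp add: field_simps)
        then have "real v * (L / 16) \<le> real v * ((L - ln (real v)) / 4 - 1)"
          by (intro mult_left_mono) auto
        also have "\<dots> \<le> avg n (displacement jordan n v)"
          unfolding L_def using v \<open>real v \<le> sqrt (real n)\<close> sqrt_le by (intro avg_displacement_jordan_ge) auto
        finally have "real v * (L / 16) / real v powr 2 \<le> avg n (displacement jordan n v) / real v powr 2"
          by (rule divide_right_mono) simp
        then show "L / 16 * (1 / real v) \<le> avg n (displacement jordan n v) / real v powr \<alpha>"
          using v 2 by (simp add: power2_eq_square)
      qed
      also have "\<dots> \<le> risk \<alpha> n (ranking_pmf jordan n)"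
      proof (rule risk_ge_one_term)
        have "real ?M \<le> real n" using M(1) sqrt_le by linarith
        then show "{2..?M} \<subseteq> {1..n}" by auto
      qed (use n in auto)
      finally show "1 / 64 * g_rate \<alpha> n \<le> risk \<alpha> n (ranking_pmf jordan n)"
        using 2 by (simp add: g_rate_def L_def power2_eq_square)
    qed
  next
    case 3
    show ?thesis
    proof (rule eventually_ge_imp_ge[OF base below])
      show "0 < 1 / (4 * 2 powr \<alpha>)" by simp
      fix n :: nat assume n: "nat \<lceil>exp (16 :: real)\<rceil> \<le> n" "2 \<le> n"
      have L: "16 \<le> ln (real n)"
        using large[OF n(1)] n(2) by (simp add: ln_ge_iff)
      have "ln (real n) / 4 \<le> real 2 * ((ln (real n) - ln (real 2)) / 4 - 1)"
        using L ln_le_minus_one[of "2 :: real"] by (simp add: field_simps)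
      also have "\<dots> \<le> avg n (displacement jordan n 2)"
        using n by (intro avg_displacement_jordan_ge) auto
      finally have "ln (real n) / 4 / 2 powr \<alpha> \<le> avg n (displacement jordan n 2) / 2 powr \<alpha>"
        by (rule divide_right_mono) simp
      also have "\<dots> \<le> risk \<alpha> n (ranking_pmf jordan n)"
        using risk_ge_one_term[of "{2}" n jordan \<alpha>] n by simp
      finally show "1 / (4 * 2 powr \<alpha>) * g_rate \<alpha> n \<le> risk \<alpha> n (ranking_pmf jordan n)"
        using 3 by (simp add: g_rate_def)
    qed
  qed
qed

lemma risk_le:
  assumes n: "1 \<le> n"
    and W: "\<And>v. v \<in> {1..n} \<Longrightarrow> avg n (displacement c n v) \<le> a * real v * l v"
  shows "risk \<alpha> n (ranking_pmf c n) \<le> a * (\<Sum>v\<in>{1..n}. real v powr (1 - \<alpha>) * l v)"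
  unfolding risk_eq[OF n] sum_distrib_left
proof (rule sum_mono)
  fix v assume v: "v \<in> {1..n}"
  have "avg n (displacement c n v) / real v powr \<alpha> \<le> a * real v * l v / real v powr \<alpha>"
    using W[OF v] by (rule divide_right_mono) simp
  then show "avg n (displacement c n v) / real v powr \<alpha> \<le> a * (real v powr (1 - \<alpha>) * l v)"
    using v by (simp add: powr_diff)
qed

lemma risk_jordan2_le_f_rate:
  assumes a: "\<alpha> > 0"
  shows "\<exists>C>0. \<forall>n\<ge>2. risk \<alpha> n (ranking_pmf jordan2 n) \<le> C * f_rate \<alpha> n"
proof -
  obtain C where C: "C > 0" "\<And>n. 2 \<le> n \<Longrightarrow> (\<Sum>v\<in>{1..n}. real v powr (1 - \<alpha>)) \<le> C * f_rate \<alpha> n"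
    using sum_powr_le_f_rate[OF a] by blast
  have "risk \<alpha> n (ranking_pmf jordan2 n) \<le> 10 ^ 12 * C * f_rate \<alpha> n" if n: "2 \<le> n" for n
    using risk_le[of n jordan2 "10 ^ 12" "\<lambda>_. 1" \<alpha>] avg_displacement_jordan2_le[of _ n] C(2)[OF n] n
    by simp
  then show ?thesis
    using C(1) by (intro exI[of _ "10 ^ 12 * C"]) auto
qed

lemma risk_jordan_le_g_rate:
  assumes a: "\<alpha> > 0"
  shows "\<exists>C>0. \<forall>n\<ge>2. risk \<alpha> n (ranking_pmf jordan n) \<le> C * g_rate \<alpha> n"
proof -
  let ?l = "\<lambda>n v. 1 + (ln (real n) - ln (real v))"
  obtain C where C: "C > 0" "\<And>n. 2 \<le> n \<Longrightarrow> (\<Sum>v\<in>{1..n}. real v powr (1 - \<alpha>) * ?l n v) \<le> C * g_rate \<alpha> n"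
    using sum_powr_ln_le_g_rate[OF a] by blast
  have "risk \<alpha> n (ranking_pmf jordan n) \<le> 16 * C * g_rate \<alpha> n" if n: "2 \<le> n" for n
    using risk_le[of n jordan 16 "?l n" \<alpha>, OF _ avg_displacement_jordan_le] C(2)[OF n] n by simp
  then show ?thesis
    using C(1) by (intro exI[of _ "16 * C"]) auto
qed

theorem corollary1p7:
  fixes \<alpha> :: real
  assumes "\<alpha> > 0"
  shows "\<exists>C>0. \<forall>n\<ge>2.
    1 / C * f_rate \<alpha> n \<le> risk \<alpha> n (ranking_pmf jordan2 n) \<and>
    risk \<alpha> n (ranking_pmf jordan2 n) \<le> C * f_rate \<alpha> n \<and>
    1 / C * g_rate \<alpha> n \<le> risk \<alpha> n (ranking_pmf jordan n) \<and>
    risk \<alpha> n (ranking_pmf jordan n) \<le> C * g_rate \<alpha> n"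
proof -
  obtain c1 where c1: "c1 > 0" "\<And>n. 2 \<le> n \<Longrightarrow> c1 * f_rate \<alpha> n \<le> risk \<alpha> n (ranking_pmf jordan2 n)"
    using risk_ge_f_rate[OF jordan2_relabel assms] by blast
  obtain c2 where c2: "c2 > 0" "\<And>n. 2 \<le> n \<Longrightarrow> risk \<alpha> n (ranking_pmf jordan2 n) \<le> c2 * f_rate \<alpha> n"
    using risk_jordan2_le_f_rate[OF assms] by blast
  obtain c3 where c3: "c3 > 0" "\<And>n. 2 \<le> n \<Longrightarrow> c3 * g_rate \<alpha> n \<le> risk \<alpha> n (ranking_pmf jordan n)"
    using risk_jordan_ge_g_rate[OF assms] by blast
  obtain c4 where c4: "c4 > 0" "\<And>n. 2 \<le> n \<Longrightarrow> risk \<alpha> n (ranking_pmf jordan n) \<le> c4 * g_rate \<alpha> n"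
    using risk_jordan_le_g_rate[OF assms] by blast
  define C where "C = max (max (1 / c1) (1 / c3)) (max c2 c4)"
  have C: "1 / c1 \<le> C" "1 / c3 \<le> C" "c2 \<le> C" "c4 \<le> C"
    by (auto simp: C_def)
  then have pos: "0 < C" using c2(1) by linarith
  have inv: "1 / C \<le> c1" "1 / C \<le> c3"
    using C(1,2) c1(1) c3(1) pos by (simp_all add: field_simps)
  have rate: "0 \<le> f_rate \<alpha> n" "0 \<le> g_rate \<alpha> n" if "2 \<le> n" for n
    using that by (auto simp: f_rate_def g_rate_def)
  have "1 / C * f_rate \<alpha> n \<le> c1 * f_rate \<alpha> n \<and> c2 * f_rate \<alpha> n \<le> C * f_rate \<alpha> n \<and>
    1 / C * g_rate \<alpha> n \<le> c3 * g_rate \<alpha> n \<and> c4 * g_rate \<alpha> n \<le> C * g_rate \<alpha> n" if "2 \<le> n" for n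
    using rate[OF that] inv C by (intro conjI mult_right_mono)
  then show ?thesis
    using pos c1(2) c2(2) c3(2) c4(2) by (intro exI[of _ C]) (meson order.trans)
qed

end
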